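(* Let $\mathcal B=(B,X,p,F)$ and $\mathcal B'=(B',X',p',F)$ be definable fibre bundles with the same fibre, let $f\colon\mathcal B\to\mathcal B'$ be a definable bundle map with induced map $\bar f\colon X\to X'$ on the base spaces, and let $\tilde h\colon X\times I\to X'$ be a definable homotopy with $\tilde h_0=\bar f$. Then there is a homotopy of definable bundle maps $h\colon B\times I\to B'$ with $h_0=f$ whose induced homotopy on the base spaces is $\tilde h$. Moreover, $h$ can be chosen to be stationary with $\tilde h$.
   Context: Fix an o-minimal expansion $\mathcal M$ of a real closed field $R$; "definable" means definable in $\mathcal M$ with parameters, with order/product/subspace topologies. A definable map is a continuous definable function; $I=[0,1]\subset R$; a definable homotopy is a definable map with domain of the form $Z\times I$, and $h_t$ denotes $h(-,t)$. A definable fibre bundle $(B,X,p,F)$ consists of definable sets $B,X,F$ and a surjective definable map $p\colon B\to X$ such that there is a finite covering of $X$ by open definable sets $U_i$ with definable homeomorphisms $\phi_i\colon U_i\times F\to p^{-1}(U_i)$. A definable bundle map $f\colon(B,X,p,F)\to(B',X',p',F)$ is a definable map $f\colon B\to B'$ for which there is a definable map $\bar f\colon X\to X'$ with $p'\circ f=\bar f\circ p$ and such that for every $x\in X$, $f|_{p^{-1}(x)}$ is a homeomorphism onto $p'^{-1}(\bar f(x))$. A homotopy of definable bundle maps is a definable map $h\colon B\times I\to B'$ such that each $h_t$ is a definable bundle map; its induced homotopy on the base spaces is $\bar h\colon X\times I\to X'$, $(x,t)\mapsto \overline{h_t}(x)$. The homotopy $h$ is stationary with $\bar h$ if for every subinterval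 $[t_1,t_2]\subseteq I$ and every $x\in B$, $h|_{\{x\}\times[t_1,t_2]}$ is constant if and only if $\bar h|_{\{p(x)\}\times[t_1,t_2]}$ is constant. *)

theory Defs
  imports "HOL-Analysis.Analysis"
begin

section \<open>Real closed fields\<close>

class real_closed_field = linordered_field +
  assumes pos_has_root: "0 < a \<Longrightarrow> \<exists>b. b * b = a"
    and odd_poly_has_root: "odd n \<Longrightarrow> c n \<noteq> 0 \<Longrightarrow> \<exists>x. (\<Sum>k\<le>n. c k * x ^ k) = 0"

section \<open>First-order definability with parameters\<close>

text \<open>
  An expansion of the ordered field \<open>'a\<close> interprets further function symbols \<open>'f\<close> and relation
  symbols \<open>'r\<close>. Symbols are interpreted on argument lists of every length; a symbol of fixed
  arity is one whose interpretation is constant on lists of any other length, which does not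
  change the definable sets.
\<close>

datatype ('a, 'f, 'r) expansion =
  Expansion (fun_of: "'f \<Rightarrow> 'a list \<Rightarrow> 'a") (rel_of: "'r \<Rightarrow> 'a list \<Rightarrow> bool")

datatype ('a, 'f) fo_term =
    Var nat
  | Param 'a
  | Plus "('a, 'f) fo_term" "('a, 'f) fo_term"
  | Times "('a, 'f) fo_term" "('a, 'f) fo_term"
  | Fun 'f "('a, 'f) fo_term list"

datatype ('a, 'f, 'r) formula =
    Equal "('a, 'f) fo_term" "('a, 'f) fo_term"
  | Less "('a, 'f) fo_term" "('a, 'f) fo_term"
  | Rel 'r "('a, 'f) fo_term list"
  | Neg "('a, 'f, 'r) formula"
  | Conj "('a, 'f, 'r) formula" "('a, 'f, 'r) formula"
  | Exists nat "('a, 'f, 'r) formula"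

primrec eval :: "('a::linordered_field, 'f, 'r) expansion \<Rightarrow> (nat \<Rightarrow> 'a) \<Rightarrow> ('a, 'f) fo_term \<Rightarrow> 'a"
  where
    "eval M e (Var i) = e i"
  | "eval M e (Param a) = a"
  | "eval M e (Plus s t) = eval M e s + eval M e t"
  | "eval M e (Times s t) = eval M e s * eval M e t"
  | "eval M e (Fun f ts) = fun_of M f (map (eval M e) ts)"

primrec sat :: "('a::linordered_field, 'f, 'r) expansion \<Rightarrow> (nat \<Rightarrow> 'a) \<Rightarrow> ('a, 'f, 'r) formula \<Rightarrow> bool"
  where
    "sat M e (Equal s t) \<longleftrightarrow> eval M e s = eval M e t"
  | "sat M e (Less s t) \<longleftrightarrow> eval M e s < eval M e t"
  | "sat M e (Rel r ts) \<longleftrightarrow> rel_of M r (map (eval M e) ts)"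
  | "sat M e (Neg \<phi>) \<longleftrightarrow> \<not> sat M e \<phi>"
  | "sat M e (Conj \<phi> \<psi>) \<longleftrightarrow> sat M e \<phi> \<and> sat M e \<psi>"
  | "sat M e (Exists i \<phi>) \<longleftrightarrow> (\<exists>a. sat M (e(i := a)) \<phi>)"

text \<open>
  \<open>R\<^sup>n\<close> consists of the functions on \<open>{..<n}\<close> that are \<open>undefined\<close> elsewhere. A subset
  of \<open>R\<^sup>n\<close> carries its ambient dimension \<open>n\<close> with it.
\<close>

abbreviation Rn :: "nat \<Rightarrow> (nat \<Rightarrow> 'a) set"
  where "Rn n \<equiv> PiE {..<n} (\<lambda>_. UNIV)"

datatype 'a rset = RSet (dim: nat) (pts: "(nat \<Rightarrow> 'a) set")

definition top_of :: "'a::topological_space rset \<Rightarrow> (nat \<Rightarrow> 'a) topology"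
  where "top_of A = subtopology (product_topology (\<lambda>_. euclidean) {..<dim A}) (pts A)"

text \<open>
  Free variables of \<open>\<phi>\<close> with index at least \<open>dim A\<close> are evaluated to the fixed element
  \<open>undefined\<close> of \<open>R\<close>, i.e. they act as additional parameters.
\<close>

definition definable :: "('a::linordered_field, 'f, 'r) expansion \<Rightarrow> 'a rset \<Rightarrow> bool"
  where "definable M A \<longleftrightarrow> (\<exists>\<phi>. pts A = {x \<in> Rn (dim A). sat M x \<phi>})"

definition vec1 :: "'a \<Rightarrow> nat \<Rightarrow> 'a"
  where "vec1 t = (\<lambda>i\<in>{..<1}. t)"

definition point_or_open_interval :: "'a::linorder set \<Rightarrow> bool"
  where "point_or_open_interval J \<longleftrightarrow>
    (\<exists>a. J = {a}) \<or> (\<exists>a b. J = {a<..<b}) \<or> (\<exists>a. J = {a<..}) \<or> (\<exists>b. J = {..<b}) \<or> J = UNIV"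

definition o_minimal :: "('a::linordered_field, 'f, 'r) expansion \<Rightarrow> bool"
  where "o_minimal M \<longleftrightarrow>
    (\<forall>A. dim A = 1 \<and> definable M A \<longrightarrow>
      (\<exists>\<J>. finite \<J> \<and> (\<forall>J\<in>\<J>. point_or_open_interval J) \<and> {t. vec1 t \<in> pts A} = \<Union>\<J>))"

section \<open>Definable maps\<close>

text \<open>
  Products are formed by concatenating coordinates, \<open>R\<^sup>n \<times> R\<^sup>m\<close> being identified
  with \<open>R\<^sup>n\<^sup>+\<^sup>m\<close>. If \<open>x \<in> Rn n\<close> and \<open>y \<in> Rn m\<close> then \<open>cat n x y \<in> Rn (n + m)\<close>.
\<close>

definition cat :: "nat \<Rightarrow> (nat \<Rightarrow> 'a) \<Rightarrow> (nat \<Rightarrow> 'a) \<Rightarrow> nat \<Rightarrow> 'a"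
  where "cat n x y = (\<lambda>i. if i < n then x i else y (i - n))"

definition rprod :: "'a rset \<Rightarrow> 'a rset \<Rightarrow> 'a rset"  (infixr "\<otimes>" 70)
  where "A \<otimes> B = RSet (dim A + dim B) {cat (dim A) x y | x y. x \<in> pts A \<and> y \<in> pts B}"

definition graph_of :: "'a rset \<Rightarrow> 'a rset \<Rightarrow> ((nat \<Rightarrow> 'a) \<Rightarrow> nat \<Rightarrow> 'a) \<Rightarrow> 'a rset"
  where "graph_of A B f = RSet (dim A + dim B) {cat (dim A) x (f x) | x. x \<in> pts A}"

definition definable_map ::
    "('a::{linordered_field, linorder_topology}, 'f, 'r) expansion \<Rightarrow> 'a rset \<Rightarrow> 'a rset
      \<Rightarrow> ((nat \<Rightarrow> 'a) \<Rightarrow> nat \<Rightarrow> 'a) \<Rightarrow> bool"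
  where "definable_map M A B f \<longleftrightarrow>
    definable M A \<and> definable M B \<and> definable M (graph_of A B f) \<and>
    continuous_map (top_of A) (top_of B) f"

definition definable_homeo ::
    "('a::{linordered_field, linorder_topology}, 'f, 'r) expansion \<Rightarrow> 'a rset \<Rightarrow> 'a rset
      \<Rightarrow> ((nat \<Rightarrow> 'a) \<Rightarrow> nat \<Rightarrow> 'a) \<Rightarrow> bool"
  where "definable_homeo M A B f \<longleftrightarrow>
    definable_map M A B f \<and> homeomorphic_map (top_of A) (top_of B) f"

definition unit_I :: "'a::linordered_field rset"
  where "unit_I = RSet 1 (vec1 ` {0..1})"

text \<open>\<open>slice Z h t\<close> is \<open>h\<^sub>t\<close> for \<open>h\<close> defined on \<open>Z \<otimes> unit_I\<close>.\<close>

definition slice :: "'a rset \<Rightarrow> ((nat \<Rightarrow> 'a) \<Rightarrow> nat \<Rightarrow> 'a) \<Rightarrow> 'a \<Rightarrow> (nat \<Rightarrow> 'a) \<Rightarrow> nat \<Rightarrow> 'a"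
  where "slice Z h t = (\<lambda>x. h (cat (dim Z) x (vec1 t)))"

section \<open>Definable fibre bundles\<close>

type_synonym 'a fbundle = "'a rset \<times> 'a rset \<times> ((nat \<Rightarrow> 'a) \<Rightarrow> nat \<Rightarrow> 'a) \<times> 'a rset"

definition preim :: "'a rset \<Rightarrow> ((nat \<Rightarrow> 'a) \<Rightarrow> nat \<Rightarrow> 'a) \<Rightarrow> (nat \<Rightarrow> 'a) set \<Rightarrow> 'a rset"
  where "preim B p U = RSet (dim B) {b \<in> pts B. p b \<in> U}"

text \<open>The last conjunct is the usual requirement that local trivialisations lie over the base.\<close>

fun definable_fibre_bundle ::
    "('a::{linordered_field, linorder_topology}, 'f, 'r) expansion \<Rightarrow> 'a fbundle \<Rightarrow> bool"
  where "definable_fibre_bundle M (B, X, p, F) \<longleftrightarrow>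
    definable M F \<and> definable_map M B X p \<and> p ` pts B = pts X \<and>
    (\<exists>\<U>. finite \<U> \<and> \<Union>\<U> = pts X \<and>
      (\<forall>U\<in>\<U>. definable M (RSet (dim X) U) \<and> openin (top_of X) U \<and>
        (\<exists>\<phi>. definable_homeo M (RSet (dim X) U \<otimes> F) (preim B p U) \<phi> \<and>
          (\<forall>x\<in>U. \<forall>v\<in>pts F. p (\<phi> (cat (dim X) x v)) = x))))"

text \<open>\<open>bundle_map_over M \<B> \<B>' f g\<close>: \<open>f\<close> is a definable bundle map with induced map \<open>g\<close> on the bases.\<close>

fun bundle_map_over ::
    "('a::{linordered_field, linorder_topology}, 'f, 'r) expansion \<Rightarrow> 'a fbundle \<Rightarrow> 'a fbundle
      \<Rightarrow> ((nat \<Rightarrow> 'a) \<Rightarrow> nat \<Rightarrow> 'a) \<Rightarrow> ((nat \<Rightarrow> 'a) \<Rightarrow> nat \<Rightarrow> 'a) \<Rightarrow> bool"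
  where "bundle_map_over M (B, X, p, F) (B', X', p', F') f g \<longleftrightarrow>
    definable_map M B B' f \<and> definable_map M X X' g \<and>
    (\<forall>b\<in>pts B. p' (f b) = g (p b)) \<and>
    (\<forall>x\<in>pts X. homeomorphic_map (top_of (preim B p {x})) (top_of (preim B' p' {g x})) f)"

fun bundle_homotopy ::
    "('a::{linordered_field, linorder_topology}, 'f, 'r) expansion \<Rightarrow> 'a fbundle \<Rightarrow> 'a fbundle
      \<Rightarrow> ((nat \<Rightarrow> 'a) \<Rightarrow> nat \<Rightarrow> 'a) \<Rightarrow> bool"
  where "bundle_homotopy M (B, X, p, F) (B', X', p', F') h \<longleftrightarrow>
    definable_map M (B \<otimes> unit_I) B' h \<and>
    (\<forall>t\<in>{0..1}. \<exists>g. bundle_map_over M (B, X, p, F) (B', X', p', F') (slice B h t) g)"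

text \<open>
  As \<open>p\<close> is surjective, the map \<open>g\<close> in \<^const>\<open>bundle_map_over\<close> is determined on \<open>X\<close>; hence
  the following says that \<open>k\<close> agrees on \<open>X \<times> I\<close> with the induced homotopy of \<open>h\<close>.
\<close>

fun induced_homotopy ::
    "('a::{linordered_field, linorder_topology}, 'f, 'r) expansion \<Rightarrow> 'a fbundle \<Rightarrow> 'a fbundle
      \<Rightarrow> ((nat \<Rightarrow> 'a) \<Rightarrow> nat \<Rightarrow> 'a) \<Rightarrow> ((nat \<Rightarrow> 'a) \<Rightarrow> nat \<Rightarrow> 'a) \<Rightarrow> bool"
  where "induced_homotopy M (B, X, p, F) (B', X', p', F') h k \<longleftrightarrow>
    (\<forall>t\<in>{0..1}. bundle_map_over M (B, X, p, F) (B', X', p', F') (slice B h t) (slice X k t))"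

fun stationary_with ::
    "'a::linordered_field fbundle \<Rightarrow> ((nat \<Rightarrow> 'a) \<Rightarrow> nat \<Rightarrow> 'a) \<Rightarrow> ((nat \<Rightarrow> 'a) \<Rightarrow> nat \<Rightarrow> 'a) \<Rightarrow> bool"
  where "stationary_with (B, X, p, F) h k \<longleftrightarrow>
    (\<forall>t\<^sub>1 t\<^sub>2. 0 \<le> t\<^sub>1 \<and> t\<^sub>1 \<le> t\<^sub>2 \<and> t\<^sub>2 \<le> 1 \<longrightarrow>
      (\<forall>x\<in>pts B. (\<lambda>t. slice B h t x) constant_on {t\<^sub>1..t\<^sub>2} \<longleftrightarrow>
        (\<lambda>t. slice X k t (p x)) constant_on {t\<^sub>1..t\<^sub>2}))"

end

theory Submission
  imports Defs
begin

text \<open>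
  As in Steenrod's covering homotopy theorem, the lift is built in finitely many steps, each of which
  transports fibres inside one trivialising chart \<open>V\<close> of the target: if \<open>h\<close> lifts the homotopy
  stopped at time \<open>S x\<close> and the path over \<open>x\<close> stays in \<open>V\<close> between the times \<open>S x\<close> and \<open>S' x\<close>, keep the
  \<open>V\<close>-coordinate in the fibre fixed during that time. Nothing moves while the path in the base rests,
  so the lift is stationary with the homotopy.

  That finitely many steps suffice needs o-minimality, since the parameter space is not compact and \<open>R\<close> may
  be non-archimedean. The boundary points of the preimages of the charts in \<open>{x} \<times> I\<close> are given by
  finitely many definable functions of \<open>x\<close> (uniform finiteness), each of which agrees piecewise with
  definable functions continuous on open subsets of \<open>R\<^sup>n\<close>. This is proved without cell decomposition: a definable
  analogue of the Baire property on cubes gives generic continuity by induction on the dimension, and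
  a definable set without interior lies in finitely many graphs, which are treated as
  parametrised by sets of lower dimension.
\<close>

section \<open>Definable predicates and functions\<close>

text \<open>Three obstacles shape the construction. The sets \<open>pts X\<close> and
  \<open>pts B\<close> need be neither open nor connected, so boundary functions, time functions and
  the domains of subdivisions live on open subsets of all of R^n and are restricted to X only when
  the lift is built. There are no connected components to count, so bounds come from a statement
  about counting functions: a function into the natural numbers with definable level sets that is
  locally constant on a definable set takes finitely many values there. Applied to the number of
  points of a finite fibre it yields uniform finiteness; to prove it one dimension higher, uniform
  finiteness and piecewise continuity are needed one dimension lower, so all these properties share
  one induction. Finally, the finitely many open domains in X carry unrelated subdivisions of I,
  which must be reconciled: the stopping time \<open>S\<close> is a continuous function on X, raised
  domain by domain under a cutoff. Where the cutoff vanishes nothing happens, and at each point of X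
  some cutoff equals 1, so \<open>S = 1\<close> in the end. The cutoffs need not add up to 1; only
  their maximum counts.\<close>

lemma cong_below_pair:
  assumes "\<exists>N::nat. \<forall>e e'. (\<forall>i<N. e i = e' i) \<longrightarrow> F e = F e'"
    and "\<exists>N. \<forall>e e'. (\<forall>i<N. e i = e' i) \<longrightarrow> G e = G e'"
  shows "\<exists>N. \<forall>e e'. (\<forall>i<N. e i = e' i) \<longrightarrow> H (F e) (G e) = H (F e') (G e')"
proof -
  obtain N K where "\<forall>e e'. (\<forall>i<N. e i = e' i) \<longrightarrow> F e = F e'"
    "\<forall>e e'. (\<forall>i<K. e i = e' i) \<longrightarrow> G e = G e'" using assms by blast
  then show ?thesis by (intro exI[of _ "max N K"] allI impI arg_cong2[of _ _ _ _ H]) (simp_all add: less_max_iff_disj)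
qed

lemma cong_below_list:
  assumes "\<And>t. t \<in> set ts \<Longrightarrow> \<exists>N::nat. \<forall>e e'. (\<forall>i<N. e i = e' i) \<longrightarrow> F e t = F e' t"
  shows "\<exists>N. \<forall>e e'. (\<forall>i<N. e i = e' i) \<longrightarrow> map (F e) ts = map (F e') ts"
  using assms
proof (induction ts)
  case (Cons t ts)
  show ?case unfolding list.map
    by (rule cong_below_pair[of "\<lambda>e. F e t" "\<lambda>e. map (F e) ts" "(#)"]; use Cons in simp)
qed simp

lemma eval_cong_below: "\<exists>N. \<forall>e e'. (\<forall>i<N. e i = e' i) \<longrightarrow> eval M e t = eval M e' t"
proof (induction t)
  case (Var x)
  show ?case by (rule exI[of _ "Suc x"]) auto
next
  case (Param x)
  show ?case by auto
next
  case (Plus s t)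
  from cong_below_pair[OF this, of "(+)"] show ?case by simp
next
  case (Times s t)
  from cong_below_pair[OF this, of "(*)"] show ?case by simp
next
  case (Fun f ts)
  then have "\<exists>N. \<forall>e e'. (\<forall>i<N. e i = e' i) \<longrightarrow> map (eval M e) ts = map (eval M e') ts"
    by (rule cong_below_list)
  then obtain N where "\<And>e e'. (\<forall>i<N. e i = e' i) \<Longrightarrow> map (eval M e) ts = map (eval M e') ts" by blast
  then have "eval M e (Fun f ts) = eval M e' (Fun f ts)" if "\<forall>i<N. e i = e' i" for e e'
    using that by (simp only: eval.simps)
  then show ?case by blast
qed

text \<open>A formula reads finitely many variables. This makes fresh variables available, and it
  lets infinite environments stand for tuples of an unspecified finite length.\<close>

lemma sat_cong_below: "\<exists>N. \<forall>e e'. (\<forall>i<N. e i = e' i) \<longrightarrow> sat M e \<phi> = sat M e' \<phi>"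
proof (induction \<phi>)
  case (Equal s t)
  show ?case
    by (simp only: sat.simps) (rule cong_below_pair[OF eval_cong_below eval_cong_below])
next
  case (Less s t)
  show ?case
    by (simp only: sat.simps) (rule cong_below_pair[OF eval_cong_below eval_cong_below])
next
  case (Rel r ts)
  obtain N where "\<And>e e'. (\<forall>i<N. e i = e' i) \<Longrightarrow> map (eval M e) ts = map (eval M e') ts"
    using cong_below_list[of ts "eval M", OF eval_cong_below] by blast
  then have "sat M e (Rel r ts) = sat M e' (Rel r ts)" if "\<forall>i<N. e i = e' i" for e e'
    using that by (simp only: sat.simps)
  then show ?case by blast
next
  case (Neg \<phi>)
  then show ?case by simp
next
  case (Conj \<phi> \<psi>)
  from cong_below_pair[OF this, of "(\<and>)"] show ?case by simp
next
  case (Exists k \<phi>)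
  then obtain N where N: "\<And>e e'. (\<forall>i<N. e i = e' i) \<Longrightarrow> sat M e \<phi> = sat M e' \<phi>" by blast
  have "sat M (e(k := a)) \<phi> = sat M (e'(k := a)) \<phi>" if "\<forall>i<N. e i = e' i" for e e' a
    using that by (intro N) auto
  then show ?case by (intro exI[of _ N]) auto
qed

section \<open>Substitution of terms for variables\<close>

primrec tsubst :: "(nat \<Rightarrow> ('a, 'f) fo_term) \<Rightarrow> ('a, 'f) fo_term \<Rightarrow> ('a, 'f) fo_term" where
  "tsubst \<theta> (Var i) = \<theta> i"
| "tsubst \<theta> (Param a) = Param a"
| "tsubst \<theta> (Plus s t) = Plus (tsubst \<theta> s) (tsubst \<theta> t)"
| "tsubst \<theta> (Times s t) = Times (tsubst \<theta> s) (tsubst \<theta> t)"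
| "tsubst \<theta> (Fun f ts) = Fun f (map (tsubst \<theta>) ts)"

lemma eval_tsubst: "eval M e (tsubst \<theta> t) = eval M (\<lambda>i. eval M e (\<theta> i)) t"
  by (induction t) (auto cong: map_cong simp: comp_def)

text \<open>Only the existence of \<open>\<psi>\<close> is claimed: bound variables of
  \<open>\<phi>\<close> must be renamed to avoid capture, and the new names depend on
  \<open>\<theta>\<close>, over which the induction therefore generalises.\<close>

lemma sat_subst: "\<exists>\<psi>. \<forall>e. sat M e \<psi> = sat M (\<lambda>i. eval M e (\<theta> i)) \<phi>"
proof (induction \<phi> arbitrary: \<theta>)
  case (Equal s t)
  show ?case by (rule exI[of _ "Equal (tsubst \<theta> s) (tsubst \<theta> t)"]) (simp add: eval_tsubst)
next
  case (Less s t)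
  show ?case by (rule exI[of _ "Less (tsubst \<theta> s) (tsubst \<theta> t)"]) (simp add: eval_tsubst)
next
  case (Rel r ts)
  show ?case by (rule exI[of _ "Rel r (map (tsubst \<theta>) ts)"]) (simp add: eval_tsubst comp_def)
next
  case (Neg \<phi>)
  then show ?case by (metis sat.simps(4))
next
  case (Conj \<phi> \<psi>)
  then show ?case by (metis sat.simps(5))
next
  case (Exists i \<phi>)
  obtain N where N: "\<And>e e'. (\<forall>i<N. e i = e' i) \<Longrightarrow> sat M e \<phi> = sat M e' \<phi>"
    using sat_cong_below by blast
  obtain K where K: "\<And>j e e'. (\<forall>i<K j. e i = e' i) \<Longrightarrow> eval M e (\<theta> j) = eval M e' (\<theta> j)"
    using choice[of "\<lambda>j N. \<forall>e e'. (\<forall>i<N. e i = e' i) \<longrightarrow> eval M e (\<theta> j) = eval M e' (\<theta> j)"]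
      eval_cong_below[of M] by blast
  \<comment> \<open>The sum dominates each \<open>K j\<close> with \<open>j < N\<close>, so no term
    substituted for a variable that \<open>\<phi>\<close> reads depends on variable
    \<open>k\<close>: binding it captures nothing.\<close>
  define k where "k = (\<Sum>j<N. K j)"
  have k: "K j \<le> k" if "j < N" for j
    unfolding k_def using that by (intro member_le_sum) auto
  obtain \<psi> where \<psi>: "\<And>e. sat M e \<psi> = sat M (\<lambda>j. eval M e ((\<theta>(i := Var k)) j)) \<phi>"
    using Exists by blast
  have "sat M (e(k := a)) \<psi> = sat M ((\<lambda>j. eval M e (\<theta> j))(i := a)) \<phi>" for e a
    unfolding \<psi> by (intro N allI impI) (auto intro!: K dest: k)
  then show ?case by (intro exI[of _ "Exists k \<psi>"]) simp
qed

text \<open>Under a quantifier, \<open>e 0\<close> is the bound element and \<open>etl e\<close> the outer environment, as for de Bruijn indices.\<close>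

definition etl :: "(nat \<Rightarrow> 'a) \<Rightarrow> nat \<Rightarrow> 'a" where "etl e = (\<lambda>n. e (Suc n))"
definition scons :: "'a \<Rightarrow> (nat \<Rightarrow> 'a) \<Rightarrow> nat \<Rightarrow> 'a" where "scons a e = case_nat a e"

lemma scons_simps [simp]: "scons a e 0 = a" "scons a e (Suc n) = e n"
  by (simp_all add: scons_def)

lemma etl_scons [simp]: "etl (scons a e) = e"
  by (simp add: etl_def)

lemma scons_etl [simp]: "scons (e 0) (etl e) = e"
  by (auto simp: scons_def etl_def fun_eq_iff split: nat.split)

lemma etl_apply [simp]: "etl e n = e (Suc n)"
  by (simp add: etl_def)

text \<open>\<open>THE\<close> alone returns an unspecified value, depending on the predicate, when
  there is no unique witness. The default 0 makes the selected value first-order in the parameters,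
  as \<open>eq_the1_iff\<close> spells out.\<close>

definition the1 :: "('a::zero \<Rightarrow> bool) \<Rightarrow> 'a" where
  "the1 P = (if \<exists>!a. P a then THE a. P a else 0)"

lemma the1_equality: "P a \<Longrightarrow> (\<And>b. P b \<Longrightarrow> b = a) \<Longrightarrow> the1 P = a"
  unfolding the1_def by (metis the_equality)

lemma eq_the1_iff: "a = the1 P \<longleftrightarrow> (P a \<and> (\<forall>b. P b \<longrightarrow> b = a)) \<or> (\<not> (\<exists>c. P c \<and> (\<forall>b. P b \<longrightarrow> b = c)) \<and> a = 0)"
proof (cases "\<exists>!a. P a")
  case True
  then obtain c where c: "P c" "\<And>b. P b \<Longrightarrow> b = c" by blast
  with the1_equality[of P c] have "the1 P = c" by blast
  with c show ?thesis by metis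
next
  case False
  then have "the1 P = 0" by (simp add: the1_def)
  then show ?thesis using False by (metis (full_types))
qed

locale o_minimal_expansion =
  fixes M :: "('a::{linordered_field, linorder_topology}, 'f, 'r) expansion"
  assumes o_minimal: "o_minimal M"
begin

text \<open>Predicates on infinite environments instead of subsets of \<open>Rn n\<close>: no arity
  has to be tracked, weakening is free, and definable functions, vectors and families compose like
  functions of HOL.\<close>

definition dpred :: "((nat \<Rightarrow> 'a) \<Rightarrow> bool) \<Rightarrow> bool" where
  "dpred P \<longleftrightarrow> (\<exists>\<phi>. \<forall>e. sat M e \<phi> = P e)"

definition dfun :: "((nat \<Rightarrow> 'a) \<Rightarrow> 'a) \<Rightarrow> bool" where
  "dfun g \<longleftrightarrow> dpred (\<lambda>e. e 0 = g (etl e))"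

definition dvec :: "((nat \<Rightarrow> 'a) \<Rightarrow> nat \<Rightarrow> 'a) \<Rightarrow> bool" where
  "dvec v \<longleftrightarrow> (\<forall>i. dfun (\<lambda>e. v e i))"

definition dfam :: "((nat \<Rightarrow> 'a) \<Rightarrow> 'a set) \<Rightarrow> bool" where
  "dfam A \<longleftrightarrow> dpred (\<lambda>e. e 0 \<in> A (etl e))"

lemma dpred_cong_below:
  assumes "dpred P"
  obtains N where "\<And>e e'. (\<And>i. i < N \<Longrightarrow> e i = e' i) \<Longrightarrow> P e = P e'"
  using assms sat_cong_below[of M] unfolding dpred_def by metis

lemma dpred_subst: "dpred P \<Longrightarrow> dpred (\<lambda>e. P (\<lambda>i. eval M e (\<theta> i)))"
  unfolding dpred_def using sat_subst[of M] by metis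

lemma dpred_rename: "dpred P \<Longrightarrow> dpred (\<lambda>e. P (\<lambda>i. e (\<rho> i)))"
  using dpred_subst[of P "\<lambda>i. Var (\<rho> i)"] by simp

lemma dpred_etl: "dpred P \<Longrightarrow> dpred (\<lambda>e. P (etl e))"
  unfolding etl_def by (rule dpred_rename)

lemma dpred_const: "dpred (\<lambda>e. p)"
proof (cases p)
  case True
  then show ?thesis unfolding dpred_def by (intro exI[of _ "Equal (Var 0) (Var 0)"]) simp
next
  case False
  then show ?thesis unfolding dpred_def by (intro exI[of _ "Less (Var 0) (Var 0)"]) simp
qed

lemma dpred_not: "dpred P \<Longrightarrow> dpred (\<lambda>e. \<not> P e)"
  unfolding dpred_def by (metis sat.simps(4))

lemma dpred_conj: "dpred P \<Longrightarrow> dpred Q \<Longrightarrow> dpred (\<lambda>e. P e \<and> Q e)"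
proof -
  assume "dpred P" "dpred Q"
  then obtain \<phi> \<psi> where "\<And>e. sat M e \<phi> = P e" "\<And>e. sat M e \<psi> = Q e"
    unfolding dpred_def by blast
  then show ?thesis unfolding dpred_def by (intro exI[of _ "Conj \<phi> \<psi>"]) simp
qed

lemma dpred_disj: "dpred P \<Longrightarrow> dpred Q \<Longrightarrow> dpred (\<lambda>e. P e \<or> Q e)"
proof -
  assume "dpred P" "dpred Q"
  then have "dpred (\<lambda>e. \<not> (\<not> P e \<and> \<not> Q e))" by (intro dpred_not dpred_conj)
  then show ?thesis by simp
qed

lemma dpred_imp: "dpred P \<Longrightarrow> dpred Q \<Longrightarrow> dpred (\<lambda>e. P e \<longrightarrow> Q e)"
  unfolding imp_conv_disj by (intro dpred_disj dpred_not)

lemma dpred_iff: "dpred P \<Longrightarrow> dpred Q \<Longrightarrow> dpred (\<lambda>e. P e \<longleftrightarrow> Q e)"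
  unfolding iff_conv_conj_imp by (intro dpred_conj dpred_imp)

text \<open>The bound element is moved from position 0 to a variable \<open>N\<close> beyond
  everything that \<open>Q\<close> reads, so a named quantifier over \<open>N\<close> leaves the
  relevant part of the outer environment intact.\<close>

lemma dpred_ex:
  assumes "dpred (\<lambda>e. Q (e 0) (etl e))"
  shows "dpred (\<lambda>e. \<exists>a. Q a e)"
proof -
  obtain N where N: "\<And>e e'. (\<And>i. i < N \<Longrightarrow> e i = e' i) \<Longrightarrow> Q (e 0) (etl e) = Q (e' 0) (etl e')"
    using dpred_cong_below[OF assms] by metis
  have "dpred (\<lambda>e. Q (e N) (\<lambda>n. e n))"
    using dpred_rename[OF assms, of "case_nat N id"] by (simp add: etl_def)
  then obtain \<phi> where \<phi>: "\<And>e. sat M e \<phi> = Q (e N) (\<lambda>n. e n)"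
    unfolding dpred_def by blast
  have "sat M (e(N := a)) \<phi> = Q a e" for e a
  proof -
    have "Q a (e(N := a)) = Q a e"
    proof -
      have "scons a (e(N := a)) i = scons a e i" if "i < N" for i
        using that by (cases i) auto
      from N[of "scons a (e(N := a))" "scons a e", OF this] show ?thesis by simp
    qed
    then show ?thesis by (simp add: \<phi> fun_upd_same del: fun_upd_apply)
  qed
  then show ?thesis unfolding dpred_def by (intro exI[of _ "Exists N \<phi>"]) simp
qed

lemma dpred_all:
  assumes "dpred (\<lambda>e. Q (e 0) (etl e))"
  shows "dpred (\<lambda>e. \<forall>a. Q a e)"
  using dpred_not[OF dpred_ex[OF dpred_not[OF assms], unfolded not_not]] by simp

lemma dfun_etl: "dfun g \<Longrightarrow> dfun (\<lambda>e. g (etl e))"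
  unfolding dfun_def using dpred_rename[of "\<lambda>e. e 0 = g (etl e)" "case_nat 0 (\<lambda>n. Suc (Suc n))"]
  by (simp add: etl_def)

lemma dpred_scons:
  assumes "dpred P" "dfun g"
  shows "dpred (\<lambda>e. P (scons (g e) e))"
proof -
  have "dpred (\<lambda>e. \<exists>a. a = g e \<and> P (scons a e))"
    using assms by (intro dpred_ex dpred_conj) (simp_all add: dfun_def)
  then show ?thesis by simp
qed

lemma dpred_comp:
  assumes "dpred P" "dvec v"
  shows "dpred (\<lambda>e. P (v e))"
proof -
  \<comment> \<open>The entries of \<open>v\<close> are inserted one at a time: behind position
    \<open>k\<close> stands all of \<open>e\<close>, whose head the next step fills with
    \<open>v e k\<close> by \<open>dpred_scons\<close>. Finitely many insertions suffice, since
    \<open>P\<close> reads only entries below \<open>N\<close>.\<close>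
  have *: "dpred (\<lambda>e. P (\<lambda>i. if i < k then v e i else e (i - k)))" if "\<And>i. dfun (\<lambda>e. v e i)" for k v
    using that
  proof (induction k arbitrary: v)
    case 0
    then show ?case using assms(1) by simp
  next
    case (Suc k)
    have "dpred (\<lambda>e. P (\<lambda>i. if i < k then v (etl e) i else e (i - k)))"
      using Suc(1)[of "\<lambda>e. v (etl e)"] Suc(2) dfun_etl by blast
    from dpred_scons[OF this, of "\<lambda>e. v e k"] Suc(2)
    have "dpred (\<lambda>e. P (\<lambda>i. if i < k then v e i else scons (v e k) e (i - k)))"
      unfolding etl_scons by blast
    moreover have "(\<lambda>i. if i < k then v e i else scons (v e k) e (i - k)) =
      (\<lambda>i. if i < Suc k then v e i else e (i - Suc k))" for e
    proof
      fix i
      show "(if i < k then v e i else scons (v e k) e (i - k)) = (if i < Suc k then v e i else e (i - Suc k))"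
        by (cases "i - k") (auto simp: less_Suc_eq not_less_iff_gr_or_eq dest: less_imp_Suc_add)
    qed
    ultimately show ?case by simp
  qed
  obtain N where N: "\<And>e e'. (\<And>i. i < N \<Longrightarrow> e i = e' i) \<Longrightarrow> P e = P e'"
    using dpred_cong_below[OF assms(1)] by metis
  have "P (v e) = P (\<lambda>i. if i < N then v e i else e (i - N))" for e by (rule N) simp
  then show ?thesis using *[of v N] assms(2) by (simp add: dvec_def)
qed

lemma dvecI: "(\<And>i. dfun (\<lambda>e. v e i)) \<Longrightarrow> dvec v"
  by (simp add: dvec_def)

lemma dfun_nth: "dvec v \<Longrightarrow> dfun (\<lambda>e. v e i)"
  by (simp add: dvec_def)

lemma dfun_var: "dfun (\<lambda>e. e i)"
  unfolding dfun_def dpred_def by (intro exI[of _ "Equal (Var 0) (Var (Suc i))"]) simp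

lemma dfun_const: "dfun (\<lambda>e. c)"
  unfolding dfun_def dpred_def by (intro exI[of _ "Equal (Var 0) (Param c)"]) simp

lemma dvec_id: "dvec (\<lambda>e. e)"
  by (intro dvecI dfun_var)

lemma dvec_const: "dvec (\<lambda>e. c)"
  by (intro dvecI dfun_const)

lemma dfun_comp: "dfun g \<Longrightarrow> dvec v \<Longrightarrow> dfun (\<lambda>e. g (v e))"
  unfolding dfun_def[of "\<lambda>e. g (v e)"]
proof -
  assume g: "dfun g" and v: "dvec v"
  have "dvec (\<lambda>e. scons (e 0) (v (etl e)))"
  proof (rule dvecI)
    fix i show "dfun (\<lambda>e. scons (e 0) (v (etl e)) i)"
      using v dfun_etl by (cases i) (auto simp: dvec_def dfun_var)
  qed
  from dpred_comp[OF g[unfolded dfun_def] this] show "dpred (\<lambda>e. e 0 = g (v (etl e)))" by simp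
qed

lemma dvec_comp: "dvec w \<Longrightarrow> dvec v \<Longrightarrow> dvec (\<lambda>e. w (v e))"
  unfolding dvec_def using dfun_comp dvec_def by blast

lemma dvec_scons: "dfun g \<Longrightarrow> dvec v \<Longrightarrow> dvec (\<lambda>e. scons (g e) (v e))"
proof (rule dvecI)
  fix i assume "dfun g" "dvec v" then show "dfun (\<lambda>e. scons (g e) (v e) i)"
    by (cases i) (auto simp: dvec_def)
qed

lemma dvec_etl: "dvec v \<Longrightarrow> dvec (\<lambda>e. etl (v e))"
  by (simp add: dvec_def)

lemma dvec_upd: "dvec v \<Longrightarrow> dfun g \<Longrightarrow> dvec (\<lambda>e. (v e)(m := g e))"
  unfolding dvec_def
proof
  fix i assume "\<forall>i. dfun (\<lambda>e. v e i)" "dfun g" then show "dfun (\<lambda>e. ((v e)(m := g e)) i)"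
    by (cases "i = m") auto
qed

lemma dpred_inst:
  assumes "dpred (\<lambda>e. Q (e 0) (etl e))" "dfun g" "dvec v"
  shows "dpred (\<lambda>e. Q (g e) (v e))"
  using dpred_comp[OF assms(1) dvec_scons[OF assms(2,3)]] by simp

lemma dfam_mem: "dfam A \<Longrightarrow> dfun g \<Longrightarrow> dvec v \<Longrightarrow> dpred (\<lambda>e. g e \<in> A (v e))"
  unfolding dfam_def by (rule dpred_inst)

lemma dpred_rel2:
  assumes "dpred (\<lambda>e. R (e 0) (e 1))" "dfun g" "dfun h"
  shows "dpred (\<lambda>e. R (g e) (h e))"
  using dpred_comp[OF assms(1) dvec_scons[OF assms(2) dvec_scons[OF assms(3) dvec_id]]] by simp

lemma dpred_eq: "dfun g \<Longrightarrow> dfun h \<Longrightarrow> dpred (\<lambda>e. g e = h e)"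
  by (rule dpred_rel2) (auto simp: dpred_def intro!: exI[of _ "Equal (Var 0) (Var 1)"])

lemma dpred_less: "dfun g \<Longrightarrow> dfun h \<Longrightarrow> dpred (\<lambda>e. g e < h e)"
  by (rule dpred_rel2) (auto simp: dpred_def intro!: exI[of _ "Less (Var 0) (Var 1)"])

lemma dpred_le: "dfun g \<Longrightarrow> dfun h \<Longrightarrow> dpred (\<lambda>e. g e \<le> h e)"
  unfolding not_less[symmetric] by (intro dpred_not dpred_less)

lemma dfun_the1:
  assumes "dpred (\<lambda>e. Q (e 0) (etl e))"
  shows "dfun (\<lambda>e. the1 (\<lambda>a. Q a e))"
  unfolding dfun_def eq_the1_iff
  by (intro dpred_conj dpred_disj dpred_not dpred_ex dpred_all dpred_imp dpred_eq dpred_inst[OF assms]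
      dfun_var dfun_const dvec_etl dvec_id dfun_nth)

lemma dfun_graph:
  assumes "dpred (\<lambda>e. Q (e 0) (etl e))" "\<And>a e. Q a e \<longleftrightarrow> a = g e"
  shows "dfun g"
  using assms by (simp add: dfun_def)

lemma dfun_plus: "dfun g \<Longrightarrow> dfun h \<Longrightarrow> dfun (\<lambda>e. g e + h e)"
proof -
  assume gh: "dfun g" "dfun h"
  have "dpred (\<lambda>e. e 0 = e 1 + e 2)"
    unfolding dpred_def by (intro exI[of _ "Equal (Var 0) (Plus (Var 1) (Var 2))"]) simp
  from dpred_comp[OF this dvec_scons[OF dfun_var[of 0] dvec_scons[OF dfun_etl[OF gh(1)] dvec_scons[OF dfun_etl[OF gh(2)] dvec_id]]]]
  show ?thesis by (simp add: dfun_def eval_nat_numeral)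
qed

lemma dfun_times: "dfun g \<Longrightarrow> dfun h \<Longrightarrow> dfun (\<lambda>e. g e * h e)"
proof -
  assume gh: "dfun g" "dfun h"
  have "dpred (\<lambda>e. e 0 = e 1 * e 2)"
    unfolding dpred_def by (intro exI[of _ "Equal (Var 0) (Times (Var 1) (Var 2))"]) simp
  from dpred_comp[OF this dvec_scons[OF dfun_var[of 0] dvec_scons[OF dfun_etl[OF gh(1)] dvec_scons[OF dfun_etl[OF gh(2)] dvec_id]]]]
  show ?thesis by (simp add: dfun_def eval_nat_numeral)
qed

lemma dfun_uminus: "dfun g \<Longrightarrow> dfun (\<lambda>e. - g e)"
  using dfun_times[OF dfun_const[of "-1"], of g] by simp

lemma dfun_minus: "dfun g \<Longrightarrow> dfun h \<Longrightarrow> dfun (\<lambda>e. g e - h e)"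
  unfolding diff_conv_add_uminus by (intro dfun_plus dfun_uminus)

lemma dfun_if:
  assumes "dpred P" "dfun g" "dfun h"
  shows "dfun (\<lambda>e. if P e then g e else h e)"
  by (rule dfun_graph[where Q = "\<lambda>a e. (P e \<and> a = g e) \<or> (\<not> P e \<and> a = h e)"])
    (auto intro!: dpred_conj dpred_disj dpred_not dpred_eq dfun_var
      dpred_etl[OF assms(1)] dfun_etl[OF assms(2)] dfun_etl[OF assms(3)])

lemma dfun_abs: "dfun g \<Longrightarrow> dfun (\<lambda>e. \<bar>g e\<bar>)"
  unfolding abs_if by (intro dfun_if dpred_less dfun_const dfun_uminus)

lemma dfun_max: "dfun g \<Longrightarrow> dfun h \<Longrightarrow> dfun (\<lambda>e. max (g e) (h e))"
  unfolding max_def by (intro dfun_if dpred_le)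

lemma dfun_min: "dfun g \<Longrightarrow> dfun h \<Longrightarrow> dfun (\<lambda>e. min (g e) (h e))"
  unfolding min_def by (intro dfun_if dpred_le)

lemma dfun_inverse:
  assumes "dfun g"
  shows "dfun (\<lambda>e. inverse (g e))"
proof (rule dfun_graph[where Q = "\<lambda>a e. a * g e = 1 \<or> (g e = 0 \<and> a = 0)"])
  show "dpred (\<lambda>e. e 0 * g (etl e) = 1 \<or> g (etl e) = 0 \<and> e 0 = 0)"
    by (intro dpred_conj dpred_disj dpred_eq dfun_times dfun_var dfun_const dfun_etl[OF assms])
  show "\<And>a e. (a * g e = 1 \<or> g e = 0 \<and> a = 0) \<longleftrightarrow> a = inverse (g e)"
    by (metis inverse_unique inverse_zero left_inverse mult_zero_right zero_neq_one mult.commute)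
qed

lemma dfun_divide: "dfun g \<Longrightarrow> dfun h \<Longrightarrow> dfun (\<lambda>e. g e / h e)"
  unfolding divide_inverse by (intro dfun_times dfun_inverse)

lemma dvec_if: "dpred P \<Longrightarrow> dvec v \<Longrightarrow> dvec w \<Longrightarrow> dvec (\<lambda>e. if P e then v e else w e)"
  unfolding dvec_def if_distribR by (auto simp: if_distribR intro: dfun_if)

lemma dpred_ball_finite: "finite I \<Longrightarrow> (\<And>i. i \<in> I \<Longrightarrow> dpred (P i)) \<Longrightarrow> dpred (\<lambda>e. \<forall>i\<in>I. P i e)"
  by (induction I rule: finite_induct) (auto intro: dpred_const dpred_conj)

lemma dpred_bex_finite: "finite I \<Longrightarrow> (\<And>i. i \<in> I \<Longrightarrow> dpred (P i)) \<Longrightarrow> dpred (\<lambda>e. \<exists>i\<in>I. P i e)"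
  by (induction I rule: finite_induct) (auto intro: dpred_const dpred_disj)

end

text \<open>\<open>E J\<close> is \<open>R\<^sup>J\<close>. The index set is not required to be an initial segment, so that any coordinate can be
  dropped (set to \<open>undefined\<close>) without renumbering the others.\<close>

abbreviation E :: "nat set \<Rightarrow> (nat \<Rightarrow> 'a) set" where "E \<equiv> extensional"

text \<open>A single environment codes a point of \<open>R\<^sup>J\<close> (at even indices) and an environment (at odd indices).\<close>

definition vpart :: "nat set \<Rightarrow> (nat \<Rightarrow> 'a) \<Rightarrow> nat \<Rightarrow> 'a" where
  "vpart J c = (\<lambda>i. if i \<in> J then c (2 * i) else undefined)"
definition epart :: "(nat \<Rightarrow> 'a) \<Rightarrow> nat \<Rightarrow> 'a" where
  "epart c = (\<lambda>i. c (2 * i + 1))"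

lemma vpart_in_E [simp]: "vpart J c \<in> E J"
  by (simp add: vpart_def extensional_def)

text \<open>Open cubes with radii in R replace metric balls, since R need not be metrisable. Only
  the entries of \<open>x\<close> in \<open>J\<close> matter, so any environment may serve as
  centre.\<close>

definition bx :: "nat set \<Rightarrow> (nat \<Rightarrow> 'a::linordered_idom) \<Rightarrow> 'a \<Rightarrow> (nat \<Rightarrow> 'a) set" where
  "bx J x r = {y \<in> E J. \<forall>i\<in>J. \<bar>y i - x i\<bar> < r}"

context o_minimal_expansion begin

lemma dvec_vpart: "dvec v \<Longrightarrow> dvec (\<lambda>e. vpart J (v e))"
proof (rule dvecI)
  fix i assume "dvec v" then show "dfun (\<lambda>e. vpart J (v e) i)"
    by (cases "i \<in> J") (auto simp: dvec_def vpart_def dfun_const)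
qed

lemma dvec_epart: "dvec v \<Longrightarrow> dvec (\<lambda>e. epart (v e))"
  by (auto simp: dvec_def epart_def)

text \<open>Quantifying over a point of R^J is a block of single quantifiers over even slots of a
  coded environment; induction on the index set adds one coordinate at a time.\<close>

lemma dpred_exE:
  assumes "finite J" "dpred (\<lambda>c. Q (vpart J c) (epart c))"
  shows "dpred (\<lambda>e. \<exists>x\<in>E J. Q x e)"
proof -
  define mrg :: "nat set \<Rightarrow> (nat \<Rightarrow> 'a) \<Rightarrow> (nat \<Rightarrow> 'a) \<Rightarrow> nat \<Rightarrow> 'a" where
    "mrg K x c = (\<lambda>i. if even i \<and> i div 2 \<in> K then x (i div 2) else c i)" for K x c
  have "dpred (\<lambda>c. \<exists>x\<in>E K. P (mrg K x c))" if "finite K" "dpred P" for P K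
    using that
  proof (induction K arbitrary: P rule: finite_induct)
    case empty
    then show ?case by (simp add: mrg_def)
  next
    case (insert k K)
    have "dpred (\<lambda>c. \<exists>a. P (c(2 * k := a)))"
      by (intro dpred_ex dpred_comp[OF insert(4)] dvec_upd dvec_etl dvec_id dfun_var)
    from insert(3)[OF this] have *: "dpred (\<lambda>c. \<exists>x\<in>E K. \<exists>a. P ((mrg K x c)(2 * k := a)))" .
    have "(\<exists>x\<in>E K. \<exists>a. P ((mrg K x c)(2 * k := a))) \<longleftrightarrow> (\<exists>x\<in>E (insert k K). P (mrg (insert k K) x c))"
      (is "?l \<longleftrightarrow> ?r") for c
    proof
      assume ?l
      then obtain x a where x: "x \<in> E K" "P ((mrg K x c)(2 * k := a))" by blast
      have "(mrg K x c)(2 * k := a) = mrg (insert k K) (x(k := a)) c"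
        using insert(2) by (auto simp: mrg_def fun_eq_iff)
      moreover have "x(k := a) \<in> E (insert k K)" using x(1) by (auto simp: extensional_def)
      ultimately show ?r using x(2) by metis
    next
      assume ?r
      then obtain x where x: "x \<in> E (insert k K)" "P (mrg (insert k K) x c)" by blast
      have "mrg (insert k K) x c = (mrg K (x(k := undefined)) c)(2 * k := x k)"
        using insert(2) by (auto simp: mrg_def fun_eq_iff)
      moreover have "x(k := undefined) \<in> E K" using x(1) by (auto simp: extensional_def)
      ultimately show ?l using x(2) by metis
    qed
    then show ?case using * by simp
  qed
  from this[OF assms]
  have "dpred (\<lambda>c. \<exists>x\<in>E J. Q (vpart J (mrg J x c)) (epart (mrg J x c)))" .
  moreover have "vpart J (mrg J x c) = x" if "x \<in> E J" for x c
    using that by (auto simp: vpart_def mrg_def extensional_def fun_eq_iff)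
  moreover have "epart (mrg J x c) = epart c" for x c
    by (auto simp: epart_def mrg_def)
  ultimately have "dpred (\<lambda>c. \<exists>x\<in>E J. Q x (epart c))"
    by (auto simp: conj_commute cong: bex_cong)
  \<comment> \<open>Slots \<open>2 * i\<close> and \<open>2 * i + 1\<close> both receive entry
    \<open>i\<close>, so \<open>epart\<close> gives back the uncoded environment.\<close>
  from dpred_rename[OF this, of "\<lambda>i. i div 2"] show ?thesis
    by (simp add: epart_def)
qed

lemma dpred_allE:
  assumes "finite J" "dpred (\<lambda>c. Q (vpart J c) (epart c))"
  shows "dpred (\<lambda>e. \<forall>x\<in>E J. Q x e)"
  using dpred_not[OF dpred_exE[OF assms(1) dpred_not[OF assms(2)]]] by simp

lemma dpred_bx:
  assumes "finite J" "dvec v" "dvec w" "dfun r" "\<And>e. v e \<in> E J"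
  shows "dpred (\<lambda>e. v e \<in> bx J (w e) (r e))"
  unfolding bx_def using assms
  by (auto intro!: dpred_ball_finite dpred_less dfun_abs dfun_minus intro: dfun_nth)

lemma dpred_ball_bx:
  assumes "finite J" "dvec x" "dfun r" "dpred (\<lambda>c. Q (vpart J c) (epart c))"
  shows "dpred (\<lambda>e. \<forall>y\<in>bx J (x e) (r e). Q y e)"
proof -
  have "dpred (\<lambda>e. \<forall>y\<in>E J. y \<in> bx J (x e) (r e) \<longrightarrow> Q y e)"
    by (intro dpred_allE assms(1) dpred_imp assms(4) dpred_bx dvec_vpart dvec_epart dvec_id vpart_in_E
        dvec_comp[OF assms(2)] dfun_comp[OF assms(3)])
  moreover have "(\<forall>y\<in>E J. y \<in> bx J (x e) (r e) \<longrightarrow> Q y e) \<longleftrightarrow> (\<forall>y\<in>bx J (x e) (r e). Q y e)" for e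
    by (auto simp: bx_def)
  ultimately show ?thesis by simp
qed

lemma dpred_bex_bx:
  assumes "finite J" "dvec x" "dfun r" "dpred (\<lambda>c. Q (vpart J c) (epart c))"
  shows "dpred (\<lambda>e. \<exists>y\<in>bx J (x e) (r e). Q y e)"
  using dpred_not[OF dpred_ball_bx[OF assms(1-3) dpred_not[OF assms(4)]]] by simp

lemmas dpred_intros =
  dpred_const dpred_conj dpred_disj dpred_imp dpred_not dpred_ex dpred_all dpred_exE dpred_allE
  dpred_ball_bx dpred_bex_bx dpred_bx dpred_less dpred_le dpred_eq dpred_iff
  dfun_var dfun_const dfun_plus dfun_minus dfun_times dfun_uminus dfun_divide dfun_abs dfun_max dfun_min
  dvec_id dvec_const dvec_etl dvec_vpart dvec_epart dvec_upd vpart_in_E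

end

section \<open>Definable subsets of the line\<close>

definition bd :: "'a::linordered_field set \<Rightarrow> 'a set" where
  "bd S = {u. \<forall>\<epsilon>>0. (\<exists>v\<in>S. \<bar>v - u\<bar> < \<epsilon>) \<and> (\<exists>v. v \<notin> S \<and> \<bar>v - u\<bar> < \<epsilon>)}"

lemma bd_Compl: "bd (- S) = bd S"
  by (auto simp: bd_def)

lemma bd_Un: "bd (S \<union> T) \<subseteq> bd S \<union> bd T"
proof
  fix u assume u: "u \<in> bd (S \<union> T)"
  show "u \<in> bd S \<union> bd T"
  proof (rule ccontr)
    assume "u \<notin> bd S \<union> bd T"
    then obtain \<epsilon> \<eta> where *: "\<epsilon> > 0" "(\<forall>v\<in>S. \<not> \<bar>v - u\<bar> < \<epsilon>) \<or> (\<forall>v. \<bar>v - u\<bar> < \<epsilon> \<longrightarrow> v \<in> S)"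
      "\<eta> > 0" "(\<forall>v\<in>T. \<not> \<bar>v - u\<bar> < \<eta>) \<or> (\<forall>v. \<bar>v - u\<bar> < \<eta> \<longrightarrow> v \<in> T)"
      unfolding bd_def by blast
    then have "min \<epsilon> \<eta> > 0" by simp
    with u obtain v w where "v \<in> S \<union> T" "\<bar>v - u\<bar> < min \<epsilon> \<eta>" "w \<notin> S \<union> T" "\<bar>w - u\<bar> < min \<epsilon> \<eta>"
      unfolding bd_def by blast
    with * show False by auto
  qed
qed

lemma not_bdI:
  fixes \<epsilon> :: "'a::linordered_field"
  assumes "\<epsilon> > 0" "(\<forall>v. \<bar>v - u\<bar> < \<epsilon> \<longrightarrow> v \<notin> S) \<or> (\<forall>v. \<bar>v - u\<bar> < \<epsilon> \<longrightarrow> v \<in> S)"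
  shows "u \<notin> bd S"
  using assms unfolding bd_def by blast

lemma finite_bd_piece:
  fixes J :: "'a::linordered_field set"
  assumes "point_or_open_interval J"
  shows "finite (bd J)"
proof -
  \<comment> \<open>\<open>C\<close> will hold the endpoints of \<open>J\<close>: a ball around
    \<open>u\<close> that reaches none of them lies inside \<open>J\<close> or misses it.\<close>
  have *: "u \<notin> bd J" if "\<And>c. c \<in> C \<Longrightarrow> u \<noteq> c" "finite C"
    "\<And>\<epsilon>. \<epsilon> > 0 \<Longrightarrow> (\<forall>c\<in>C. \<epsilon> \<le> \<bar>u - c\<bar>) \<Longrightarrow> (\<forall>v. \<bar>v - u\<bar> < \<epsilon> \<longrightarrow> v \<notin> J) \<or> (\<forall>v. \<bar>v - u\<bar> < \<epsilon> \<longrightarrow> v \<in> J)" for u C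
  proof -
    define \<epsilon> where "\<epsilon> = Min (insert 1 ((\<lambda>c. \<bar>u - c\<bar>) ` C))"
    have \<epsilon>: "\<epsilon> > 0" using that(1,2) by (simp add: \<epsilon>_def)
    have "\<forall>c\<in>C. \<epsilon> \<le> \<bar>u - c\<bar>" using \<open>finite C\<close> by (simp add: \<epsilon>_def)
    from not_bdI[OF \<epsilon> that(3)[OF \<epsilon> this]] show ?thesis .
  qed
  consider a where "J = {a}" | a b where "J = {a<..<b}" | a where "J = {a<..}" | b where "J = {..<b}" | "J = UNIV"
    using assms unfolding point_or_open_interval_def by blast
  then show ?thesis
  proof cases
    case (1 a)
    have "u \<notin> bd J" if "u \<noteq> a" for u
      using that by (intro *[of "{a}"]) (auto simp: 1 abs_if not_less split: if_splits)
    then have "bd J \<subseteq> {a}" by blast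
    then show ?thesis using finite_subset by blast
  next
    case (2 a b)
    have "u \<notin> bd J" if "u \<notin> {a, b}" for u
      using that by (intro *[of "{a, b}"]) (auto simp: 2 abs_if not_less split: if_splits)
    then have "bd J \<subseteq> {a, b}" by blast
    then show ?thesis using finite_subset by blast
  next
    case (3 a)
    have "u \<notin> bd J" if "u \<noteq> a" for u
      using that by (intro *[of "{a}"]) (auto simp: 3 abs_if not_less split: if_splits)
    then have "bd J \<subseteq> {a}" by blast
    then show ?thesis using finite_subset by blast
  next
    case (4 b)
    have "u \<notin> bd J" if "u \<noteq> b" for u
      using that by (intro *[of "{b}"]) (auto simp: 4 abs_if not_less split: if_splits)
    then have "bd J \<subseteq> {b}" by blast
    then show ?thesis using finite_subset by blast
  next
    case 5
    have "u \<notin> bd J" for u by (rule not_bdI[of 1]) (simp_all add: 5)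
    then have "bd J = {}" by blast
    then show ?thesis by simp
  qed
qed

lemma finite_bd_Union:
  fixes \<J> :: "'a::linordered_field set set"
  assumes "finite \<J>" "\<And>J. J \<in> \<J> \<Longrightarrow> point_or_open_interval J"
  shows "finite (bd (\<Union>\<J>))"
  using assms
proof (induction \<J> rule: finite_induct)
  case empty
  have "u \<notin> bd {}" for u :: 'a by (rule not_bdI[of 1]) simp_all
  then have "bd ({}::'a set) = {}" by blast
  then show ?case by simp
next
  case (insert J \<J>)
  then show ?case using finite_subset[OF bd_Un[of J "\<Union>\<J>"]] finite_bd_piece by auto
qed

section \<open>Suprema, boundary points and connectedness on the line\<close>

definition is_sup :: "'a::linorder set \<Rightarrow> 'a \<Rightarrow> bool" where
  "is_sup S s \<longleftrightarrow> (\<forall>x\<in>S. x \<le> s) \<and> (\<forall>u. (\<forall>x\<in>S. x \<le> u) \<longrightarrow> s \<le> u)"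

lemma is_sup_piece:
  fixes J :: "'a::linordered_field set"
  assumes J: "point_or_open_interval J" and "J \<noteq> {}" and b: "\<And>x. x \<in> J \<Longrightarrow> x \<le> b"
  shows "\<exists>s. is_sup J s"
proof -
  have *: "c < d" if "J = {c<..<d}" for c d
    using that assms(2) by (meson greaterThanLessThan_empty_iff not_le)
  consider a where "J = {a}" | c d where "J = {c<..<d}" | a where "J = {a<..}" | d where "J = {..<d}" | "J = UNIV"
    using J unfolding point_or_open_interval_def by blast
  then show ?thesis
  proof cases
    case (1 a)
    then show ?thesis by (intro exI[of _ a]) (simp add: is_sup_def)
  next
    case (2 c d)
    then have "c < d" using * by blast
    then show ?thesis using 2 dense_le_bounded[of c d] by (intro exI[of _ d]) (auto simp: is_sup_def)
  next
    case (3 a)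
    have "max a b + 1 \<in> J" by (simp add: 3 less_max_iff_disj add.commute add_strict_increasing)
    then show ?thesis using b[of "max a b + 1"] by (simp add: max_def split: if_splits)
  next
    case (4 d)
    then show ?thesis using dense_le[of d] by (intro exI[of _ d]) (auto simp: is_sup_def)
  next
    case 5
    then show ?thesis using b[of "b + 1"] by simp
  qed
qed

lemma is_sup_Union:
  fixes \<J> :: "'a::linordered_field set set"
  assumes "finite \<J>" "\<And>J. J \<in> \<J> \<Longrightarrow> point_or_open_interval J" "\<Union>\<J> \<noteq> {}" "\<And>x. x \<in> \<Union>\<J> \<Longrightarrow> x \<le> b"
  shows "\<exists>s. is_sup (\<Union>\<J>) s"
  using assms
proof (induction \<J> rule: finite_induct)
  case (insert J \<J>)
  show ?case
  proof (cases "J = {} \<or> \<Union>\<J> = {}")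
    case True
    then have "\<Union>(insert J \<J>) = J \<or> \<Union>(insert J \<J>) = \<Union>\<J>" by blast
    then show ?thesis
    proof
      assume *: "\<Union>(insert J \<J>) = J"
      then show ?thesis using insert(4)[of J] insert(5,6) is_sup_piece[of J b] by simp
    next
      assume *: "\<Union>(insert J \<J>) = \<Union>\<J>"
      then show ?thesis using insert by simp
    qed
  next
    case False
    then obtain s t where "is_sup J s" "is_sup (\<Union>\<J>) t" using insert is_sup_piece[of J b] by auto
    then have "is_sup (\<Union>(insert J \<J>)) (max s t)"
      by (simp add: is_sup_def le_max_iff_disj) blast
    then show ?thesis by blast
  qed
qed simp

text \<open>R need not be Dedekind complete, but nonempty bounded definable sets have suprema
  (\<open>is_sup_dsup\<close>). Selection by \<open>the1\<close>, with value 0 when there is no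
  supremum, keeps it definable in families.\<close>

definition dsup :: "'a::{linorder,zero} set \<Rightarrow> 'a" where
  "dsup S = the1 (is_sup S)"

definition dinf :: "'a::linordered_field set \<Rightarrow> 'a" where
  "dinf S = - dsup {a. - a \<in> S}"

context o_minimal_expansion begin

definition def1 :: "'a set \<Rightarrow> bool" where
  "def1 S \<longleftrightarrow> dpred (\<lambda>e. e 0 \<in> S)"

lemma dpred_mem1: "def1 S \<Longrightarrow> dfun g \<Longrightarrow> dpred (\<lambda>e. g e \<in> S)"
  unfolding def1_def using dpred_comp[OF _ dvec_scons[OF _ dvec_id], of "\<lambda>e. e 0 \<in> S" g] by simp

lemma def1_Collect: "dpred (\<lambda>e. Q (e 0) (etl e)) \<Longrightarrow> def1 {a. Q a x}"
  unfolding def1_def mem_Collect_eq by (rule dpred_inst[OF _ dfun_var dvec_const])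

lemma def1_fam: "dfam A \<Longrightarrow> def1 (A x)"
  unfolding dfam_def using def1_Collect[of "\<lambda>a e. a \<in> A e" x] by simp

lemma dfun_nth_etl: "dvec v \<Longrightarrow> dfun (\<lambda>e. etl (v e) i)"
  by (rule dfun_nth[OF dvec_etl])

lemma dfun_nth_vpart: "dvec v \<Longrightarrow> dfun (\<lambda>e. vpart J (v e) i)"
  by (rule dfun_nth[OF dvec_vpart])

lemma dfun_nth_epart: "dvec v \<Longrightarrow> dfun (\<lambda>e. epart (v e) i)"
  by (rule dfun_nth[OF dvec_epart])

lemmas d_intros = dpred_intros dfun_nth_etl dfun_nth_vpart dfun_nth_epart

lemma dfam_Collect: "dpred (\<lambda>e. Q (e 0) (etl e)) \<Longrightarrow> dfam (\<lambda>e. {a. Q a e})"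
  unfolding dfam_def by simp

lemma dfam_comp: "dfam A \<Longrightarrow> dvec v \<Longrightarrow> dfam (\<lambda>e. A (v e))"
  unfolding dfam_def[of "\<lambda>e. A (v e)"]
  by (rule dfam_mem[of A], assumption, rule dfun_var, rule dvec_comp[of v], assumption, rule dvec_etl, rule dvec_id)

lemma dfun_dsup:
  assumes "dfam A"
  shows "dfun (\<lambda>e. dsup (A e))"
  unfolding dsup_def
proof (rule dfun_the1)
  note A = dfam_mem[OF assms]
  have "dpred (\<lambda>e. (\<forall>x. x \<in> A (etl e) \<longrightarrow> x \<le> e 0) \<and> (\<forall>u. (\<forall>x. x \<in> A (etl e) \<longrightarrow> x \<le> u) \<longrightarrow> e 0 \<le> u))"
    by (intro d_intros A)
  then show "dpred (\<lambda>e. is_sup (A (etl e)) (e 0))"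
    by (simp add: is_sup_def Ball_def)
qed

lemma dfun_dinf: "dfam A \<Longrightarrow> dfun (\<lambda>e. dinf (A e))"
  unfolding dinf_def by (intro dfun_uminus dfun_dsup dfam_Collect dfam_mem d_intros)

text \<open>The single place where o-minimality is applied. Finite boundaries, suprema, and
  intervals inside infinite definable sets all derive from it.\<close>

lemma def1_pieces:
  assumes "def1 S"
  obtains \<J> where "finite \<J>" "\<And>J. J \<in> \<J> \<Longrightarrow> point_or_open_interval J" "S = \<Union>\<J>"
proof -
  obtain \<phi> where \<phi>: "\<And>e. sat M e \<phi> = (e 0 \<in> S)"
    using assms unfolding def1_def dpred_def by blast
  let ?A = "RSet 1 {x \<in> Rn 1. sat M x \<phi>}"
  have "definable M ?A" unfolding definable_def by auto
  then obtain \<J> where "finite \<J>" "\<forall>J\<in>\<J>. point_or_open_interval J" "{t. vec1 t \<in> pts ?A} = \<Union>\<J>"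
    using o_minimal[unfolded o_minimal_def, rule_format, of ?A] by auto
  moreover have "{t. vec1 t \<in> pts ?A} = S"
    by (auto simp: \<phi> vec1_def)
  ultimately show ?thesis using that by metis
qed

lemma finite_bd: "def1 S \<Longrightarrow> finite (bd S)"
  by (metis def1_pieces finite_bd_Union)

lemma is_sup_dsup:
  assumes "def1 S" "S \<noteq> {}" "\<forall>x\<in>S. x \<le> b"
  shows "is_sup S (dsup S)"
proof -
  obtain s where s: "is_sup S s" using assms def1_pieces[OF assms(1)] is_sup_Union by metis
  moreover have "t = s" if "is_sup S t" for t
    using s that unfolding is_sup_def by (meson order_antisym)
  ultimately show ?thesis unfolding dsup_def by (metis the1_equality)
qed

lemma dsup_upper: "def1 S \<Longrightarrow> x \<in> S \<Longrightarrow> \<forall>x\<in>S. x \<le> b \<Longrightarrow> x \<le> dsup S"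
  using is_sup_dsup[of S b] unfolding is_sup_def by blast

lemma less_dsup: "def1 S \<Longrightarrow> S \<noteq> {} \<Longrightarrow> \<forall>x\<in>S. x \<le> b \<Longrightarrow> u < dsup S \<Longrightarrow> \<exists>x\<in>S. u < x"
  using is_sup_dsup[of S b] unfolding is_sup_def by (meson not_le)

lemma dsup_le: "def1 S \<Longrightarrow> S \<noteq> {} \<Longrightarrow> \<forall>x\<in>S. x \<le> b \<Longrightarrow> dsup S \<le> b"
  using is_sup_dsup[of S b] unfolding is_sup_def by blast

lemma def1_uminus: "def1 S \<Longrightarrow> def1 {a. - a \<in> S}"
  unfolding def1_def[of "{a. - a \<in> S}"] mem_Collect_eq by (rule dpred_mem1, assumption) (intro d_intros)

lemma dinf_lower:
  assumes "def1 S" "x \<in> S" "\<forall>x\<in>S. b \<le> x"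
  shows "dinf S \<le> x"
  using dsup_upper[OF def1_uminus[OF assms(1)], of "- x" "- b"] assms(2,3)
  by (force simp: dinf_def minus_le_iff le_minus_iff)

lemma dinf_less:
  assumes "def1 S" "S \<noteq> {}" "\<forall>x\<in>S. b \<le> x" "dinf S < u"
  shows "\<exists>x\<in>S. x < u"
proof -
  have "\<exists>x\<in>{a. - a \<in> S}. - u < x"
  proof (rule less_dsup[OF def1_uminus[OF assms(1)]])
    show "{a. - a \<in> S} \<noteq> {}" using assms(2) by (metis (no_types, lifting) empty_Collect_eq equals0I minus_minus)
    show "\<forall>x\<in>{a. - a \<in> S}. x \<le> - b" using assms(3) by (auto simp: le_minus_iff)
    show "- u < dsup {a. - a \<in> S}" using assms(4) by (simp add: dinf_def minus_less_iff)
  qed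
  then show ?thesis by (metis mem_Collect_eq minus_less_iff)
qed

lemma le_dinf:
  assumes "def1 S" "S \<noteq> {}" "\<forall>x\<in>S. b \<le> x"
  shows "b \<le> dinf S"
  using dinf_less[OF assms] assms(3) by (meson not_le)

text \<open>Definable connectedness of an interval. The boundary point is the supremum
  \<open>z\<close> of the right ends of initial segments that stay in \<open>S\<close>.\<close>

lemma bd_between:
  assumes S: "def1 S" and "x \<in> S" "y \<notin> S" "x < y"
  shows "\<exists>z\<in>bd S. x \<le> z \<and> z \<le> y"
proof -
  define W where "W = {w. x \<le> w \<and> w \<le> y \<and> (\<forall>v. x \<le> v \<and> v \<le> w \<longrightarrow> v \<in> S)}"
  have W: "def1 W" unfolding W_def
    by (rule def1_Collect) (intro d_intros dpred_mem1[OF S])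
  have xW: "x \<in> W" using assms by (auto simp: W_def)
  have le: "\<forall>w\<in>W. w \<le> y" by (simp add: W_def)
  define z where "z = dsup W"
  have z: "x \<le> z" "z \<le> y"
    using dsup_upper[OF W xW le] dsup_le[OF W _ le] xW by (auto simp: z_def)
  have "z \<in> bd S" unfolding bd_def
  proof (intro CollectI allI impI conjI)
    fix \<epsilon> :: 'a assume \<epsilon>: "\<epsilon> > 0"
    then obtain w where w: "w \<in> W" "z - \<epsilon> < w" using less_dsup[OF W _ le, of "z - \<epsilon>"] xW by (auto simp: z_def)
    have "w \<le> z" using dsup_upper[OF W w(1) le] by (simp add: z_def)
    then show "\<exists>v\<in>S. \<bar>v - z\<bar> < \<epsilon>" using w by (intro bexI[of _ w]) (auto simp: W_def)
    show "\<exists>v. v \<notin> S \<and> \<bar>v - z\<bar> < \<epsilon>"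
    proof (rule ccontr)
      assume c: "\<not> ?thesis"
      \<comment> \<open>If all points within \<open>\<epsilon>\<close> of \<open>z\<close> lie in
        \<open>S\<close>, this point still belongs to \<open>W\<close>. Being at most
        \<open>z\<close> it must be \<open>y\<close>, which is not in \<open>S\<close>.\<close>
      let ?w = "min y (z + \<epsilon> / 2)"
      have "v \<in> S" if "x \<le> v" "v \<le> ?w" for v
      proof (cases "v \<le> w")
        case False
        then have "\<bar>v - z\<bar> < \<epsilon>" using w(2) that \<epsilon> by (auto simp: abs_if)
        then show ?thesis using c by blast
      qed (use w that in \<open>auto simp: W_def\<close>)
      then have "?w \<in> W" using \<epsilon> z assms(4) by (auto simp: W_def)
      then have "?w \<le> z" "?w \<in> S" using dsup_upper[OF W _ le] by (auto simp: z_def W_def)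
      then show False using \<epsilon> assms(3) by (auto simp: min_def split: if_splits)
    qed
  qed
  with z show ?thesis by blast
qed

lemma def1_Compl: "def1 S \<Longrightarrow> def1 (- S)"
  unfolding def1_def using dpred_not by simp

lemma no_bd_iff:
  assumes S: "def1 S" and "x \<le> y" "\<And>z. x \<le> z \<Longrightarrow> z \<le> y \<Longrightarrow> z \<notin> bd S"
  shows "x \<in> S \<longleftrightarrow> y \<in> S"
proof (cases "x = y")
  case False
  then have "x < y" using assms by simp
  then show ?thesis
    using bd_between[OF S, of x y] bd_between[OF def1_Compl[OF S], of x y] assms(3) bd_Compl[of S] by auto
qed simp

lemma infinite_def1_interval:
  assumes S: "def1 S" and "infinite S"
  shows "\<exists>c d. c < d \<and> {c<..<d} \<subseteq> S"
proof -
  obtain \<J> where \<J>: "finite \<J>" "\<And>J. J \<in> \<J> \<Longrightarrow> point_or_open_interval J" "S = \<Union>\<J>"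
    using def1_pieces[OF S] by metis
  then obtain J where J: "J \<in> \<J>" "infinite J" using assms(2) by fastforce
  have "\<exists>c d. c < d \<and> {c<..<d} \<subseteq> J"
  proof -
    consider x where "J = {x}" | c d where "J = {c<..<d}" | x where "J = {x<..}" | x where "J = {..<x}" | "J = UNIV"
      using \<J>(2)[OF J(1)] unfolding point_or_open_interval_def by blast
    then show ?thesis
    proof cases
      case (2 c d)
      then have "c < d" using J(2) by (metis finite.emptyI greaterThanLessThan_empty_iff not_le)
      then show ?thesis using 2 by blast
    next
      case (3 x)
      then show ?thesis by (intro exI[of _ x] exI[of _ "x + 1"]) auto
    next
      case (4 x)
      then show ?thesis by (intro exI[of _ "x - 1"] exI[of _ x]) auto
    next
      case 5
      then show ?thesis by (intro exI[of _ 0] exI[of _ 1]) auto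
    qed (use J(2) in simp)
  qed
  then show ?thesis using J(1) \<J>(3) by (metis Union_upper subset_trans)
qed

lemma infinite_interval:
  assumes S: "def1 S" and "infinite (S \<inter> {a<..<b})"
  obtains c d where "a \<le> c" "c < d" "d \<le> b" "\<And>u. c < u \<Longrightarrow> u < d \<Longrightarrow> u \<in> S"
proof -
  have "def1 (S \<inter> {a<..<b})"
    unfolding def1_def Int_iff greaterThanLessThan_iff by (intro d_intros dpred_mem1[OF S])
  from infinite_def1_interval[OF this assms(2)]
  obtain c d where cd: "c < d" "{c<..<d} \<subseteq> S \<inter> {a<..<b}" by blast
  then have "a \<le> c \<and> d \<le> b" using greaterThanLessThan_subseteq_greaterThanLessThan[of c d a b] by auto
  then show ?thesis using that[of c d] cd by (simp add: subset_iff)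
qed

lemma interval_dichotomy:
  assumes S: "def1 S" and "a < b"
  obtains c d where "a \<le> c" "c < d" "d \<le> b" "(\<forall>u. c < u \<and> u < d \<longrightarrow> u \<in> S) \<or> (\<forall>u. c < u \<and> u < d \<longrightarrow> u \<notin> S)"
proof -
  have "infinite {a<..<b}" using assms(2) infinite_Ioo by blast
  moreover have "{a<..<b} = (S \<inter> {a<..<b}) \<union> (- S \<inter> {a<..<b})" by blast
  ultimately have "infinite (S \<inter> {a<..<b}) \<or> infinite (- S \<inter> {a<..<b})" by (metis finite_UnI)
  then show ?thesis
    using infinite_interval[OF S] infinite_interval[OF def1_Compl[OF S]] that by (metis Compl_iff)
qed

text \<open>A one-dimensional Baire property: if every set \<open>{\<delta> \<ge> c}\<close> were finite, then \<open>\<delta>\<close> would have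
  finite fibres, hence infinite image, and the image would contain an interval bounded away from 0.\<close>

lemma bounded_below_on_interval:
  assumes \<delta>: "dfun (\<lambda>e. \<delta> (e 0))" and "a < b" and pos: "\<And>u. a < u \<Longrightarrow> u < b \<Longrightarrow> \<delta> u > 0"
  obtains \<epsilon> c d where "\<epsilon> > 0" "a \<le> c" "c < d" "d \<le> b" "\<And>u. c < u \<Longrightarrow> u < d \<Longrightarrow> \<epsilon> \<le> \<delta> u"
proof -
  have \<delta>': "dfun (\<lambda>e. \<delta> (g e))" if "dfun g" for g
    using dfun_comp[OF \<delta> dvec_scons[OF that dvec_id]] by simp
  have def: "def1 {u. \<epsilon> \<le> \<delta> u}" for \<epsilon>
    by (rule def1_Collect) (intro d_intros \<delta>')
  have "\<exists>\<epsilon>>0. infinite ({u. \<epsilon> \<le> \<delta> u} \<inter> {a<..<b})"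
  proof (rule ccontr)
    assume "\<not> ?thesis"
    then have fin: "finite ({u. \<epsilon> \<le> \<delta> u} \<inter> {a<..<b})" if "\<epsilon> > 0" for \<epsilon> using that by blast
    define T where "T = \<delta> ` {a<..<b}"
    have "def1 {y. \<exists>u. a < u \<and> u < b \<and> y = \<delta> u}"
      by (rule def1_Collect) (intro d_intros \<delta>')
    moreover have "{y. \<exists>u. a < u \<and> u < b \<and> y = \<delta> u} = T" by (auto simp: T_def)
    ultimately have T: "def1 T" by simp
    have "infinite T"
    proof
      assume "finite T"
      moreover have "finite {u \<in> {a<..<b}. \<delta> u = y}" if "y \<in> T" for y
        using that pos by (intro finite_subset[OF _ fin[of y]]) (auto simp: T_def)
      ultimately have "finite (\<Union>y\<in>T. {u \<in> {a<..<b}. \<delta> u = y})" by blast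
      moreover have "(\<Union>y\<in>T. {u \<in> {a<..<b}. \<delta> u = y}) = {a<..<b}" by (auto simp: T_def)
      ultimately have "finite {a<..<b}" by simp
      then show False using infinite_Ioo[OF assms(2)] by simp
    qed
    then obtain c d where "c < d" "{c<..<d} \<subseteq> T" using infinite_def1_interval[OF T] by blast
    then have cd: "c < d" "\<And>u. c < u \<Longrightarrow> u < d \<Longrightarrow> u \<in> T" by auto
    define m where "m = (c + d) / 2"
    have m: "c < m" "m < d" using cd(1) by (auto simp: m_def)
    then have "m > 0" using cd(2)[of m] pos by (auto simp: T_def)
    \<comment> \<open>Values in the upper half of the interval are attained only where
      \<open>\<delta>\<close> is at least \<open>m\<close>, a finite set; \<open>m\<close> is
      positive because it is itself a value of \<open>\<delta>\<close>.\<close>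
    have "{m<..<d} \<subseteq> \<delta> ` ({u. m \<le> \<delta> u} \<inter> {a<..<b})"
    proof
      fix y assume "y \<in> {m<..<d}"
      then have "y \<in> T" "m \<le> y" using cd(2)[of y] m by auto
      then show "y \<in> \<delta> ` ({u. m \<le> \<delta> u} \<inter> {a<..<b})" by (auto simp: T_def)
    qed
    then show False using fin[OF \<open>m > 0\<close>] infinite_Ioo[OF m(2)] finite_surj by blast
  qed
  then show ?thesis using infinite_interval[OF def] that by (metis mem_Collect_eq)
qed

end

section \<open>Generic behaviour on cubes\<close>

lemma bx_subset_E: "bx J x r \<subseteq> E J"
  by (auto simp: bx_def)

lemma bx_restrict [simp]: "bx J (restrict x J) r = bx J x r"
  by (auto simp: bx_def)

lemma center_in_bx: "r > 0 \<Longrightarrow> restrict x J \<in> bx J x r"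
  by (auto simp: bx_def)

lemma self_in_bx: "r > 0 \<Longrightarrow> x \<in> E J \<Longrightarrow> x \<in> bx J x r"
  by (auto simp: bx_def)

lemma bx_mono: "r \<le> s \<Longrightarrow> bx J x r \<subseteq> bx J x s"
  by (auto simp: bx_def)

lemma bx_open:
  assumes "finite J" "y \<in> bx J x (r::'a::linordered_field)"
  obtains s where "s > 0" "bx J y s \<subseteq> bx J x r"
proof -
  define s where "s = Min (insert 1 ((\<lambda>i. r - \<bar>y i - x i\<bar>) ` J))"
  have "s > 0" using assms by (auto simp: s_def bx_def)
  moreover have "bx J y s \<subseteq> bx J x r"
  proof
    fix z assume z: "z \<in> bx J y s"
    have "\<bar>z i - x i\<bar> < r" if "i \<in> J" for i
    proof -
      have "s \<le> r - \<bar>y i - x i\<bar>" using assms(1) that by (simp add: s_def)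
      moreover have "\<bar>z i - y i\<bar> < s" using z that by (simp add: bx_def)
      ultimately show ?thesis by linarith
    qed
    then show "z \<in> bx J x r" using z by (simp add: bx_def)
  qed
  ultimately show ?thesis using that by blast
qed

lemma bx_empty [simp]: "bx {} x r = {\<lambda>_. undefined}"
  by (auto simp: bx_def extensional_def)

lemma E_insert_iff: "m \<notin> J \<Longrightarrow> z \<in> E (insert m J) \<longleftrightarrow> z(m := undefined) \<in> E J"
  by (auto simp: extensional_def)

lemma bx_insert_iff:
  "m \<notin> J \<Longrightarrow> z \<in> bx (insert m J) x r \<longleftrightarrow> z(m := undefined) \<in> bx J x r \<and> \<bar>z m - x m\<bar> < r"
  by (auto simp: bx_def E_insert_iff)

lemma upd_in_bx_insert:
  "m \<notin> J \<Longrightarrow> y \<in> bx J x r \<Longrightarrow> \<bar>u - x m\<bar> < r \<Longrightarrow> y(m := u) \<in> bx (insert m J) x r"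
  by (subst bx_insert_iff) (auto simp: bx_def extensional_def fun_upd_idem)

definition cont_at :: "nat set \<Rightarrow> ((nat \<Rightarrow> 'a) \<Rightarrow> 'a::linordered_field) \<Rightarrow> (nat \<Rightarrow> 'a) \<Rightarrow> bool" where
  "cont_at J f x \<longleftrightarrow> (\<forall>\<epsilon>. \<epsilon> > 0 \<longrightarrow> (\<exists>r. r > 0 \<and> (\<forall>y\<in>bx J x r. \<bar>f y - f x\<bar> < \<epsilon>)))"

section \<open>Baire property and dichotomy, by induction on the dimension\<close>

context o_minimal_expansion begin

text \<open>The sets where \<open>\<epsilon> \<le> \<delta>\<close> exhaust the cube as
  \<open>\<epsilon>\<close> decreases, so one of them must have interior: a category statement for
  one increasing family, indexed by R instead of the integers.\<close>

definition Baire :: "nat set \<Rightarrow> bool" where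
  "Baire J \<longleftrightarrow> (\<forall>\<delta> x r. dfun \<delta> \<longrightarrow> r > 0 \<longrightarrow> (\<forall>y\<in>bx J x r. \<delta> y > 0) \<longrightarrow>
    (\<exists>x' r' \<epsilon>. r' > 0 \<and> \<epsilon> > 0 \<and> bx J x' r' \<subseteq> bx J x r \<and> (\<forall>y\<in>bx J x' r'. \<epsilon> \<le> \<delta> y)))"

text \<open>Excludes definable sets that are both dense and codense in a cube; together with
  \<open>Baire\<close> this takes the place of cell decomposition.\<close>

definition dichotomy :: "nat set \<Rightarrow> bool" where
  "dichotomy J \<longleftrightarrow> (\<forall>P x r. dpred P \<longrightarrow> r > 0 \<longrightarrow>
    (\<exists>x' r'. r' > 0 \<and> bx J x' r' \<subseteq> bx J x r \<and> ((\<forall>y\<in>bx J x' r'. P y) \<or> (\<forall>y\<in>bx J x' r'. \<not> P y))))"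

lemma BaireE:
  assumes "Baire J" "dfun \<delta>" "r > 0" "\<And>y. y \<in> bx J x r \<Longrightarrow> \<delta> y > 0"
  obtains x' r' \<epsilon> where "r' > 0" "\<epsilon> > 0" "bx J x' r' \<subseteq> bx J x r" "\<And>y. y \<in> bx J x' r' \<Longrightarrow> \<epsilon> \<le> \<delta> y"
proof -
  obtain x' r' \<epsilon> where "r' > 0" "\<epsilon> > 0" "bx J x' r' \<subseteq> bx J x r" "\<forall>y\<in>bx J x' r'. \<epsilon> \<le> \<delta> y"
    using assms(1)[unfolded Baire_def, rule_format, OF assms(2-4)] by blast
  then show ?thesis using that by blast
qed

lemma dichotomyE:
  assumes "dichotomy J" "dpred P" "r > 0"
  obtains x' r' where "r' > 0" "bx J x' r' \<subseteq> bx J x r" "\<And>y. y \<in> bx J x' r' \<Longrightarrow> P y"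
    | x' r' where "r' > 0" "bx J x' r' \<subseteq> bx J x r" "\<And>y. y \<in> bx J x' r' \<Longrightarrow> \<not> P y"
proof -
  obtain x' r' where *: "r' > 0" "bx J x' r' \<subseteq> bx J x r" "(\<forall>y\<in>bx J x' r'. P y) \<or> (\<forall>y\<in>bx J x' r'. \<not> P y)"
    using assms(1)[unfolded dichotomy_def, rule_format, OF assms(2,3)] by blast
  from *(3) show ?thesis using that(1)[OF *(1,2)] that(2)[OF *(1,2)] by blast
qed

text \<open>The infimum of all \<open>c\<close> such that \<open>f < c\<close> on some subcube is nearly attained by \<open>f\<close> on a subcube.\<close>

lemma small_oscillation:
  assumes J: "finite J" and B: "Baire J" and D: "dichotomy J" and f: "dfun f" and "r > 0" "\<epsilon> > 0"
  obtains x' r' c where "r' > 0" "bx J x' r' \<subseteq> bx J x r" "\<And>y. y \<in> bx J x' r' \<Longrightarrow> \<bar>f y - c\<bar> \<le> \<epsilon>"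
proof -
  \<comment> \<open>A positive lower bound \<open>k\<close> of this function on a subcube bounds the
    absolute value of \<open>f\<close> there by \<open>1 / k\<close>, so that the infimum
    \<open>c\<close> exists.\<close>
  have df: "dfun (\<lambda>y. 1 / (1 + \<bar>f y\<bar>))" by (intro d_intros f)
  have ps: "1 / (1 + \<bar>f y\<bar>) > 0" for y by (simp add: add_pos_nonneg)
  obtain x0 r0 k where 0: "r0 > 0" "k > 0" "bx J x0 r0 \<subseteq> bx J x r"
    "\<And>y. y \<in> bx J x0 r0 \<Longrightarrow> k \<le> 1 / (1 + \<bar>f y\<bar>)"
    by (rule BaireE[OF B df \<open>r > 0\<close> ps], rule that)
  define K where "K = 1 / k"
  have K: "\<bar>f y\<bar> \<le> K" if "y \<in> bx J x0 r0" for y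
  proof -
    have "1 + \<bar>f y\<bar> > 0" by (simp add: add_pos_nonneg)
    then have "k * (1 + \<bar>f y\<bar>) \<le> 1" using 0(4)[OF that] by (simp add: pos_le_divide_eq)
    then have "1 + \<bar>f y\<bar> \<le> K" using \<open>k > 0\<close> by (simp add: K_def pos_le_divide_eq mult.commute)
    then show ?thesis by simp
  qed
  define T where "T = {c. \<exists>x'\<in>E J. \<exists>r'. r' > 0 \<and> (\<forall>y\<in>bx J x' r'. y \<in> bx J x0 r0 \<and> f y < c)}"
  have T: "def1 T" unfolding T_def
    by (rule def1_Collect) (intro J d_intros dfun_comp[OF f])
  have TI: "c \<in> T" if "r' > 0" "bx J x' r' \<subseteq> bx J x0 r0" "\<And>y. y \<in> bx J x' r' \<Longrightarrow> f y < c" for c x' r'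
    unfolding T_def using that by (auto intro!: bexI[of _ "restrict x' J"] exI[of _ r'])
  have "f y < K + 1" if "y \<in> bx J x0 r0" for y using K[OF that] by linarith
  then have "K + 1 \<in> T" using \<open>r0 > 0\<close> by (intro TI[of r0 x0]) auto
  have Tl: "\<forall>c\<in>T. - K \<le> c"
  proof
    fix c assume "c \<in> T"
    then obtain x' r' where *: "r' > 0" "\<And>y. y \<in> bx J x' r' \<Longrightarrow> y \<in> bx J x0 r0 \<and> f y < c"
      unfolding T_def by blast
    from *(2)[OF center_in_bx[OF *(1)]] K[of "restrict x' J"] show "- K \<le> c" by (simp add: abs_le_iff)
  qed
  define c where "c = dinf T"
  obtain b where b: "b \<in> T" "b < c + \<epsilon>"
    using dinf_less[OF T _ Tl, of "c + \<epsilon>"] \<open>K + 1 \<in> T\<close> \<open>\<epsilon> > 0\<close> unfolding c_def by auto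
  then obtain x1 r1 where 1: "r1 > 0" "\<And>y. y \<in> bx J x1 r1 \<Longrightarrow> y \<in> bx J x0 r0 \<and> f y < b"
    unfolding T_def by blast
  have P: "dpred (\<lambda>y. f y < c - \<epsilon>)" by (intro d_intros f)
  show ?thesis
  proof (rule dichotomyE[OF D P \<open>r1 > 0\<close>, of x1])
    fix x2 r2 assume 2: "r2 > 0" "bx J x2 r2 \<subseteq> bx J x1 r1" "\<And>y. y \<in> bx J x2 r2 \<Longrightarrow> f y < c - \<epsilon>"
    then have "c - \<epsilon> \<in> T" using 1 by (intro TI[of r2 x2]) auto
    from dinf_lower[OF T this Tl] \<open>\<epsilon> > 0\<close> show ?thesis by (simp add: c_def)
  next
    fix x2 r2 assume 2: "r2 > 0" "bx J x2 r2 \<subseteq> bx J x1 r1" "\<And>y. y \<in> bx J x2 r2 \<Longrightarrow> \<not> f y < c - \<epsilon>"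
    show ?thesis
    proof (rule that[of r2 x2 c])
      show "bx J x2 r2 \<subseteq> bx J x r" using 2 1 0 by blast
      show "\<bar>f y - c\<bar> \<le> \<epsilon>" if "y \<in> bx J x2 r2" for y
      proof -
        have "f y < b" "\<not> f y < c - \<epsilon>" using that 1 2 by blast+
        then show ?thesis using b by linarith
      qed
    qed (rule 2)
  qed
qed

text \<open>\<open>Baire\<close> is applied to half the supremum of the witnesses
  \<open>l \<le> 1\<close>. The cap makes the supremum exist; halving leaves room for a true witness
  above \<open>\<epsilon>\<close>, since the supremum need not be attained.\<close>

lemma uniform_choice:
  assumes B: "Baire J" and R: "dpred (\<lambda>e. R (e 0) (etl e))" and r: "r > 0"
    and ex: "\<And>y. y \<in> bx J x r \<Longrightarrow> \<exists>l>0. R l y"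
    and mono: "\<And>y l l'. y \<in> bx J x r \<Longrightarrow> R l y \<Longrightarrow> 0 < l' \<Longrightarrow> l' \<le> l \<Longrightarrow> R l' y"
  obtains x' r' \<epsilon> where "r' > 0" "\<epsilon> > 0" "bx J x' r' \<subseteq> bx J x r" "\<And>y. y \<in> bx J x' r' \<Longrightarrow> R \<epsilon> y"
proof -
  define L where "L y = {l. 0 < l \<and> l \<le> 1 \<and> R l y}" for y
  have L: "dfam L" unfolding L_def by (intro dfam_Collect d_intros R)
  note L1 = def1_fam[OF L]
  have Lb: "\<forall>l\<in>L y. l \<le> 1" for y by (simp add: L_def)
  have Lne: "\<exists>l\<in>L y. l > 0" if y: "y \<in> bx J x r" for y
  proof -
    obtain l where "l > 0" "R l y" using ex[OF y] by blast
    then have "min 1 l \<in> L y" "min 1 l > 0" using mono[OF y, of l "min 1 l"] by (auto simp: L_def)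
    then show ?thesis by blast
  qed
  have df: "dfun (\<lambda>y. dsup (L y) / 2)" by (intro d_intros dfun_dsup L)
  have ps: "dsup (L y) / 2 > 0" if "y \<in> bx J x r" for y
    using Lne[OF that] dsup_upper[OF L1 _ Lb] by (meson half_gt_zero less_le_trans)
  obtain x0 r0 \<epsilon> where 0: "r0 > 0" "\<epsilon> > 0" "bx J x0 r0 \<subseteq> bx J x r"
    "\<And>y. y \<in> bx J x0 r0 \<Longrightarrow> \<epsilon> \<le> dsup (L y) / 2"
    by (rule BaireE[OF B df r ps], assumption, rule that)
  have "R \<epsilon> y" if y: "y \<in> bx J x0 r0" for y
  proof -
    have ne: "L y \<noteq> {}" using Lne[of y] y 0 by blast
    have lt: "\<epsilon> < dsup (L y)" using 0(2) 0(4)[OF y] by linarith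
    obtain l where "l \<in> L y" "\<epsilon> < l" using less_dsup[OF L1 ne Lb lt] by blast
    then show ?thesis using mono[of y l \<epsilon>] y 0 by (auto simp: L_def)
  qed
  with 0 show ?thesis using that by blast
qed

text \<open>Once the length \<open>\<epsilon>\<close> is uniform, the leftmost admissible left end
  is a definable function of \<open>y\<close>. On a subcube where it stays within
  \<open>\<epsilon> / 4\<close> of a constant \<open>c\<close>, the middle half of the interval from
  \<open>c\<close> to \<open>c + \<epsilon>\<close> lies in every fibre.\<close>

lemma common_interval:
  assumes J: "finite J" and B: "Baire J" and D: "dichotomy J" and A: "dfam A" and "r > 0"
    and ex: "\<And>y. y \<in> bx J x r \<Longrightarrow> \<exists>s t. lo \<le> s \<and> s < t \<and> t \<le> hi \<and> (\<forall>u. s < u \<and> u < t \<longrightarrow> u \<in> A y)"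
  obtains x' r' s t where "r' > 0" "bx J x' r' \<subseteq> bx J x r" "lo \<le> s" "s < t" "t \<le> hi"
    "\<And>y u. y \<in> bx J x' r' \<Longrightarrow> s < u \<Longrightarrow> u < t \<Longrightarrow> u \<in> A y"
proof -
  note Am = dfam_mem[OF A]
  define R where "R l y \<longleftrightarrow> (\<exists>s. lo \<le> s \<and> s + l \<le> hi \<and> (\<forall>u. s < u \<and> u < s + l \<longrightarrow> u \<in> A y))" for l y
  have R: "dpred (\<lambda>e. R (e 0) (etl e))" unfolding R_def by (intro d_intros Am)
  have R1: "\<exists>l>0. R l y" if y: "y \<in> bx J x r" for y
  proof -
    obtain s t where "lo \<le> s" "s < t" "t \<le> hi" "\<forall>u. s < u \<and> u < t \<longrightarrow> u \<in> A y" using ex[OF y] by blast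
    then show ?thesis by (intro exI[of _ "t - s"]) (auto simp: R_def intro!: exI[of _ s])
  qed
  have R2: "R l' y" if l: "R l y" "0 < l'" "l' \<le> l" for y l l'
  proof -
    obtain s where "lo \<le> s" "s + l \<le> hi" "\<forall>u. s < u \<and> u < s + l \<longrightarrow> u \<in> A y"
      using l(1) unfolding R_def by blast
    then show ?thesis using l(2,3) unfolding R_def by (intro exI[of _ s]) auto
  qed
  obtain x0 r0 \<epsilon> where 0: "r0 > 0" "\<epsilon> > 0" "bx J x0 r0 \<subseteq> bx J x r"
    "\<And>y. y \<in> bx J x0 r0 \<Longrightarrow> R \<epsilon> y"
    by (rule uniform_choice[OF B R \<open>r > 0\<close> R1 R2], assumption, assumption, assumption, assumption, rule that)
  define S where "S y = {s. lo \<le> s \<and> s + \<epsilon> \<le> hi \<and> (\<forall>u. s < u \<and> u < s + \<epsilon> \<longrightarrow> u \<in> A y)}" for y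
  have S: "dfam S" unfolding S_def by (intro dfam_Collect d_intros Am)
  note S1 = def1_fam[OF S]
  have Sne: "S y \<noteq> {}" if y: "y \<in> bx J x0 r0" for y
    using 0(4)[OF y] unfolding R_def S_def by blast
  have Sb: "\<forall>s\<in>S y. lo \<le> s" for y by (simp add: S_def)
  \<comment> \<open>The infimum is attained because only an open interval has to lie in
    \<open>A y\<close>: a point to the right of the infimum is also to the right of some element of
    \<open>S y\<close>.\<close>
  have g: "dinf (S y) \<in> S y" if y: "y \<in> bx J x0 r0" for y
  proof -
    have "u \<in> A y" if u: "dinf (S y) < u" "u < dinf (S y) + \<epsilon>" for u
    proof -
      obtain s where s: "s \<in> S y" "s < u" using dinf_less[OF S1 Sne[OF y] Sb u(1)] by blast
      moreover have "dinf (S y) \<le> s" by (rule dinf_lower[OF S1 s(1) Sb])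
      ultimately show ?thesis using u(2) by (simp add: S_def)
    qed
    moreover obtain s where "s \<in> S y" using Sne[OF y] by blast
    then have "dinf (S y) + \<epsilon> \<le> hi" using dinf_lower[OF S1 _ Sb, of s y] by (auto simp: S_def)
    moreover have "lo \<le> dinf (S y)" by (rule le_dinf[OF S1 Sne[OF y] Sb])
    ultimately show ?thesis by (simp add: S_def)
  qed
  have df: "dfun (\<lambda>y. dinf (S y))" by (intro dfun_dinf S)
  have e4: "\<epsilon> / 4 > 0" using 0(2) by simp
  obtain x1 r1 c where 1: "r1 > 0" "bx J x1 r1 \<subseteq> bx J x0 r0"
    "\<And>y. y \<in> bx J x1 r1 \<Longrightarrow> \<bar>dinf (S y) - c\<bar> \<le> \<epsilon> / 4"
    by (rule small_oscillation[OF J B D df 0(1) e4]) (rule that)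
  have *: "dinf (S y) \<le> c + \<epsilon> / 4" "c + 3 * \<epsilon> / 4 \<le> dinf (S y) + \<epsilon>" "dinf (S y) \<in> S y"
    if y: "y \<in> bx J x1 r1" for y
  proof -
    have "dinf (S y) - c \<le> \<epsilon> / 4" "c - dinf (S y) \<le> \<epsilon> / 4"
      using abs_le_D1[OF 1(3)[OF y]] abs_le_D2[OF 1(3)[OF y]] by simp_all
    then show "dinf (S y) \<le> c + \<epsilon> / 4" "c + 3 * \<epsilon> / 4 \<le> dinf (S y) + \<epsilon>" by (simp_all add: field_simps)
    show "dinf (S y) \<in> S y" using g 1(2) y by blast
  qed
  show ?thesis
  proof (rule that[of r1 x1 "c + \<epsilon> / 4" "c + 3 * \<epsilon> / 4"])
    show "bx J x1 r1 \<subseteq> bx J x r" using 1 0 by blast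
    show "c + \<epsilon> / 4 < c + 3 * \<epsilon> / 4" using 0(2) by simp
    note cc = *[OF center_in_bx[OF 1(1)]]
    have S_le: "lo \<le> s" "s + \<epsilon> \<le> hi" if "s \<in> S y" for s y using that unfolding S_def by blast+
    from S_le[OF cc(3)] show "lo \<le> c + \<epsilon> / 4" "c + 3 * \<epsilon> / 4 \<le> hi"
      using cc(1,2) by (meson order_trans)+
    show "u \<in> A y" if y: "y \<in> bx J x1 r1" and u: "c + \<epsilon> / 4 < u" "u < c + 3 * \<epsilon> / 4" for y u
    proof -
      have "dinf (S y) < u" "u < dinf (S y) + \<epsilon>"
        using le_less_trans[OF *(1)[OF y] u(1)] less_le_trans[OF u(2) *(2)[OF y]] .
      moreover have "\<forall>u. s < u \<and> u < s + \<epsilon> \<longrightarrow> u \<in> A y" if "s \<in> S y" for s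
        using that unfolding S_def by blast
      ultimately show ?thesis using *(3)[OF y] by blast
    qed
  qed (rule 1)
qed

lemma cube_over_interval:
  assumes "m \<notin> J" "r' > 0" "s < (t::'a)"
  obtains z q where "q > 0"
    "\<And>w. w \<in> bx (insert m J) z q \<Longrightarrow> w(m := undefined) \<in> bx J x' r' \<and> s < w m \<and> w m < t"
proof -
  define z where "z = x'(m := (s + t) / 2)"
  define q where "q = min r' ((t - s) / 2)"
  have "w(m := undefined) \<in> bx J x' r' \<and> s < w m \<and> w m < t" if "w \<in> bx (insert m J) z q" for w
  proof -
    have "w(m := undefined) \<in> bx J z q" "\<bar>w m - z m\<bar> < q"
      using that unfolding bx_insert_iff[OF assms(1)] by auto
    moreover have "bx J z q \<subseteq> bx J x' r'"
      using assms(1) by (auto simp: bx_def z_def q_def)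
    moreover have "q \<le> (t - s) / 2" unfolding q_def by (rule min.cobounded2)
    moreover have "z m = (s + t) / 2" by (simp add: z_def)
    ultimately show ?thesis by (auto simp: abs_less_iff field_simps)
  qed
  moreover have "q > 0" using assms by (simp add: q_def)
  ultimately show ?thesis using that by blast
qed

lemma subcube_insert:
  assumes "m \<notin> J" "r' > 0" "bx J x' r' \<subseteq> bx J x r" "x m - r \<le> s" "s < t" "t \<le> x m + r"
  obtains z q where "q > 0" "bx (insert m J) z q \<subseteq> bx (insert m J) x (r::'a)"
    "\<And>w. w \<in> bx (insert m J) z q \<Longrightarrow> w(m := undefined) \<in> bx J x' r' \<and> s < w m \<and> w m < t"
proof -
  obtain z q where *: "q > 0"
    "\<And>w. w \<in> bx (insert m J) z q \<Longrightarrow> w(m := undefined) \<in> bx J x' r' \<and> s < w m \<and> w m < t"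
    by (rule cube_over_interval[OF assms(1,2,5)]) (rule that)
  have "w \<in> bx (insert m J) x r" if "w \<in> bx (insert m J) z q" for w
    using *(2)[OF that] assms(3-6) unfolding bx_insert_iff[OF assms(1)]
    by (auto simp: abs_less_iff)
  then show ?thesis using that * by blast
qed

text \<open>On each line over \<open>y\<close> the one-dimensional case gives a bound
  \<open>l\<close> on some interval. \<open>uniform_choice\<close> makes \<open>l\<close>
  independent of \<open>y\<close>, \<open>common_interval\<close> does so for the interval, and both
  together span a cube.\<close>

lemma Baire_insert:
  assumes J: "finite J" "m \<notin> J" and B: "Baire J" and D: "dichotomy J"
  shows "Baire (insert m J)"
  unfolding Baire_def
proof (intro allI impI)
  fix \<delta> x and r :: 'a
  assume \<delta>: "dfun \<delta>" and r: "r > 0" and pos: "\<forall>y\<in>bx (insert m J) x r. \<delta> y > 0"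
  define lo hi where "lo = x m - r" "hi = x m + r"
  note \<delta>' = dfun_comp[OF \<delta>]
  define R where "R l y \<longleftrightarrow> (\<exists>s t. lo \<le> s \<and> s < t \<and> t \<le> hi \<and> (\<forall>u. s < u \<and> u < t \<longrightarrow> l \<le> \<delta> (y(m := u))))" for l y
  have R: "dpred (\<lambda>e. R (e 0) (etl e))" unfolding R_def by (intro d_intros \<delta>')
  have R1: "\<exists>l>0. R l y" if y: "y \<in> bx J x r" for y
  proof -
    have df: "dfun (\<lambda>e. \<delta> (y(m := e 0)))" by (intro \<delta>' d_intros)
    have ps: "\<delta> (y(m := u)) > 0" if "lo < u" "u < hi" for u
      using pos upd_in_bx_insert[OF J(2) y, of u] that by (simp add: lo_hi_def abs_less_iff algebra_simps)
    have lh: "lo < hi" using r by (simp add: lo_hi_def)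
    obtain \<epsilon> s t where "\<epsilon> > 0" "lo \<le> s" "s < t" "t \<le> hi" "\<And>u. s < u \<Longrightarrow> u < t \<Longrightarrow> \<epsilon> \<le> \<delta> (y(m := u))"
      by (rule bounded_below_on_interval[of "\<lambda>u. \<delta> (y(m := u))", OF df lh ps], assumption, assumption, rule that)
    then show ?thesis unfolding R_def by blast
  qed
  have R2: "R l' y" if "R l y" "0 < l'" "l' \<le> l" for y l l'
    using that unfolding R_def by (meson order_trans)
  obtain x0 r0 \<epsilon> where 0: "r0 > 0" "\<epsilon> > 0" "bx J x0 r0 \<subseteq> bx J x r"
    "\<And>y. y \<in> bx J x0 r0 \<Longrightarrow> R \<epsilon> y"
    by (rule uniform_choice[OF B R r R1 R2], assumption, assumption, assumption, assumption, rule that)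
  define A where "A y = {u. \<epsilon> \<le> \<delta> (y(m := u))}" for y
  have A: "dfam A" unfolding A_def by (intro dfam_Collect d_intros \<delta>')
  have ex: "\<exists>s t. lo \<le> s \<and> s < t \<and> t \<le> hi \<and> (\<forall>u. s < u \<and> u < t \<longrightarrow> u \<in> A y)" if "y \<in> bx J x0 r0" for y
    using 0(4)[OF that] unfolding R_def A_def by simp
  obtain x1 r1 s t where 1: "r1 > 0" "bx J x1 r1 \<subseteq> bx J x0 r0" "lo \<le> s" "s < t" "t \<le> hi"
    "\<And>y u. y \<in> bx J x1 r1 \<Longrightarrow> s < u \<Longrightarrow> u < t \<Longrightarrow> u \<in> A y"
    by (rule common_interval[OF J(1) B D A 0(1) ex], assumption, rule that)
  obtain z q where zq: "q > 0" "bx (insert m J) z q \<subseteq> bx (insert m J) x r"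
    "\<And>w. w \<in> bx (insert m J) z q \<Longrightarrow> w(m := undefined) \<in> bx J x1 r1 \<and> s < w m \<and> w m < t"
    by (rule subcube_insert[OF J(2) 1(1) subset_trans[OF 1(2) 0(3)] 1(3)[unfolded lo_hi_def] 1(4)
      1(5)[unfolded lo_hi_def]]) (rule that)
  have "\<epsilon> \<le> \<delta> w" if "w \<in> bx (insert m J) z q" for w
    using zq(3)[OF that] 1(6)[of "w(m := undefined)" "w m"] by (simp add: A_def)
  then show "\<exists>x' r' \<epsilon>. r' > 0 \<and> \<epsilon> > 0 \<and> bx (insert m J) x' r' \<subseteq> bx (insert m J) x r \<and>
      (\<forall>y\<in>bx (insert m J) x' r'. \<epsilon> \<le> \<delta> y)"
    using zq(1,2) 0(2) by blast
qed

text \<open>Whether the line over \<open>y\<close> contains an interval of \<open>P\<close> within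
  the given range is a definable question about \<open>y\<close>, settled on a cube by the case
  \<open>J\<close>. If the answer is no, each such line contains an interval of the
  negation.\<close>

lemma dichotomy_insert:
  assumes J: "finite J" "m \<notin> J" and B: "Baire J" and D: "dichotomy J"
  shows "dichotomy (insert m J)"
  unfolding dichotomy_def
proof (intro allI impI)
  fix P x and r :: 'a
  assume P: "dpred P" and r: "r > 0"
  define lo hi where "lo = x m - r" "hi = x m + r"
  have lh: "lo < hi" using r by (simp add: lo_hi_def)
  note P' = dpred_comp[OF P]
  have *: "\<exists>x' r'. r' > 0 \<and> bx (insert m J) x' r' \<subseteq> bx (insert m J) x r \<and> (\<forall>y\<in>bx (insert m J) x' r'. Q y)"
    if Q: "dpred Q" and 0: "r0 > 0" "bx J x0 r0 \<subseteq> bx J x r"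
      "\<And>y. y \<in> bx J x0 r0 \<Longrightarrow> \<exists>s t. lo \<le> s \<and> s < t \<and> t \<le> hi \<and> (\<forall>u. s < u \<and> u < t \<longrightarrow> Q (y(m := u)))" for Q x0 r0
  proof -
    have A: "dfam (\<lambda>y. {u. Q (y(m := u))})" by (intro dfam_Collect d_intros dpred_comp[OF Q])
    obtain x1 r1 s t where 1: "r1 > 0" "bx J x1 r1 \<subseteq> bx J x0 r0" "lo \<le> s" "s < t" "t \<le> hi"
      "\<And>y u. y \<in> bx J x1 r1 \<Longrightarrow> s < u \<Longrightarrow> u < t \<Longrightarrow> u \<in> {u. Q (y(m := u))}"
      by (rule common_interval[OF J(1) B D A 0(1), of x0 lo hi]) (use 0(3) in simp, rule that)
    obtain z q where zq: "q > 0" "bx (insert m J) z q \<subseteq> bx (insert m J) x r"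
      "\<And>w. w \<in> bx (insert m J) z q \<Longrightarrow> w(m := undefined) \<in> bx J x1 r1 \<and> s < w m \<and> w m < t"
      by (rule subcube_insert[OF J(2) 1(1) subset_trans[OF 1(2) 0(2)] 1(3)[unfolded lo_hi_def] 1(4)
      1(5)[unfolded lo_hi_def]]) (rule that)
    have "Q w" if "w \<in> bx (insert m J) z q" for w
      using zq(3)[OF that] 1(6)[of "w(m := undefined)" "w m"] by simp
    then show ?thesis using zq by blast
  qed
  define R where "R y \<longleftrightarrow> (\<exists>s t. lo \<le> s \<and> s < t \<and> t \<le> hi \<and> (\<forall>u. s < u \<and> u < t \<longrightarrow> P (y(m := u))))" for y
  have R: "dpred R" unfolding R_def by (intro d_intros P')
  show "\<exists>x' r'. r' > 0 \<and> bx (insert m J) x' r' \<subseteq> bx (insert m J) x r \<and>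
      ((\<forall>y\<in>bx (insert m J) x' r'. P y) \<or> (\<forall>y\<in>bx (insert m J) x' r'. \<not> P y))"
  proof (rule dichotomyE[OF D R r, of x])
    fix x0 r0 assume "r0 > 0" "bx J x0 r0 \<subseteq> bx J x r" "\<And>y. y \<in> bx J x0 r0 \<Longrightarrow> R y"
    from *[OF P this(1,2) this(3)[unfolded R_def]] show ?thesis by blast
  next
    fix x0 r0 assume 0: "r0 > 0" "bx J x0 r0 \<subseteq> bx J x r" "\<And>y. y \<in> bx J x0 r0 \<Longrightarrow> \<not> R y"
    have "\<exists>s t. lo \<le> s \<and> s < t \<and> t \<le> hi \<and> (\<forall>u. s < u \<and> u < t \<longrightarrow> \<not> P (y(m := u)))" if y: "y \<in> bx J x0 r0" for y
    proof -
      have "def1 {u. P (y(m := u))}" by (rule def1_Collect) (intro d_intros P')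
      from this lh obtain s t where st: "lo \<le> s" "s < t" "t \<le> hi"
        "(\<forall>u. s < u \<and> u < t \<longrightarrow> P (y(m := u))) \<or> (\<forall>u. s < u \<and> u < t \<longrightarrow> \<not> P (y(m := u)))"
        by (rule interval_dichotomy[unfolded mem_Collect_eq]) (auto intro: that)
      then show ?thesis using 0(3)[OF y] unfolding R_def by blast
    qed
    from *[OF dpred_not[OF P] 0(1,2) this] show ?thesis by blast
  qed
qed

lemma Baire_dichotomy: "finite J \<Longrightarrow> Baire J \<and> dichotomy J"
proof (induction J rule: finite_induct)
  case empty
  have "Baire {}" unfolding Baire_def
  proof (intro allI impI)
    fix \<delta> :: "(nat \<Rightarrow> 'a) \<Rightarrow> 'a" and x and r :: 'a assume "r > 0" "\<forall>y\<in>bx {} x r. \<delta> y > 0"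
    then show "\<exists>x' r' \<epsilon>. r' > 0 \<and> \<epsilon> > 0 \<and> bx {} x' r' \<subseteq> bx {} x r \<and> (\<forall>y\<in>bx {} x' r'. \<epsilon> \<le> \<delta> y)"
      by (intro exI[of _ x] exI[of _ r] exI[of _ "\<delta> (\<lambda>_. undefined)"]) simp
  qed
  moreover have "dichotomy {}" unfolding dichotomy_def by auto
  ultimately show ?case ..
next
  case (insert m J)
  then show ?case using Baire_insert dichotomy_insert by blast
qed

lemmas Baire = Baire_dichotomy[THEN conjunct1]
lemmas dichotomy = Baire_dichotomy[THEN conjunct2]

lemma dpred_cont_at:
  assumes J: "finite J" and f: "dfun f"
  shows "dpred (cont_at J f)"
  unfolding cont_at_def by (intro J d_intros dfun_comp[OF f])

text \<open>Discontinuity on a whole cube would give, by \<open>uniform_choice\<close>, jumps of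
  size \<open>\<epsilon>\<close> at all points of a subcube; but on a still smaller one
  \<open>f\<close> stays within \<open>\<epsilon> / 4\<close> of a constant.\<close>

lemma generic_continuity:
  assumes J: "finite J" and f: "dfun f" and r: "r > 0"
  obtains x' r' where "r' > 0" "bx J x' r' \<subseteq> bx J x r" "\<And>y. y \<in> bx J x' r' \<Longrightarrow> cont_at J f y"
proof (rule dichotomyE[OF dichotomy[OF J] dpred_cont_at[OF J f] r, of x])
  fix x0 r0 assume 0: "r0 > 0" "bx J x0 r0 \<subseteq> bx J x r" "\<And>y. y \<in> bx J x0 r0 \<Longrightarrow> \<not> cont_at J f y"
  note f' = dfun_comp[OF f]
  define R where "R l x \<longleftrightarrow> (\<forall>r. r > 0 \<longrightarrow> (\<exists>y\<in>bx J x r. l \<le> \<bar>f y - f x\<bar>))" for l x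
  have R: "dpred (\<lambda>e. R (e 0) (etl e))" unfolding R_def by (intro d_intros J f')
  have R1: "\<exists>l>0. R l y" if y: "y \<in> bx J x0 r0" for y
    using 0(3)[OF y] unfolding cont_at_def R_def by (meson not_le)
  have R2: "R l' y" if "R l y" "0 < l'" "l' \<le> l" for y l l'
    using that unfolding R_def by (meson order_trans)
  obtain x1 r1 \<epsilon> where 1: "r1 > 0" "\<epsilon> > 0" "bx J x1 r1 \<subseteq> bx J x0 r0"
    "\<And>y. y \<in> bx J x1 r1 \<Longrightarrow> R \<epsilon> y"
    by (rule uniform_choice[OF Baire[OF J] R 0(1) R1 R2], assumption, assumption, assumption, assumption, rule that)
  have e4: "\<epsilon> / 4 > 0" using 1(2) by simp
  obtain x2 r2 c where 2: "r2 > 0" "bx J x2 r2 \<subseteq> bx J x1 r1" "\<And>y. y \<in> bx J x2 r2 \<Longrightarrow> \<bar>f y - c\<bar> \<le> \<epsilon> / 4"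
    by (rule small_oscillation[OF J Baire[OF J] dichotomy[OF J] f 1(1) e4]) (rule that)
  define y where "y = restrict x2 J"
  have y: "y \<in> bx J x2 r2" unfolding y_def by (rule center_in_bx[OF 2(1)])
  then obtain s where s: "s > 0" "bx J y s \<subseteq> bx J x2 r2" using bx_open[OF J] by metis
  then obtain z where "z \<in> bx J y s" "\<epsilon> \<le> \<bar>f z - f y\<bar>"
    using 1(4)[of y] 2(2) y s(1) unfolding R_def by blast
  then have "\<bar>f z - c\<bar> \<le> \<epsilon> / 4" "\<bar>f y - c\<bar> \<le> \<epsilon> / 4" "\<epsilon> \<le> \<bar>f z - f y\<bar>" using 2(3) s(2) y by auto
  then have "\<epsilon> \<le> \<epsilon> / 4 + \<epsilon> / 4" by linarith
  then show thesis using 1(2) by (simp add: field_simps)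
qed (use that in blast)

end

section \<open>Piecewise continuity and locally constant functions\<close>

text \<open>Cardinality is not first-order, but for fixed \<open>k\<close> this is.
  \<open>atleast_Suc\<close> peels off the least of the chosen elements, which gives definability by
  induction on \<open>k\<close>.\<close>

definition atleast :: "nat \<Rightarrow> 'a set \<Rightarrow> bool" where
  "atleast k S \<longleftrightarrow> (\<exists>T\<subseteq>S. finite T \<and> card T = k)"

lemma atleast_iff_card: "finite S \<Longrightarrow> atleast k S \<longleftrightarrow> k \<le> card S"
  unfolding atleast_def by (metis card_mono finite_subset obtain_subset_with_card_n)

lemma atleast_0: "atleast 0 S"
  unfolding atleast_def by (intro exI[of _ "{}"]) simp

lemma atleast_Suc: "atleast (Suc k) S \<longleftrightarrow> (\<exists>b. b \<in> S \<and> atleast k (S \<inter> {b::'a::linorder<..}))"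
proof
  assume "atleast (Suc k) S"
  then obtain T where T: "T \<subseteq> S" "finite T" "card T = Suc k" unfolding atleast_def by blast
  then have "T \<noteq> {}" by auto
  let ?b = "Min T"
  have "?b \<in> T" using T \<open>T \<noteq> {}\<close> by simp
  moreover have "T - {?b} \<subseteq> S \<inter> {?b<..}" using T by (auto simp: less_le)
  moreover have "card (T - {?b}) = k" using T \<open>?b \<in> T\<close> by simp
  ultimately show "\<exists>b. b \<in> S \<and> atleast k (S \<inter> {b<..})"
    unfolding atleast_def using T by (intro exI[of _ ?b]) blast
next
  assume "\<exists>b. b \<in> S \<and> atleast k (S \<inter> {b<..})"
  then obtain b T where T: "b \<in> S" "T \<subseteq> S \<inter> {b<..}" "finite T" "card T = k" unfolding atleast_def by blast
  then have "b \<notin> T" by auto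
  then show "atleast (Suc k) S" unfolding atleast_def using T
    by (intro exI[of _ "insert b T"]) auto
qed

text \<open>The points in which a definable function of one further variable has to be sampled in order
  to meet every component of the complement of the finite set \<open>A\<close>.\<close>

lemma sample_between:
  fixes u :: "'a::linordered_field"
  assumes A: "finite A" and u: "u \<notin> A"
  obtains w where "w = 0 \<or> (\<exists>a\<in>A. w = a - 1 \<or> w = a + 1) \<or> (\<exists>a\<in>A. \<exists>b\<in>A. w = (a + b) / 2)"
    "\<And>z. min u w \<le> z \<Longrightarrow> z \<le> max u w \<Longrightarrow> z \<notin> A"
proof -
  let ?L = "A \<inter> {..<u}" and ?U = "A \<inter> {u<..}"
  have L: "a \<in> ?L \<Longrightarrow> a \<le> Max ?L" and U: "a \<in> ?U \<Longrightarrow> Min ?U \<le> a" for a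
    using A by simp_all
  have AA: "a \<in> ?L \<or> a \<in> ?U" if "a \<in> A" for a using that u linorder_less_linear[of a u] by auto
  consider "?L = {}" "?U = {}" | "?L = {}" "?U \<noteq> {}" | "?L \<noteq> {}" "?U = {}" | "?L \<noteq> {}" "?U \<noteq> {}" by blast
  then show ?thesis
  proof cases
    case 1
    then have "A = {}" using AA by blast
    then show ?thesis using that[of 0] by simp
  next
    case 2
    then have m: "Min ?U \<in> ?U" using A by (intro Min_in) auto
    show ?thesis
    proof (rule that[of "Min ?U - 1"])
      fix z assume z: "min u (Min ?U - 1) \<le> z" "z \<le> max u (Min ?U - 1)"
      then have "z < Min ?U" using m by (auto simp: max_def split: if_splits)
      then show "z \<notin> A" using AA[of z] U[of z] 2(1) by auto
    qed (use m in blast)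
  next
    case 3
    then have m: "Max ?L \<in> ?L" using A by (intro Max_in) auto
    show ?thesis
    proof (rule that[of "Max ?L + 1"])
      fix z assume z: "min u (Max ?L + 1) \<le> z" "z \<le> max u (Max ?L + 1)"
      then have "z > Max ?L" using m by (auto simp: min_def split: if_splits intro: less_le_trans)
      then show "z \<notin> A" using AA[of z] L[of z] 3(2) by auto
    qed (use m in blast)
  next
    case 4
    have m1: "Max ?L \<in> ?L" using A 4 by (intro Max_in) auto
    have m2: "Min ?U \<in> ?U" using A 4 by (intro Min_in) auto
    note m = m1 m2
    show ?thesis
    proof (rule that[of "(Max ?L + Min ?U) / 2"])
      fix z assume z: "min u ((Max ?L + Min ?U) / 2) \<le> z" "z \<le> max u ((Max ?L + Min ?U) / 2)"
      have lu: "Max ?L < Min ?U" using m by auto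
      have "z > Max ?L" using z(1) m lu by (auto simp: min_def field_simps split: if_splits)
      moreover have "z < Min ?U" using z(2) m lu by (auto simp: max_def field_simps split: if_splits)
      ultimately show "z \<notin> A" using AA[of z] L[of z] U[of z] by auto
    qed (use m in blast)
  qed
qed

lemma common_radius:
  assumes "finite S" "\<And>a. a \<in> S \<Longrightarrow> \<exists>r>0. \<forall>y\<in>bx J x r. P a y"
  shows "\<exists>r>0::'a::linordered_field. \<forall>a\<in>S. \<forall>y\<in>bx J x r. P a y"
  using assms
proof (induction S rule: finite_induct)
  case empty
  show ?case by (intro exI[of _ 1]) simp
next
  case (insert a S)
  then obtain r s where "r > 0" "\<forall>y\<in>bx J x r. P a y" "s > 0" "\<forall>a\<in>S. \<forall>y\<in>bx J x s. P a y" by blast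
  then show ?case using bx_mono[of "min r s" r J x] bx_mono[of "min r s" s J x]
    by (intro exI[of _ "min r s"]) (auto simp: subset_iff)
qed

section \<open>The four tameness properties of an index set\<close>

context o_minimal_expansion begin

definition thin :: "nat set \<Rightarrow> ((nat \<Rightarrow> 'a) \<Rightarrow> bool) \<Rightarrow> bool" where
  "thin J P \<longleftrightarrow> (\<forall>x r. r > 0 \<longrightarrow> (\<exists>y\<in>bx J x r. \<not> P y))"

definition nbhd :: "nat set \<Rightarrow> ((nat \<Rightarrow> 'a) \<Rightarrow> bool) \<Rightarrow> (nat \<Rightarrow> 'a) \<Rightarrow> bool" where
  "nbhd J P x \<longleftrightarrow> (\<exists>r. r > 0 \<and> (\<forall>y\<in>bx J x r. P y))"

lemma dpred_nbhd: "finite J \<Longrightarrow> dpred P \<Longrightarrow> dpred (nbhd J P)"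
proof -
  assume "finite J" and P: "dpred P"
  then show ?thesis unfolding nbhd_def by (intro d_intros dpred_comp[OF P])
qed

lemma nbhd_nbhd: "finite J \<Longrightarrow> nbhd J P x \<Longrightarrow> nbhd J (nbhd J P) x"
  unfolding nbhd_def by (meson bx_open subset_iff)

text \<open>Stated with functions instead of a bound on \<open>card (A x)\<close>: the functions are
  what subdivisions are made of, and at exceptional points they are inherited from lower dimension
  without a common ranking.\<close>

definition uniformly_finite :: "nat set \<Rightarrow> bool" where
  "uniformly_finite J \<longleftrightarrow> (\<forall>A. dfam A \<longrightarrow> (\<forall>x\<in>E J. finite (A x)) \<longrightarrow>
    (\<exists>G. finite G \<and> (\<forall>g\<in>G. dfun g) \<and> (\<forall>x\<in>E J. \<forall>u\<in>A x. \<exists>g\<in>G. u = g x)))"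

definition thin_in_graphs :: "nat set \<Rightarrow> bool" where
  "thin_in_graphs J \<longleftrightarrow> (\<forall>P. dpred P \<longrightarrow> thin J P \<longrightarrow>
    (\<exists>G. finite G \<and> (\<forall>(m, g)\<in>G. m \<in> J \<and> dfun g) \<and>
      (\<forall>x\<in>E J. P x \<longrightarrow> (\<exists>(m, g)\<in>G. x m = g (x(m := undefined))))))"

text \<open>It is \<open>g\<close>, not \<open>f\<close>, that is continuous on the open set
  \<open>U\<close>; \<open>f\<close> only shares a value with some \<open>g\<close> at each point.
  Thus the pieces stay open in R^J even where \<open>f\<close> is discontinuous.\<close>

definition piecewise_cont :: "nat set \<Rightarrow> bool" where
  "piecewise_cont J \<longleftrightarrow> (\<forall>f. dfun f \<longrightarrow>
    (\<exists>G. finite G \<and> (\<forall>(g, U)\<in>G. dfun g \<and> dpred U \<and> (\<forall>x\<in>E J. U x \<longrightarrow> cont_at J g x \<and> nbhd J U x)) \<and>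
      (\<forall>x\<in>E J. \<exists>(g, U)\<in>G. U x \<and> f x = g x)))"

text \<open>Replaces finiteness of the number of definably connected components. The values of
  \<open>N\<close> are not elements of R, so definability is asked of its level sets; constancy is
  local within \<open>G\<close>.\<close>

definition loc_const_finite :: "nat set \<Rightarrow> bool" where
  "loc_const_finite J \<longleftrightarrow> (\<forall>G (N :: (nat \<Rightarrow> 'a) \<Rightarrow> nat). dpred G \<longrightarrow>
    (\<forall>k. \<exists>Q. dpred Q \<and> (\<forall>x\<in>E J. Q x \<longleftrightarrow> N x = k)) \<longrightarrow>
    (\<forall>x\<in>E J. G x \<longrightarrow> nbhd J (\<lambda>y. G y \<longrightarrow> N y = N x) x) \<longrightarrow> finite (N ` {x \<in> E J. G x}))"

lemma uniformly_finiteE: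
  assumes "uniformly_finite J" "dfam A" "\<And>x. x \<in> E J \<Longrightarrow> finite (A x)"
  obtains G where "finite G" "\<And>g. g \<in> G \<Longrightarrow> dfun g" "\<And>x u. x \<in> E J \<Longrightarrow> u \<in> A x \<Longrightarrow> \<exists>g\<in>G. u = g x"
  using assms(1)[unfolded uniformly_finite_def, rule_format, OF assms(2,3)] by blast

lemma thin_in_graphsE:
  assumes "thin_in_graphs J" "dpred P" "thin J P"
  obtains G where "finite G" "\<And>m g. (m, g) \<in> G \<Longrightarrow> m \<in> J \<and> dfun g"
    "\<And>x. x \<in> E J \<Longrightarrow> P x \<Longrightarrow> \<exists>m g. (m, g) \<in> G \<and> x m = g (x(m := undefined))"
proof -
  obtain G where "finite G" "\<forall>(m, g)\<in>G. m \<in> J \<and> dfun g"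
    "\<forall>x\<in>E J. P x \<longrightarrow> (\<exists>(m, g)\<in>G. x m = g (x(m := undefined)))"
    using assms(1)[unfolded thin_in_graphs_def, rule_format, OF assms(2,3)] by blast
  then show ?thesis by (intro that[of G]) fast+
qed

lemma piecewise_contE:
  assumes "piecewise_cont J" "dfun f"
  obtains G where "finite G" "\<And>g U. (g, U) \<in> G \<Longrightarrow> dfun g" "\<And>g U. (g, U) \<in> G \<Longrightarrow> dpred U"
    "\<And>g U x. (g, U) \<in> G \<Longrightarrow> x \<in> E J \<Longrightarrow> U x \<Longrightarrow> cont_at J g x \<and> nbhd J U x"
    "\<And>x. x \<in> E J \<Longrightarrow> \<exists>g U. (g, U) \<in> G \<and> U x \<and> f x = g x"
proof -
  obtain G where "finite G" "\<forall>(g, U)\<in>G. dfun g \<and> dpred U \<and> (\<forall>x\<in>E J. U x \<longrightarrow> cont_at J g x \<and> nbhd J U x)"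
    "\<forall>x\<in>E J. \<exists>(g, U)\<in>G. U x \<and> f x = g x"
    using assms(1)[unfolded piecewise_cont_def, rule_format, OF assms(2)] by blast
  then show ?thesis by (intro that[of G]) fast+
qed

lemma dpred_atleast: "dfam A \<Longrightarrow> dpred (\<lambda>x. atleast k (A x))"
proof (induction k arbitrary: A)
  case 0
  show ?case by (simp add: atleast_0 dpred_const)
next
  case (Suc k)
  have "dfam (\<lambda>e. A (etl e) \<inter> {e 0<..})"
    unfolding dfam_def Int_iff greaterThan_iff by (intro d_intros dfam_mem[OF Suc(2)])
  from Suc(1)[OF this] have "dpred (\<lambda>e. atleast k (A (etl e) \<inter> {e 0<..}))" .
  then show ?case unfolding atleast_Suc
    by (intro dpred_ex dpred_conj dfam_mem[OF Suc(2)] d_intros)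
qed

text \<open>This selects the element of rank \<open>i\<close>, counted from 0:
  \<open>atleast i\<close> without \<open>atleast (Suc i)\<close> says that exactly \<open>i\<close>
  elements lie below it.\<close>

lemma dfun_ranked:
  assumes A: "dfam A"
  shows "dfun (\<lambda>x. the1 (\<lambda>a. a \<in> A x \<and> atleast i (A x \<inter> {..<a}) \<and> \<not> atleast (Suc i) (A x \<inter> {..<a})))"
proof -
  have "dfam (\<lambda>e. A (etl e) \<inter> {..<e 0})"
    unfolding dfam_def Int_iff lessThan_iff by (intro d_intros dfam_mem[OF A])
  note B = dpred_atleast[OF this]
  show ?thesis by (intro dfun_the1 dpred_conj dpred_not B dfam_mem[OF A] d_intros)
qed

lemma ranked_eq:
  fixes S :: "'b::{linorder,zero} set"
  assumes S: "finite S" and u: "u \<in> S"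
  shows "the1 (\<lambda>a. a \<in> S \<and> atleast (card (S \<inter> {..<u})) (S \<inter> {..<a}) \<and>
    \<not> atleast (Suc (card (S \<inter> {..<u}))) (S \<inter> {..<a})) = u"
proof (rule the1_equality)
  have iff: "atleast k (S \<inter> {..<a}) \<longleftrightarrow> k \<le> card (S \<inter> {..<a})" for k a
    using S by (simp add: atleast_iff_card)
  show "u \<in> S \<and> atleast (card (S \<inter> {..<u})) (S \<inter> {..<u}) \<and> \<not> atleast (Suc (card (S \<inter> {..<u}))) (S \<inter> {..<u})"
    using u by (simp add: iff)
  fix a assume "a \<in> S \<and> atleast (card (S \<inter> {..<u})) (S \<inter> {..<a}) \<and> \<not> atleast (Suc (card (S \<inter> {..<u}))) (S \<inter> {..<a})"
  then have a: "a \<in> S" "card (S \<inter> {..<a}) = card (S \<inter> {..<u})" by (auto simp: iff)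
  have "card (S \<inter> {..<a}) < card (S \<inter> {..<b})" if "a < b" "a \<in> S" for a b
    using that S by (intro psubset_card_mono) auto
  with a u show "a = u" by (metis less_irrefl linorder_less_linear)
qed

lemma ranked_functions:
  assumes A: "dfam A"
  obtains G where "finite G" "\<And>g. g \<in> G \<Longrightarrow> dfun g"
    "\<And>x u. finite (A x) \<Longrightarrow> card (A x) \<le> K \<Longrightarrow> u \<in> A x \<Longrightarrow> \<exists>g\<in>G. u = g x"
proof -
  let ?g = "\<lambda>i x. the1 (\<lambda>a. a \<in> A x \<and> atleast i (A x \<inter> {..<a}) \<and> \<not> atleast (Suc i) (A x \<inter> {..<a}))"
  show ?thesis
  proof (rule that[of "?g ` {..K}"])
    show "dfun g" if "g \<in> ?g ` {..K}" for g using that dfun_ranked[OF A] by blast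
    fix x u assume *: "finite (A x)" "card (A x) \<le> K" "u \<in> A x"
    have "card (A x \<inter> {..<u}) \<le> K" using *(1,2) card_mono[of "A x" "A x \<inter> {..<u}"] by auto
    then show "\<exists>g\<in>?g ` {..K}. u = g x"
      using ranked_eq[OF *(1,3)] by (intro bexI[of _ "?g (card (A x \<inter> {..<u}))"]) auto
  qed simp
qed

lemma dfam_bd: "dfam A \<Longrightarrow> dfam (\<lambda>x. bd (A x))"
proof -
  assume A: "dfam A"
  show ?thesis unfolding bd_def Bex_def by (intro dfam_Collect d_intros dfam_mem[OF A])
qed

section \<open>Finitely many values of locally constant functions\<close>

lemma loc_const_finite_empty: "loc_const_finite {}"
  unfolding loc_const_finite_def
proof (intro allI impI)
  fix G :: "(nat \<Rightarrow> 'a) \<Rightarrow> bool" and N :: "(nat \<Rightarrow> 'a) \<Rightarrow> nat"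
  have "{x \<in> E {}. G x} \<subseteq> {\<lambda>_. undefined}" by auto
  then show "finite (N ` {x \<in> E {}. G x})" by (meson finite.emptyI finite.insertI finite_imageI finite_subset)
qed

text \<open>No boundary point of the fibre of \<open>G\<close> lies between \<open>u\<close> and
  \<open>w\<close>, so the segment stays in \<open>G\<close>. By local constancy the level set of
  \<open>N\<close> has no boundary point there either, and definable connectedness carries the value
  from \<open>u\<close> to \<open>w\<close>.\<close>

lemma loc_const_sample:
  assumes J: "m \<notin> J" and G: "dpred G"
    and Q: "\<And>k. dpred (Q k)" "\<And>k x. x \<in> E (insert m J) \<Longrightarrow> Q k x \<longleftrightarrow> N x = (k::nat)"
    and loc: "\<And>x. x \<in> E (insert m J) \<Longrightarrow> G x \<Longrightarrow> nbhd (insert m J) (\<lambda>y. G y \<longrightarrow> N y = N x) x"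
    and y: "y \<in> E J" and u: "G (y(m := u))"
    and W: "\<And>z. min u w \<le> z \<Longrightarrow> z \<le> max u w \<Longrightarrow> z \<notin> bd {u. G (y(m := u))}"
  shows "G (y(m := w)) \<and> N (y(m := w)) = N (y(m := u))"
proof -
  have yE: "y(m := v) \<in> E (insert m J)" for v using y by (auto simp: extensional_def)
  have G1: "def1 {u. G (y(m := u))}"
    by (rule def1_Collect) (intro d_intros dpred_comp[OF G])
  define k where "k = N (y(m := u))"
  define S where "S = {u. G (y(m := u)) \<and> Q k (y(m := u))}"
  have S1: "def1 S" unfolding S_def
    by (rule def1_Collect) (intro d_intros dpred_comp[OF G] dpred_comp[OF Q(1)])
  have Gz: "G (y(m := z))" if z: "min u w \<le> z" "z \<le> max u w" for z
  proof (cases "u \<le> z")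
    case True
    then show ?thesis using no_bd_iff[OF G1 True] W z u by (auto simp: min_def max_def split: if_splits)
  next
    case False
    then have zu: "z \<le> u" by simp
    then show ?thesis using no_bd_iff[OF G1 zu] W z u by (auto simp: min_def max_def split: if_splits)
  qed
  have nb: "z \<notin> bd S" if z: "min u w \<le> z" "z \<le> max u w" for z
  proof -
    obtain \<epsilon> where \<epsilon>: "\<epsilon> > 0" "\<And>v. \<bar>v - z\<bar> < \<epsilon> \<Longrightarrow> G (y(m := v))"
    proof -
      obtain \<epsilon> where "\<epsilon> > 0" "(\<forall>v. \<bar>v - z\<bar> < \<epsilon> \<longrightarrow> \<not> G (y(m := v))) \<or> (\<forall>v. \<bar>v - z\<bar> < \<epsilon> \<longrightarrow> G (y(m := v)))"
        using W[OF z] unfolding bd_def by auto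
      moreover have "\<bar>z - z\<bar> < \<epsilon>" using \<open>\<epsilon> > 0\<close> by simp
      ultimately show ?thesis using Gz[OF z] that by blast
    qed
    obtain r where r: "r > 0" "\<And>x. x \<in> bx (insert m J) (y(m := z)) r \<Longrightarrow> G x \<Longrightarrow> N x = N (y(m := z))"
      using loc[OF yE Gz[OF z]] unfolding nbhd_def by blast
    have *: "N (y(m := v)) = N (y(m := z))" if "\<bar>v - z\<bar> < min \<epsilon> r" for v
    proof -
      have "y(m := v) \<in> bx (insert m J) (y(m := z)) r"
        using that r(1) yE[of v] by (auto simp: bx_def)
      then show ?thesis using r(2) \<epsilon>(2)[of v] that by simp
    qed
    show ?thesis
    proof (rule not_bdI[of "min \<epsilon> r"])
      show "min \<epsilon> r > 0" using \<epsilon>(1) r(1) by simp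
      have "v \<in> S \<longleftrightarrow> N (y(m := z)) = k" if "\<bar>v - z\<bar> < min \<epsilon> r" for v
        using *[OF that] \<epsilon>(2)[of v] that yE Q(2) by (simp add: S_def)
      then show "(\<forall>v. \<bar>v - z\<bar> < min \<epsilon> r \<longrightarrow> v \<notin> S) \<or> (\<forall>v. \<bar>v - z\<bar> < min \<epsilon> r \<longrightarrow> v \<in> S)" by blast
    qed
  qed
  have "u \<in> S" using u yE Q(2) by (simp add: S_def k_def)
  then have "w \<in> S"
    using no_bd_iff[OF S1, of u w] no_bd_iff[OF S1, of w u] nb by (cases "u \<le> w") (auto simp: min_def max_def)
  then show ?thesis using yE Q(2) by (simp add: S_def k_def)
qed

text \<open>The section \<open>s\<close> may be discontinuous, so it is replaced by the functions
  \<open>g\<close>, continuous on open sets \<open>U\<close>. Along each of them \<open>N\<close>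
  remains locally constant, and the case \<open>J\<close> bounds its values.\<close>

lemma loc_const_along_section:
  assumes J: "finite J" "m \<notin> J" and PC: "piecewise_cont J" and LC: "loc_const_finite J" and G: "dpred G"
    and Q: "\<And>k. dpred (Q k)" "\<And>k x. x \<in> E (insert m J) \<Longrightarrow> Q k x \<longleftrightarrow> N x = (k::nat)"
    and loc: "\<And>x. x \<in> E (insert m J) \<Longrightarrow> G x \<Longrightarrow> nbhd (insert m J) (\<lambda>y. G y \<longrightarrow> N y = N x) x"
    and s: "dfun s"
  shows "finite ((\<lambda>y. N (y(m := s y))) ` {y \<in> E J. G (y(m := s y))})"
proof -
  obtain H where H: "finite H" "\<And>g U. (g, U) \<in> H \<Longrightarrow> dfun g" "\<And>g U. (g, U) \<in> H \<Longrightarrow> dpred U"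
    "\<And>g U x. (g, U) \<in> H \<Longrightarrow> x \<in> E J \<Longrightarrow> U x \<Longrightarrow> cont_at J g x \<and> nbhd J U x"
    "\<And>x. x \<in> E J \<Longrightarrow> \<exists>g U. (g, U) \<in> H \<and> U x \<and> s x = g x"
    by (rule piecewise_contE[OF PC s]) (rule that)
  have yE: "y(m := v) \<in> E (insert m J)" if "y \<in> E J" for y v using that by (auto simp: extensional_def)
  have fin: "finite ((\<lambda>y. N (y(m := g y))) ` {y \<in> E J. U y \<and> G (y(m := g y))})" if gU: "(g, U) \<in> H" for g U
  proof -
    note g = H(2)[OF gU] and U = H(3)[OF gU]
    have "dpred (\<lambda>y. U y \<and> G (y(m := g y)))"
      by (intro d_intros U dpred_comp[OF G] g)
    moreover have "\<exists>Q. dpred Q \<and> (\<forall>x\<in>E J. Q x \<longleftrightarrow> N (x(m := g x)) = k)" for k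
      using yE Q(2) by (intro exI[of _ "\<lambda>y. Q k (y(m := g y))"] conjI dpred_comp[OF Q(1)] d_intros g) simp
    moreover have "nbhd J (\<lambda>x. U x \<and> G (x(m := g x)) \<longrightarrow> N (x(m := g x)) = N (y(m := g y))) y"
      if y: "y \<in> E J" and Uy: "U y" and Gy: "G (y(m := g y))" for y
    proof -
      obtain r where r: "r > 0" "\<And>x. x \<in> bx (insert m J) (y(m := g y)) r \<Longrightarrow> G x \<Longrightarrow> N x = N (y(m := g y))"
        using loc[OF yE[OF y] Gy] unfolding nbhd_def by blast
      obtain q where q: "q > 0" "\<And>x. x \<in> bx J y q \<Longrightarrow> \<bar>g x - g y\<bar> < r"
        using H(4)[OF gU y Uy] r(1) unfolding cont_at_def by blast
      have "x(m := g x) \<in> bx (insert m J) (y(m := g y)) r" if x: "x \<in> bx J y (min q r)" for x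
      proof -
        have "x \<in> bx J y q" using x by (auto simp: bx_def)
        then show ?thesis using x q(2)[of x] J(2) by (auto simp: bx_def extensional_def)
      qed
      then show ?thesis unfolding nbhd_def using r q(1) by (intro exI[of _ "min q r"]) auto
    qed
    ultimately show ?thesis
      using LC[unfolded loc_const_finite_def, rule_format, of "\<lambda>y. U y \<and> G (y(m := g y))" "\<lambda>y. N (y(m := g y))"] by blast
  qed
  have "(\<lambda>y. N (y(m := s y))) ` {y \<in> E J. G (y(m := s y))} \<subseteq>
    (\<Union>(g, U)\<in>H. (\<lambda>y. N (y(m := g y))) ` {y \<in> E J. U y \<and> G (y(m := g y))})"
  proof
    fix k assume "k \<in> (\<lambda>y. N (y(m := s y))) ` {y \<in> E J. G (y(m := s y))}"
    then obtain y where y: "y \<in> E J" "G (y(m := s y))" "k = N (y(m := s y))" by blast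
    obtain g U where gU: "(g, U) \<in> H" "U y" "s y = g y" using H(5)[OF y(1)] by blast
    have "k \<in> (\<lambda>y. N (y(m := g y))) ` {y \<in> E J. U y \<and> G (y(m := g y))}"
      using y gU(2,3) by (intro image_eqI[of _ _ y]) auto
    then show "k \<in> (\<Union>(g, U)\<in>H. (\<lambda>y. N (y(m := g y))) ` {y \<in> E J. U y \<and> G (y(m := g y))})"
      by (intro UN_I[OF gU(1)]) (simp only: prod.case)
  qed
  then show ?thesis by (rule finite_subset) (use H(1) fin in auto)
qed

text \<open>Every value of \<open>N\<close> on a vertical line inside \<open>G\<close> is taken at a
  boundary point of the fibre of \<open>G\<close> or at a sample point off the boundary. Uniform
  finiteness turns these points into finitely many sections that serve all lines.\<close>

lemma loc_const_finite_insert: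
  assumes J: "finite J" "m \<notin> J" and UF: "uniformly_finite J" and PC: "piecewise_cont J" and LC: "loc_const_finite J"
  shows "loc_const_finite (insert m J)"
  unfolding loc_const_finite_def
proof (intro allI impI)
  fix G :: "(nat \<Rightarrow> 'a) \<Rightarrow> bool" and N :: "(nat \<Rightarrow> 'a) \<Rightarrow> nat"
  assume G: "dpred G" and Q0: "\<forall>k. \<exists>Q. dpred Q \<and> (\<forall>x\<in>E (insert m J). Q x \<longleftrightarrow> N x = k)"
    and loc0: "\<forall>x\<in>E (insert m J). G x \<longrightarrow> nbhd (insert m J) (\<lambda>y. G y \<longrightarrow> N y = N x) x"
  obtain Q where Q: "\<And>k. dpred (Q k)" "\<And>k x. x \<in> E (insert m J) \<Longrightarrow> Q k x \<longleftrightarrow> N x = k"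
    using Q0 by metis
  have loc: "nbhd (insert m J) (\<lambda>y. G y \<longrightarrow> N y = N x) x" if "x \<in> E (insert m J)" "G x" for x
    using loc0 that by blast
  define A where "A y = bd {u. G (y(m := u))}" for y
  have A0: "dfam (\<lambda>y. {u. G (y(m := u))})" by (intro dfam_Collect d_intros dpred_comp[OF G])
  have A: "dfam A" unfolding A_def by (rule dfam_bd[OF A0])
  have Af: "finite (A y)" for y unfolding A_def by (rule finite_bd[OF def1_fam[OF A0]])
  obtain H where H: "finite H" "\<And>g. g \<in> H \<Longrightarrow> dfun g" "\<And>x u. x \<in> E J \<Longrightarrow> u \<in> A x \<Longrightarrow> \<exists>g\<in>H. u = g x"
    by (rule uniformly_finiteE[OF UF A Af]) (rule that)
  \<comment> \<open>The sections mirror \<open>sample_between\<close>: boundary points, 0 for an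
    empty boundary, points one unit beyond an extreme boundary point, and midpoints.\<close>
  define S where "S = H \<union> insert (\<lambda>_. 0) ((\<lambda>g y. g y - 1) ` H \<union> (\<lambda>g y. g y + 1) ` H \<union>
    (\<lambda>(g, h) y. (g y + h y) / 2) ` (H \<times> H))"
  have S: "finite S" "\<And>s. s \<in> S \<Longrightarrow> dfun s"
    unfolding S_def using H(1,2) by (auto intro!: d_intros)
  have *: "\<exists>s\<in>S. G (y(m := s y)) \<and> N (y(m := s y)) = N (y(m := u))"
    if y: "y \<in> E J" and u: "G (y(m := u))" for y u
  proof (cases "u \<in> A y")
    case True
    then obtain g where "g \<in> H" "u = g y" using H(3)[OF y] by blast
    then show ?thesis using u by (intro bexI[of _ g]) (auto simp: S_def)
  next
    case False
    obtain w where w: "w = 0 \<or> (\<exists>a\<in>A y. w = a - 1 \<or> w = a + 1) \<or> (\<exists>a\<in>A y. \<exists>b\<in>A y. w = (a + b) / 2)"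
      "\<And>z. min u w \<le> z \<Longrightarrow> z \<le> max u w \<Longrightarrow> z \<notin> A y"
      by (rule sample_between[OF Af False]) (rule that)
    have Hy: "\<exists>g\<in>H. a = g y" if "a \<in> A y" for a using H(3)[OF y that] .
    have "\<exists>s\<in>S. w = s y"
    proof -
      consider "w = 0" | a where "a \<in> A y" "w = a - 1" | a where "a \<in> A y" "w = a + 1"
        | a b where "a \<in> A y" "b \<in> A y" "w = (a + b) / 2" using w(1) by blast
      then show ?thesis
      proof cases
        case 1
        then show ?thesis by (intro bexI[of _ "\<lambda>_. 0"]) (simp_all add: S_def)
      next
        case (2 a)
        then obtain g where "g \<in> H" "a = g y" using Hy by blast
        then show ?thesis using 2 by (intro bexI[of _ "\<lambda>y. g y - 1"]) (auto simp: S_def)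
      next
        case (3 a)
        then obtain g where "g \<in> H" "a = g y" using Hy by blast
        then show ?thesis using 3 by (intro bexI[of _ "\<lambda>y. g y + 1"]) (auto simp: S_def)
      next
        case (4 a b)
        then obtain g h where "g \<in> H" "a = g y" "h \<in> H" "b = h y" using Hy by blast
        then show ?thesis using 4 by (intro bexI[of _ "\<lambda>y. (g y + h y) / 2"]) (force simp: S_def)+
      qed
    qed
    moreover have "G (y(m := w)) \<and> N (y(m := w)) = N (y(m := u))"
      using loc_const_sample[OF J(2) G Q loc y u] w(2) unfolding A_def by blast
    ultimately show ?thesis by blast
  qed
  have "N ` {x \<in> E (insert m J). G x} \<subseteq> (\<Union>s\<in>S. (\<lambda>y. N (y(m := s y))) ` {y \<in> E J. G (y(m := s y))})"
  proof
    fix k assume "k \<in> N ` {x \<in> E (insert m J). G x}"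
    then obtain x where x: "x \<in> E (insert m J)" "G x" "k = N x" by blast
    define y where "y = x(m := undefined)"
    have y: "y \<in> E J" using x(1) J(2) by (simp add: y_def E_insert_iff)
    have "x = y(m := x m)" by (simp add: y_def)
    with *[OF y, of "x m"] x(2,3) obtain s where s: "s \<in> S" "G (y(m := s y))" "N (y(m := s y)) = k" by auto
    show "k \<in> (\<Union>s\<in>S. (\<lambda>y. N (y(m := s y))) ` {y \<in> E J. G (y(m := s y))})"
      by (rule UN_I[OF s(1)], rule image_eqI[of _ _ y]) (use s y in auto)
  qed
  then show "finite (N ` {x \<in> E (insert m J). G x})"
    by (rule finite_subset) (use S loc_const_along_section[OF J PC LC G Q loc] in auto)
qed

text \<open>Let \<open>T\<close> consist of the \<open>y\<close> whose line meets \<open>P\<close>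
  in an interval. A cube in \<open>T\<close> would produce a cube in \<open>P\<close>, so
  \<open>T\<close> is thin and the case \<open>J\<close> applies. Over other \<open>y\<close> the
  fibre is finite, and its points are values of finitely many functions: graphs in direction
  \<open>m\<close>.\<close>

lemma thin_in_graphs_insert:
  assumes J: "finite J" "m \<notin> J" and UF: "uniformly_finite J" and TG: "thin_in_graphs J"
  shows "thin_in_graphs (insert m J)"
  unfolding thin_in_graphs_def
proof (intro allI impI)
  fix P :: "(nat \<Rightarrow> 'a) \<Rightarrow> bool"
  assume P: "dpred P" and thin: "thin (insert m J) P"
  note P' = dpred_comp[OF P]
  define T where "T y \<longleftrightarrow> (\<exists>s t. s < t \<and> (\<forall>u. s < u \<and> u < t \<longrightarrow> P (y(m := u))))" for y
  have T: "dpred T" unfolding T_def by (intro d_intros P')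
  have "thin J T" unfolding thin_def
  proof (intro allI impI, rule ccontr)
    fix x and r :: 'a assume r: "r > 0" and "\<not> (\<exists>y\<in>bx J x r. \<not> T y)"
    then have Ty: "\<And>y. y \<in> bx J x r \<Longrightarrow> T y" by blast
    \<comment> \<open>\<open>common_interval\<close> needs one bounded range for all fibres.
      Bounding it by \<open>1 / l\<close> makes the condition monotone in \<open>l\<close>, as
      \<open>uniform_choice\<close> requires.\<close>
    define R where "R l y \<longleftrightarrow> (\<exists>s t. - (1 / l) \<le> s \<and> s < t \<and> t \<le> 1 / l \<and> (\<forall>u. s < u \<and> u < t \<longrightarrow> P (y(m := u))))" for l y
    have R: "dpred (\<lambda>e. R (e 0) (etl e))" unfolding R_def by (intro d_intros P')
    have R1: "\<exists>l>0. R l y" if y: "y \<in> bx J x r" for y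
    proof -
      obtain s t where st: "s < t" "\<forall>u. s < u \<and> u < t \<longrightarrow> P (y(m := u))" using Ty[OF y] unfolding T_def by blast
      define l where "l = 1 / (1 + \<bar>s\<bar> + \<bar>t\<bar>)"
      have "l > 0" "1 / l = 1 + \<bar>s\<bar> + \<bar>t\<bar>" unfolding l_def by (simp_all add: add_pos_nonneg)
      moreover have "- (1 + \<bar>s\<bar> + \<bar>t\<bar>) \<le> s" "t \<le> 1 + \<bar>s\<bar> + \<bar>t\<bar>" by linarith+
      ultimately have "R l y" unfolding R_def using st by (intro exI[of _ s] exI[of _ t]) simp
      then show ?thesis using \<open>l > 0\<close> by blast
    qed
    have R2: "R l' y" if l: "R l y" "0 < l'" "l' \<le> l" for y l l'
    proof -
      have "1 / l \<le> 1 / l'" using l(2,3) by (simp add: frac_le)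
      moreover obtain s t where "- (1 / l) \<le> s" "s < t" "t \<le> 1 / l" "\<forall>u. s < u \<and> u < t \<longrightarrow> P (y(m := u))"
        using l(1) unfolding R_def by blast
      ultimately show ?thesis unfolding R_def by (intro exI[of _ s] exI[of _ t]) auto
    qed
    obtain x0 r0 \<epsilon> where 0: "r0 > 0" "\<epsilon> > 0" "bx J x0 r0 \<subseteq> bx J x r"
      "\<And>y. y \<in> bx J x0 r0 \<Longrightarrow> R \<epsilon> y"
      by (rule uniform_choice[OF Baire[OF J(1)] R r R1 R2], assumption, assumption, assumption, assumption, rule that)
    have A: "dfam (\<lambda>y. {u. P (y(m := u))})" by (intro dfam_Collect d_intros P')
    have ex: "\<exists>s t. - (1 / \<epsilon>) \<le> s \<and> s < t \<and> t \<le> 1 / \<epsilon> \<and> (\<forall>u. s < u \<and> u < t \<longrightarrow> u \<in> {u. P (y(m := u))})"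
      if "y \<in> bx J x0 r0" for y
      using 0(4)[OF that] unfolding R_def by simp
    obtain x1 r1 s t where 1: "r1 > 0" "bx J x1 r1 \<subseteq> bx J x0 r0" "- (1 / \<epsilon>) \<le> s" "s < t" "t \<le> 1 / \<epsilon>"
      "\<And>y u. y \<in> bx J x1 r1 \<Longrightarrow> s < u \<Longrightarrow> u < t \<Longrightarrow> u \<in> {u. P (y(m := u))}"
      by (rule common_interval[OF J(1) Baire[OF J(1)] dichotomy[OF J(1)] A 0(1) ex], assumption, rule that)
    obtain z q where zq: "q > 0"
      "\<And>w. w \<in> bx (insert m J) z q \<Longrightarrow> w(m := undefined) \<in> bx J x1 r1 \<and> s < w m \<and> w m < t"
      by (rule cube_over_interval[OF J(2) 1(1,4)]) (rule that)
    have "P w" if "w \<in> bx (insert m J) z q" for w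
      using zq(2)[OF that] 1(6)[of "w(m := undefined)" "w m"] by simp
    then show False using thin zq(1) unfolding thin_def by blast
  qed
  then obtain H where H: "finite H" "\<And>k h. (k, h) \<in> H \<Longrightarrow> k \<in> J \<and> dfun h"
    "\<And>x. x \<in> E J \<Longrightarrow> T x \<Longrightarrow> \<exists>k h. (k, h) \<in> H \<and> x k = h (x(k := undefined))"
    by (rule thin_in_graphsE[OF TG T]) (rule that)
  define A where "A y = {u. P (y(m := u)) \<and> \<not> T y}" for y
  have A: "dfam A" unfolding A_def by (intro dfam_Collect d_intros P' T dpred_comp[OF T])
  have Af: "finite (A y)" for y
  proof (rule ccontr)
    assume "infinite (A y)"
    then obtain c d where cd: "c < d" "{c<..<d} \<subseteq> A y" using infinite_def1_interval[OF def1_fam[OF A]] by blast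
    then obtain w where "w \<in> A y" using dense[OF cd(1)] by auto
    then have "\<not> T y" by (simp add: A_def)
    moreover have "T y" unfolding T_def using cd by (intro exI[of _ c] exI[of _ d]) (auto simp: A_def subset_iff)
    ultimately show False by blast
  qed
  obtain G where G: "finite G" "\<And>g. g \<in> G \<Longrightarrow> dfun g" "\<And>x u. x \<in> E J \<Longrightarrow> u \<in> A x \<Longrightarrow> \<exists>g\<in>G. u = g x"
    by (rule uniformly_finiteE[OF UF A Af]) (rule that)
  define K where "K = Pair m ` G \<union> (\<lambda>(k, h). (k, \<lambda>z. h (z(m := undefined)))) ` H"
  have finK: "finite K" using G(1) H(1) by (simp add: K_def)
  have Kd: "k \<in> insert m J \<and> dfun g" if kg: "(k, g) \<in> K" for k g
  proof -
    consider "k = m" "g \<in> G" | h where "(k, h) \<in> H" "g = (\<lambda>z. h (z(m := undefined)))"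
      using kg unfolding K_def by auto
    then show ?thesis
    proof cases
      case (2 h)
      then have kh: "k \<in> J" "dfun h" using H(2) by blast+
      then have "dfun g" unfolding 2(2) by (intro dfun_comp[OF kh(2)] d_intros)
      then show ?thesis using kh(1) by blast
    qed (use G(2) in blast)
  qed
  have Kc: "\<exists>(k, g)\<in>K. x k = g (x(k := undefined))" if x: "x \<in> E (insert m J)" "P x" for x
  proof -
    define y where "y = x(m := undefined)"
    have y: "y \<in> E J" using x(1) J(2) by (simp add: y_def E_insert_iff)
    show ?thesis
    proof (cases "T y")
      case True
      then obtain k h where kh: "(k, h) \<in> H" "y k = h (y(k := undefined))" using H(3)[OF y] by blast
      then have "k \<noteq> m" using H(2) J(2) by blast
      then have "x k = h ((x(k := undefined))(m := undefined))"
        using kh(2) by (simp add: y_def fun_upd_twist)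
      moreover have "(k, \<lambda>z. h (z(m := undefined))) \<in> K" unfolding K_def using kh(1) by force
      ultimately show ?thesis by (intro bexI[of _ "(k, \<lambda>z. h (z(m := undefined)))"]) simp_all
    next
      case False
      then have "x m \<in> A y" using x(2) by (simp add: A_def y_def)
      then obtain g where "g \<in> G" "x m = g y" using G(3)[OF y] by blast
      then show ?thesis unfolding y_def by (intro bexI[of _ "(m, g)"]) (auto simp: K_def)
    qed
  qed
  have "\<forall>(k, g)\<in>K. k \<in> insert m J \<and> dfun g" using Kd by blast
  moreover have "\<forall>x\<in>E (insert m J). P x \<longrightarrow> (\<exists>(k, g)\<in>K. x k = g (x(k := undefined)))" using Kc by (intro ballI impI)
  ultimately show "\<exists>G. finite G \<and> (\<forall>(k, g)\<in>G. k \<in> insert m J \<and> dfun g) \<and>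
      (\<forall>x\<in>E (insert m J). P x \<longrightarrow> (\<exists>(k, g)\<in>G. x k = g (x(k := undefined))))"
    using finK by (intro exI[of _ K] conjI)
qed

lemma thin_in_graphs_empty: "thin_in_graphs {}"
  unfolding thin_in_graphs_def
proof (intro allI impI exI[of _ "{}"] conjI)
  fix P :: "(nat \<Rightarrow> 'a) \<Rightarrow> bool" assume "thin {} P"
  from this[unfolded thin_def, rule_format, OF zero_less_one] have "\<not> P (\<lambda>_. undefined)" by simp
  then show "\<forall>x\<in>E {}. P x \<longrightarrow> (\<exists>(m, g)\<in>{}. x m = g (x(m := undefined)))" by simp
qed simp_all

text \<open>Off a thin set \<open>f\<close> is continuous near each point. On a graph, coordinate
  \<open>m\<close> is a function of the others and \<open>f\<close> becomes a function on
  \<open>J - {m}\<close>. Its pieces, read as functions of \<open>x\<close> that ignore coordinate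
  \<open>m\<close>, are continuous on open subsets of R^J.\<close>

lemma piecewise_cont_step:
  assumes J: "finite J" and TG: "thin_in_graphs J" and PC: "\<And>m. m \<in> J \<Longrightarrow> piecewise_cont (J - {m})"
  shows "piecewise_cont J"
  unfolding piecewise_cont_def
proof (intro allI impI)
  fix f :: "(nat \<Rightarrow> 'a) \<Rightarrow> 'a" assume f: "dfun f"
  define C where "C = nbhd J (cont_at J f)"
  have C: "dpred C" unfolding C_def by (intro dpred_nbhd dpred_cont_at J f)
  have thin: "thin J (\<lambda>x. \<not> C x)" unfolding thin_def
  proof (intro allI impI)
    fix x and r :: 'a assume r: "r > 0"
    obtain x' r' where *: "r' > 0" "bx J x' r' \<subseteq> bx J x r" "\<And>y. y \<in> bx J x' r' \<Longrightarrow> cont_at J f y"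
      by (rule generic_continuity[OF J f r]) (rule that)
    have y: "restrict x' J \<in> bx J x' r'" by (rule center_in_bx[OF *(1)])
    have "C (restrict x' J)" unfolding C_def nbhd_def using *(1,3) by (intro exI[of _ r']) simp
    then show "\<exists>y\<in>bx J x r. \<not> \<not> C y" using y *(2) by blast
  qed
  obtain H where H: "finite H" "\<And>m h. (m, h) \<in> H \<Longrightarrow> m \<in> J \<and> dfun h"
    "\<And>x. x \<in> E J \<Longrightarrow> \<not> C x \<Longrightarrow> \<exists>m h. (m, h) \<in> H \<and> x m = h (x(m := undefined))"
    by (rule thin_in_graphsE[OF TG dpred_not[OF C] thin]) (rule that)
  have "\<exists>G. finite G \<and> (\<forall>(g, U)\<in>G. dfun g \<and> dpred U \<and> (\<forall>x\<in>E (J - {m}). U x \<longrightarrow> cont_at (J - {m}) g x \<and> nbhd (J - {m}) U x)) \<and>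
      (\<forall>y\<in>E (J - {m}). \<exists>(g, U)\<in>G. U y \<and> f (y(m := h y)) = g y)" if "(m, h) \<in> H" for m h
  proof -
    have "dfun (\<lambda>y. f (y(m := h y)))" using H(2)[OF that] by (intro dfun_comp[OF f] d_intros) simp
    then show ?thesis using PC[of m] H(2)[OF that] unfolding piecewise_cont_def by blast
  qed
  then have "\<forall>p\<in>H. \<exists>G. finite G \<and> (\<forall>(g, U)\<in>G. dfun g \<and> dpred U \<and>
      (\<forall>x\<in>E (J - {fst p}). U x \<longrightarrow> cont_at (J - {fst p}) g x \<and> nbhd (J - {fst p}) U x)) \<and>
      (\<forall>y\<in>E (J - {fst p}). \<exists>(g, U)\<in>G. U y \<and> f (y(fst p := snd p y)) = g y)"
    by auto
  from bchoice[OF this] obtain F where F0: "\<forall>p\<in>H. finite (F p) \<and> (\<forall>(g, U)\<in>F p. dfun g \<and> dpred U \<and>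
      (\<forall>x\<in>E (J - {fst p}). U x \<longrightarrow> cont_at (J - {fst p}) g x \<and> nbhd (J - {fst p}) U x)) \<and>
      (\<forall>y\<in>E (J - {fst p}). \<exists>(g, U)\<in>F p. U y \<and> f (y(fst p := snd p y)) = g y)" ..
  have F: "\<And>p. p \<in> H \<Longrightarrow> finite (F p)"
    "\<And>p g U. p \<in> H \<Longrightarrow> (g, U) \<in> F p \<Longrightarrow> dfun g \<and> dpred U \<and>
      (\<forall>x\<in>E (J - {fst p}). U x \<longrightarrow> cont_at (J - {fst p}) g x \<and> nbhd (J - {fst p}) U x)"
    "\<And>p y. p \<in> H \<Longrightarrow> y \<in> E (J - {fst p}) \<Longrightarrow> \<exists>(g, U)\<in>F p. U y \<and> f (y(fst p := snd p y)) = g y"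
    using F0 by blast+
  define L where "L p = (\<lambda>(g, U). (\<lambda>x. g (x(fst p := undefined)), \<lambda>x. U (x(fst p := undefined)))) ` F p"
    for p :: "nat \<times> ((nat \<Rightarrow> 'a) \<Rightarrow> 'a)"
  define G where "G = insert (f, C) (\<Union>p\<in>H. L p)"
  have dropE: "x(m := undefined) \<in> E (J - {m})" if "x \<in> E J" for x :: "nat \<Rightarrow> 'a" and m
    using that by (auto simp: extensional_def)
  have dropbx: "y(m := undefined) \<in> bx (J - {m}) (x(m := undefined)) r" if "y \<in> bx J x r" for x y :: "nat \<Rightarrow> 'a" and m r
    using that by (auto simp: bx_def extensional_def)
  have finG: "finite G" unfolding G_def L_def using H(1) F(1) by auto
  have Gcont: "\<forall>(g, U)\<in>G. dfun g \<and> dpred U \<and> (\<forall>x\<in>E J. U x \<longrightarrow> cont_at J g x \<and> nbhd J U x)"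
  proof (clarify)
    fix g' U' assume "(g', U') \<in> G"
    then consider "g' = f" "U' = C" | p g U where "p \<in> H" "(g, U) \<in> F p"
      "g' = (\<lambda>x. g (x(fst p := undefined)))" "U' = (\<lambda>x. U (x(fst p := undefined)))"
      unfolding G_def L_def by auto
    then show "dfun g' \<and> dpred U' \<and> (\<forall>x\<in>E J. U' x \<longrightarrow> cont_at J g' x \<and> nbhd J U' x)"
    proof cases
      case 1
      have "cont_at J f x" if "C x" "x \<in> E J" for x
        using that unfolding C_def nbhd_def by (meson self_in_bx)
      then show ?thesis using f C nbhd_nbhd[OF J] unfolding 1 C_def by blast
    next
      case (2 p g U)
      note * = F(2)[OF 2(1,2)]
      have "dfun g'" "dpred U'" unfolding 2 using * by (intro dfun_comp[OF *[THEN conjunct1]] dpred_comp[OF *[THEN conjunct2, THEN conjunct1]] d_intros)+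
      moreover have "cont_at J g' x" if x: "x \<in> E J" "U' x" for x
        unfolding cont_at_def
      proof (intro allI impI)
        fix \<epsilon> :: 'a assume "\<epsilon> > 0"
        then obtain r where "r > 0" "\<forall>y\<in>bx (J - {fst p}) (x(fst p := undefined)) r. \<bar>g y - g (x(fst p := undefined))\<bar> < \<epsilon>"
          using * dropE[OF x(1)] x(2) unfolding cont_at_def 2 by blast
        then show "\<exists>r>0. \<forall>y\<in>bx J x r. \<bar>g' y - g' x\<bar> < \<epsilon>" unfolding 2 using dropbx by blast
      qed
      moreover have "nbhd J U' x" if x: "x \<in> E J" "U' x" for x
      proof -
        obtain r where "r > 0" "\<forall>y\<in>bx (J - {fst p}) (x(fst p := undefined)) r. U y"
          using * dropE[OF x(1)] x(2) unfolding nbhd_def 2 by blast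
        then show ?thesis unfolding nbhd_def 2 using dropbx by blast
      qed
      ultimately show ?thesis by blast
    qed
  qed
  have Gcov: "\<exists>(g, U)\<in>G. U x \<and> f x = g x" if x: "x \<in> E J" for x
  proof (cases "C x")
    case True
    then show ?thesis unfolding G_def by blast
  next
    case False
    then obtain m h where mh: "(m, h) \<in> H" "x m = h (x(m := undefined))" using H(3)[OF x] by blast
    have fx: "x(m := h (x(m := undefined))) = x" by (subst mh(2)[symmetric]) simp
    have "\<exists>(g, U)\<in>F (m, h). U (x(m := undefined)) \<and> f x = g (x(m := undefined))"
      using F(3)[OF mh(1), of "x(m := undefined)"] dropE[OF x, of m]
      unfolding fst_conv snd_conv fun_upd_upd fx by blast
    then obtain g U where gU: "(g, U) \<in> F (m, h)" "U (x(m := undefined))" "f x = g (x(m := undefined))"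
      by blast
    then have "((\<lambda>x. g (x(m := undefined))), (\<lambda>x. U (x(m := undefined)))) \<in> G"
      unfolding G_def L_def by (intro insertI2 UN_I[OF mh(1)] image_eqI[OF _ gU(1)]) simp
    then show ?thesis using gU(2,3) by (intro bexI[of _ "(\<lambda>x. g (x(m := undefined)), \<lambda>x. U (x(m := undefined)))"]) simp_all
  qed
  show "\<exists>G. finite G \<and> (\<forall>(g, U)\<in>G. dfun g \<and> dpred U \<and> (\<forall>x\<in>E J. U x \<longrightarrow> cont_at J g x \<and> nbhd J U x)) \<and>
      (\<forall>x\<in>E J. \<exists>(g, U)\<in>G. U x \<and> f x = g x)"
    by (rule exI[of _ G], intro conjI, rule finG, rule Gcont, rule ballI, rule Gcov)
qed

end

section \<open>Uniform finiteness\<close>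

lemma bx_min [simp]: "z \<in> bx J y (min s t) \<longleftrightarrow> z \<in> bx J y s \<and> z \<in> bx J y t"
  by (auto simp: bx_def)

lemma card_eq_if_close:
  fixes S T :: "'a::linordered_field set"
  assumes gap: "\<And>a b. a \<in> S \<Longrightarrow> b \<in> S \<Longrightarrow> a \<noteq> b \<Longrightarrow> 2 * \<eta> \<le> \<bar>a - b\<bar>"
    and ST: "\<And>a. a \<in> S \<Longrightarrow> \<exists>b. b \<in> T \<and> \<bar>b - a\<bar> < \<eta> \<and> (\<forall>c. c \<in> T \<and> \<bar>c - a\<bar> < \<eta> \<longrightarrow> c = b)"
    and TS: "\<And>b. b \<in> T \<Longrightarrow> \<exists>a. a \<in> S \<and> \<bar>b - a\<bar> < \<eta>"
  shows "card T = card S"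
proof -
  obtain f where f: "\<And>a. a \<in> S \<Longrightarrow> f a \<in> T \<and> \<bar>f a - a\<bar> < \<eta> \<and> (\<forall>c. c \<in> T \<and> \<bar>c - a\<bar> < \<eta> \<longrightarrow> c = f a)"
    using ST by metis
  have "bij_betw f S T"
  proof (rule bij_betwI')
    fix a b assume ab: "a \<in> S" "b \<in> S"
    show "f a = f b \<longleftrightarrow> a = b"
    proof
      assume eq: "f a = f b"
      have "\<bar>f a - a\<bar> < \<eta>" "\<bar>f b - b\<bar> < \<eta>" using f[OF ab(1)] f[OF ab(2)] by blast+
      then have "\<bar>a - b\<bar> < 2 * \<eta>" using eq by linarith
      then show "a = b" using gap[OF ab] by (meson not_le)
    qed simp
  next
    fix b assume b: "b \<in> T"
    then obtain a where "a \<in> S" "\<bar>b - a\<bar> < \<eta>" using TS by blast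
    then show "\<exists>a\<in>S. b = f a" using f b by blast
  qed (use f in blast)
  then show ?thesis by (simp add: bij_betw_same_card)
qed

section \<open>Generic behaviour of finite fibres\<close>

context o_minimal_expansion begin

text \<open>Equality of cardinalities of nearby fibres is not first-order while no bound is known.
  This condition is, and it implies equality by matching each point of \<open>A x\<close> with
  exactly one nearby point of \<open>A y\<close>.\<close>

definition good :: "nat set \<Rightarrow> ((nat \<Rightarrow> 'a) \<Rightarrow> 'a set) \<Rightarrow> (nat \<Rightarrow> 'a) \<Rightarrow> bool" where
  "good J A x \<longleftrightarrow> (\<exists>\<eta> r. \<eta> > 0 \<and> r > 0 \<and>
    (\<forall>a b. a \<in> A x \<and> b \<in> A x \<and> a \<noteq> b \<longrightarrow> 2 * \<eta> \<le> \<bar>a - b\<bar>) \<and>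
    (\<forall>y\<in>bx J x r.
      (\<forall>a. a \<in> A x \<longrightarrow> (\<exists>b. b \<in> A y \<and> \<bar>b - a\<bar> < \<eta> \<and> (\<forall>c. c \<in> A y \<and> \<bar>c - a\<bar> < \<eta> \<longrightarrow> c = b))) \<and>
      (\<forall>b. b \<in> A y \<longrightarrow> (\<exists>a. a \<in> A x \<and> \<bar>b - a\<bar> < \<eta>))))"

lemma good_card:
  assumes "good J A x"
  shows "nbhd J (\<lambda>y. card (A y) = card (A x)) x"
proof -
  obtain \<eta> r where *: "\<eta> > 0" "r > 0" "\<forall>a b. a \<in> A x \<and> b \<in> A x \<and> a \<noteq> b \<longrightarrow> 2 * \<eta> \<le> \<bar>a - b\<bar>"
    "\<forall>y\<in>bx J x r.
      (\<forall>a. a \<in> A x \<longrightarrow> (\<exists>b. b \<in> A y \<and> \<bar>b - a\<bar> < \<eta> \<and> (\<forall>c. c \<in> A y \<and> \<bar>c - a\<bar> < \<eta> \<longrightarrow> c = b))) \<and>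
      (\<forall>b. b \<in> A y \<longrightarrow> (\<exists>a. a \<in> A x \<and> \<bar>b - a\<bar> < \<eta>))"
    using assms unfolding good_def by blast
  have "card (A y) = card (A x)" if "y \<in> bx J x r" for y
  proof (rule card_eq_if_close[of _ \<eta>])
    show "2 * \<eta> \<le> \<bar>a - b\<bar>" if "a \<in> A x" "b \<in> A x" "a \<noteq> b" for a b using *(3) that by blast
    show "\<exists>b. b \<in> A y \<and> \<bar>b - a\<bar> < \<eta> \<and> (\<forall>c. c \<in> A y \<and> \<bar>c - a\<bar> < \<eta> \<longrightarrow> c = b)" if "a \<in> A x" for a
      using bspec[OF *(4) \<open>y \<in> bx J x r\<close>, THEN conjunct1, rule_format, OF that] .
    show "\<exists>a. a \<in> A x \<and> \<bar>b - a\<bar> < \<eta>" if "b \<in> A y" for b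
      using bspec[OF *(4) \<open>y \<in> bx J x r\<close>, THEN conjunct2, rule_format, OF that] .
  qed
  then show ?thesis unfolding nbhd_def using *(2) by blast
qed

lemma dpred_good:
  assumes "finite J" "dfam A"
  shows "dpred (good J A)"
  unfolding good_def by (intro d_intros assms(1) dfam_mem[OF assms(2)])

text \<open>Tested at one point \<open>a\<close> of the fibre at a time, so that the least point of
  failure can be selected.\<close>

definition lsc :: "nat set \<Rightarrow> ((nat \<Rightarrow> 'a) \<Rightarrow> 'a set) \<Rightarrow> 'a \<Rightarrow> (nat \<Rightarrow> 'a) \<Rightarrow> bool" where
  "lsc J A a x \<longleftrightarrow> (\<forall>\<epsilon>. \<epsilon> > 0 \<longrightarrow> (\<exists>r. r > 0 \<and> (\<forall>y\<in>bx J x r. \<exists>b. b \<in> A y \<and> \<bar>b - a\<bar> < \<epsilon>)))"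

definition usc :: "nat set \<Rightarrow> ((nat \<Rightarrow> 'a) \<Rightarrow> 'a set) \<Rightarrow> (nat \<Rightarrow> 'a) \<Rightarrow> bool" where
  "usc J A x \<longleftrightarrow> (\<forall>\<epsilon>. \<epsilon> > 0 \<longrightarrow> (\<exists>r. r > 0 \<and> (\<forall>y\<in>bx J x r. \<forall>b. b \<in> A y \<longrightarrow> (\<exists>a. a \<in> A x \<and> \<bar>b - a\<bar> < \<epsilon>))))"

text \<open>Otherwise the least point of \<open>A y\<close> at which lower semicontinuity fails would be a definable
  function of \<open>y\<close>, but a definable selection of \<open>A\<close> is continuous somewhere.\<close>

lemma lsc_somewhere:
  assumes J: "finite J" and A: "dfam A" and fin: "\<And>x. x \<in> E J \<Longrightarrow> finite (A x)" and r: "r > 0"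
  obtains x' r' where "r' > 0" "bx J x' r' \<subseteq> bx J x r" "\<And>y a. y \<in> bx J x' r' \<Longrightarrow> a \<in> A y \<Longrightarrow> lsc J A a y"
proof -
  define bad where "bad a y \<longleftrightarrow> a \<in> A y \<and> \<not> lsc J A a y" for a y
  have bad: "dpred (\<lambda>e. bad (e 0) (etl e))" unfolding bad_def lsc_def
    by (intro d_intros J dfam_mem[OF A])
  note bad' = dpred_inst[OF bad]
  have B: "dpred (\<lambda>y. \<exists>a. bad a y)" by (intro d_intros bad')
  show ?thesis
  proof (rule dichotomyE[OF dichotomy[OF J] B r, of x])
    fix x0 r0 assume 0: "r0 > 0" "bx J x0 r0 \<subseteq> bx J x r" "\<And>y. y \<in> bx J x0 r0 \<Longrightarrow> \<exists>a. bad a y"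
    define f where "f y = the1 (\<lambda>a. bad a y \<and> (\<forall>b. bad b y \<longrightarrow> a \<le> b))" for y
    have f: "dfun f" unfolding f_def by (intro dfun_the1 d_intros bad')
    have bf: "bad (f y) y" if y: "y \<in> bx J x0 r0" for y
    proof -
      have "finite {a. bad a y}" using fin[of y] y bx_subset_E[of J x0 r0] by (auto simp: bad_def)
      moreover have "{a. bad a y} \<noteq> {}" using 0(3)[OF y] by blast
      ultimately have m: "bad (Min {a. bad a y}) y" "\<forall>b. bad b y \<longrightarrow> Min {a. bad a y} \<le> b"
        using Min_in[of "{a. bad a y}"] by simp_all
      have "f y = Min {a. bad a y}" unfolding f_def
        using m by (intro the1_equality) (auto intro: order_antisym)
      then show ?thesis using m by simp
    qed
    obtain x1 r1 where 1: "r1 > 0" "bx J x1 r1 \<subseteq> bx J x0 r0" "\<And>y. y \<in> bx J x1 r1 \<Longrightarrow> cont_at J f y"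
      by (rule generic_continuity[OF J f 0(1)]) (rule that)
    define y where "y = restrict x1 J"
    have y: "y \<in> bx J x1 r1" unfolding y_def by (rule center_in_bx[OF 1(1)])
    then have "bad (f y) y" using bf 1 by blast
    then have "\<not> lsc J A (f y) y" unfolding bad_def by (rule conjunct2)
    then obtain \<epsilon> where \<epsilon>0: "\<epsilon> > 0" "\<not> (\<exists>r. r > 0 \<and> (\<forall>z\<in>bx J y r. \<exists>b. b \<in> A z \<and> \<bar>b - f y\<bar> < \<epsilon>))"
      unfolding lsc_def not_all not_imp by (elim exE conjE)
    have "\<exists>z\<in>bx J y r. \<forall>b. b \<in> A z \<longrightarrow> \<not> \<bar>b - f y\<bar> < \<epsilon>" if "r > 0" for r
      using \<epsilon>0(2) that by auto
    note \<epsilon> = \<epsilon>0(1) this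
    obtain s where s: "s > 0" "\<And>z. z \<in> bx J y s \<Longrightarrow> \<bar>f z - f y\<bar> < \<epsilon>"
      using 1(3)[OF y] \<epsilon>(1) unfolding cont_at_def by blast
    obtain t where t: "t > 0" "bx J y t \<subseteq> bx J x1 r1" using bx_open[OF J y] by blast
    have "min s t > 0" using s(1) t(1) by simp
    from \<epsilon>(2)[OF this] obtain z where z: "z \<in> bx J y (min s t)" "\<forall>b. b \<in> A z \<longrightarrow> \<not> \<bar>b - f y\<bar> < \<epsilon>" by blast
    have "z \<in> bx J y s" "z \<in> bx J y t" using z(1) by auto
    then have "f z \<in> A z" "\<bar>f z - f y\<bar> < \<epsilon>" using bf[of z] t(2) 1(2) s(2) unfolding bad_def by auto
    then show ?thesis using z(2) by blast
  next
    fix x0 r0 assume 0: "r0 > 0" "bx J x0 r0 \<subseteq> bx J x r" "\<And>y. y \<in> bx J x0 r0 \<Longrightarrow> \<not> (\<exists>a. bad a y)"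
    then show ?thesis unfolding bad_def by (intro that[of r0 x0]) blast+
  qed
qed

text \<open>If upper semicontinuity failed on a cube, then, after shrinking it, with a uniform \<open>\<epsilon>\<close>.
  The upper limit \<open>u x\<close> of the points of \<open>A y\<close>, for \<open>y \<longlongrightarrow> x\<close>, at distance at least \<open>\<epsilon>\<close> from
  \<open>A x\<close> oscillates arbitrarily little on some subcube, where this is absurd.\<close>

lemma usc_somewhere:
  assumes J: "finite J" and A: "dfam A" and r: "r > 0"
    and K: "\<And>y a. y \<in> bx J x r \<Longrightarrow> a \<in> A y \<Longrightarrow> \<bar>a\<bar> \<le> K"
  obtains x' r' where "r' > 0" "bx J x' r' \<subseteq> bx J x r" "\<And>y. y \<in> bx J x' r' \<Longrightarrow> usc J A y"
proof -
  note Am = dfam_mem[OF A]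
  have U: "dpred (usc J A)" unfolding usc_def by (intro d_intros J Am)
  show ?thesis
  proof (rule dichotomyE[OF dichotomy[OF J] U r, of x])
    fix x0 r0 assume 0: "r0 > 0" "bx J x0 r0 \<subseteq> bx J x r" "\<And>y. y \<in> bx J x0 r0 \<Longrightarrow> \<not> usc J A y"
    define R where "R l x \<longleftrightarrow> (\<forall>r. r > 0 \<longrightarrow> (\<exists>y\<in>bx J x r. \<exists>b. b \<in> A y \<and> (\<forall>a. a \<in> A x \<longrightarrow> l \<le> \<bar>b - a\<bar>)))" for l x
    have R: "dpred (\<lambda>e. R (e 0) (etl e))" unfolding R_def by (intro d_intros J Am)
    have R1: "\<exists>l>0. R l y" if y: "y \<in> bx J x0 r0" for y
      using 0(3)[OF y] unfolding usc_def R_def by (meson not_le)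
    have R2: "R l' y" if "R l y" "0 < l'" "l' \<le> l" for y l l'
      using that unfolding R_def by (meson order_trans)
    obtain x1 r1 \<epsilon> where 1: "r1 > 0" "\<epsilon> > 0" "bx J x1 r1 \<subseteq> bx J x0 r0" "\<And>y. y \<in> bx J x1 r1 \<Longrightarrow> R \<epsilon> y"
      by (rule uniform_choice[OF Baire[OF J] R 0(1) R1 R2], assumption, assumption, assumption, assumption, rule that)
    \<comment> \<open>Upper bounds, valid near \<open>x\<close>, for those points of nearby fibres
      that keep distance \<open>\<epsilon>\<close> from \<open>A x\<close>; their infimum is the
      upper limit. By \<open>R\<close> such points occur arbitrarily near, so the bounds cannot fall
      below \<open>- K\<close>.\<close>
    define D where "D x = {u. \<exists>r. r > 0 \<and> (\<forall>y\<in>bx J x r. \<forall>b. b \<in> A y \<and> (\<forall>a. a \<in> A x \<longrightarrow> \<epsilon> \<le> \<bar>b - a\<bar>) \<longrightarrow> b \<le> u)}" for x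
    have D: "dfam D" unfolding D_def by (intro dfam_Collect d_intros J Am)
    note D1 = def1_fam[OF D]
    have KD: "K \<in> D y" "\<forall>u\<in>D y. - K \<le> u" if y: "y \<in> bx J x1 r1" for y
    proof -
      have "y \<in> bx J x r" using y 1 0 by blast
      then obtain t where t: "t > 0" "bx J y t \<subseteq> bx J x r" using bx_open[OF J] by blast
      have "b \<le> K" if "z \<in> bx J y t" "b \<in> A z" for z b using K[of z b] t(2) that by (auto simp: abs_le_iff)
      then show "K \<in> D y" unfolding D_def using t(1) by blast
      show "\<forall>u\<in>D y. - K \<le> u"
      proof
        fix u assume "u \<in> D y"
        then obtain q where q: "q > 0" "\<And>z b. z \<in> bx J y q \<Longrightarrow> b \<in> A z \<Longrightarrow> (\<forall>a. a \<in> A y \<longrightarrow> \<epsilon> \<le> \<bar>b - a\<bar>) \<Longrightarrow> b \<le> u"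
          unfolding D_def by blast
        have "min q t > 0" using q(1) t(1) by simp
        then obtain z b where zb: "z \<in> bx J y (min q t)" "b \<in> A z" "\<forall>a. a \<in> A y \<longrightarrow> \<epsilon> \<le> \<bar>b - a\<bar>"
          using 1(4)[OF y] unfolding R_def by blast
        have z: "z \<in> bx J y q" "z \<in> bx J y t" using zb(1) by auto
        have "\<bar>b\<bar> \<le> K" using K t(2) z(2) zb(2) by blast
        moreover have "b \<le> u" using q(2)[OF z(1) zb(2,3)] .
        ultimately show "- K \<le> u" by linarith
      qed
    qed
    define u where "u y = dinf (D y)" for y
    have u: "dfun u" unfolding u_def by (intro dfun_dinf D)
    have lim: "\<exists>z\<in>bx J y r. \<exists>b. b \<in> A z \<and> (\<forall>a. a \<in> A y \<longrightarrow> \<epsilon> \<le> \<bar>b - a\<bar>) \<and> \<bar>b - u y\<bar> < \<theta>"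
      if y: "y \<in> bx J x1 r1" and r: "r > 0" and \<theta>: "\<theta> > 0" for y r \<theta>
    proof -
      have ne: "D y \<noteq> {}" using KD(1)[OF y] by blast
      have "dinf (D y) < u y + \<theta>" using \<theta> by (simp add: u_def)
      then obtain d where "d \<in> D y" "d < u y + \<theta>" using dinf_less[OF D1 ne KD(2)[OF y]] by blast
      then obtain q where q: "q > 0" "\<And>z b. z \<in> bx J y q \<Longrightarrow> b \<in> A z \<Longrightarrow> (\<forall>a. a \<in> A y \<longrightarrow> \<epsilon> \<le> \<bar>b - a\<bar>) \<Longrightarrow> b \<le> d"
        unfolding D_def by blast
      have "u y - \<theta> \<notin> D y" using dinf_lower[OF D1 _ KD(2)[OF y], of "u y - \<theta>"] \<theta> by (auto simp: u_def)
      moreover have "min q r > 0" using q(1) r by simp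
      ultimately obtain z b where zb: "z \<in> bx J y (min q r)" "b \<in> A z" "\<forall>a. a \<in> A y \<longrightarrow> \<epsilon> \<le> \<bar>b - a\<bar>" "\<not> b \<le> u y - \<theta>"
        unfolding D_def by blast
      have z: "z \<in> bx J y q" "z \<in> bx J y r" using zb(1) by auto
      have "b \<le> d" using q(2)[OF z(1) zb(2,3)] .
      then have "\<bar>b - u y\<bar> < \<theta>" using zb(4) \<open>d < u y + \<theta>\<close> by (simp add: abs_less_iff not_le algebra_simps)
      then show ?thesis using z(2) zb(2,3) by blast
    qed
    have e8: "\<epsilon> / 8 > 0" using 1(2) by simp
    obtain x2 r2 c where 2: "r2 > 0" "bx J x2 r2 \<subseteq> bx J x1 r1" "\<And>y. y \<in> bx J x2 r2 \<Longrightarrow> \<bar>u y - c\<bar> \<le> \<epsilon> / 8"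
      by (rule small_oscillation[OF J Baire[OF J] dichotomy[OF J] u 1(1) e8]) (rule that)
    define y where "y = restrict x2 J"
    have y: "y \<in> bx J x2 r2" unfolding y_def by (rule center_in_bx[OF 2(1)])
    then obtain s where s: "s > 0" "bx J y s \<subseteq> bx J x2 r2" using bx_open[OF J] by metis
    obtain z b where z: "z \<in> bx J y s" "b \<in> A z" "\<bar>b - u y\<bar> < \<epsilon> / 8"
      using lim[OF _ s(1) e8, of y] y 2(2) by blast
    have z2: "z \<in> bx J x2 r2" using z(1) s(2) by blast
    obtain w b' where w: "b' \<in> A w" "\<forall>a. a \<in> A z \<longrightarrow> \<epsilon> \<le> \<bar>b' - a\<bar>" "\<bar>b' - u z\<bar> < \<epsilon> / 8"
      using lim[OF _ zero_less_one e8, of z] z2 2(2) by blast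
    \<comment> \<open>Here \<open>b\<close> lies in \<open>A z\<close> near \<open>u y\<close>,
      while \<open>b'\<close> is near \<open>u z\<close> and at least \<open>\<epsilon>\<close> away
      from \<open>A z\<close>. As \<open>u y\<close> and \<open>u z\<close> are both near
      \<open>c\<close>, four errors of \<open>\<epsilon> / 8\<close> would have to make up
      \<open>\<epsilon>\<close>.\<close>
    have "\<epsilon> \<le> \<bar>b' - b\<bar>" using w(2) z(2) by blast
    also have "\<bar>b' - b\<bar> \<le> \<bar>b' - u z\<bar> + \<bar>u z - c\<bar> + \<bar>u y - c\<bar> + \<bar>b - u y\<bar>" by linarith
    also have "\<dots> \<le> \<epsilon> / 8 + \<epsilon> / 8 + \<epsilon> / 8 + \<epsilon> / 8"
      using 2(3)[OF y] 2(3)[OF z2] z(3) w(3) by (intro add_mono) auto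
    also have "\<dots> = \<epsilon> / 2" by (simp add: field_simps)
    finally show ?thesis using 1(2) by simp
  qed (rule that)
qed

text \<open>Every cube has a subcube on which the fibres have a uniform gap and a uniform bound and
  are semicontinuous from both sides at all points; the centre of that subcube is good.\<close>

lemma bad_thin:
  assumes J: "finite J" and A: "dfam A" and fin: "\<And>x. x \<in> E J \<Longrightarrow> finite (A x)"
  shows "thin J (\<lambda>x. \<not> good J A x)"
  unfolding thin_def not_not
proof (intro allI impI)
  fix x and r :: 'a assume r: "r > 0"
  note Am = dfam_mem[OF A]
  have finx: "finite (A y)" if "y \<in> bx J x' r'" for y x' r' using fin that bx_subset_E[of J x' r'] by blast
  \<comment> \<open>The bound on the points is written as a product with \<open>l\<close>, so that
    both requirements weaken as \<open>l\<close> decreases.\<close>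
  define R where "R l y \<longleftrightarrow> (\<forall>a. a \<in> A y \<longrightarrow> l * \<bar>a\<bar> \<le> 1) \<and> (\<forall>a b. a \<in> A y \<and> b \<in> A y \<and> a \<noteq> b \<longrightarrow> l \<le> \<bar>a - b\<bar>)" for l y
  have R: "dpred (\<lambda>e. R (e 0) (etl e))" unfolding R_def by (intro d_intros Am)
  have R1: "\<exists>l>0. R l y" if y: "y \<in> bx J x r" for y
  proof -
    define S where "S = (\<lambda>a. 1 / (1 + \<bar>a\<bar>)) ` A y \<union> (\<lambda>(a, b). \<bar>a - b\<bar>) ` {(a, b) \<in> A y \<times> A y. a \<noteq> b}"
    define l where "l = Min (insert 1 S)"
    have "finite S" unfolding S_def using finx[OF y] by (auto intro!: finite_imageI intro: finite_subset[of _ "A y \<times> A y"])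
    then have l: "l > 0" "\<And>s. s \<in> S \<Longrightarrow> l \<le> s" unfolding l_def by (auto simp: S_def add_pos_nonneg)
    have "l * \<bar>a\<bar> \<le> 1" if "a \<in> A y" for a
    proof -
      have "l \<le> 1 / (1 + \<bar>a\<bar>)" using that by (intro l(2)) (auto simp: S_def)
      then have "l * (1 + \<bar>a\<bar>) \<le> 1" by (simp add: pos_le_divide_eq add_pos_nonneg)
      then show ?thesis using l(1) by (simp add: algebra_simps)
    qed
    moreover have "l \<le> \<bar>a - b\<bar>" if "a \<in> A y" "b \<in> A y" "a \<noteq> b" for a b
      using that by (intro l(2)) (force simp: S_def)
    ultimately show ?thesis using l(1) unfolding R_def by blast
  qed
  have R2: "R l' y" if l: "R l y" "0 < l'" "l' \<le> l" for y l l'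
    using l(1) mult_right_mono[OF l(3) abs_ge_zero] l(3) unfolding R_def by (meson order_trans)
  obtain x0 r0 \<epsilon> where 0: "r0 > 0" "\<epsilon> > 0" "bx J x0 r0 \<subseteq> bx J x r" "\<And>y. y \<in> bx J x0 r0 \<Longrightarrow> R \<epsilon> y"
    by (rule uniform_choice[OF Baire[OF J] R r R1 R2], assumption, assumption, assumption, assumption, rule that)
  have K: "\<bar>a\<bar> \<le> 1 / \<epsilon>" if "y \<in> bx J x0 r0" "a \<in> A y" for y a
    using 0(4)[OF that(1)] that(2) 0(2) unfolding R_def by (simp add: pos_le_divide_eq mult.commute)
  obtain x1 r1 where 1: "r1 > 0" "bx J x1 r1 \<subseteq> bx J x0 r0" "\<And>y. y \<in> bx J x1 r1 \<Longrightarrow> usc J A y"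
    by (rule usc_somewhere[OF J A 0(1) K], assumption, assumption, rule that)
  obtain x2 r2 where 2: "r2 > 0" "bx J x2 r2 \<subseteq> bx J x1 r1" "\<And>y a. y \<in> bx J x2 r2 \<Longrightarrow> a \<in> A y \<Longrightarrow> lsc J A a y"
    by (rule lsc_somewhere[OF J A fin 1(1)], assumption, rule that)
  define y where "y = restrict x2 J"
  have y: "y \<in> bx J x2 r2" unfolding y_def by (rule center_in_bx[OF 2(1)])
  define \<eta> where "\<eta> = \<epsilon> / 4"
  have \<eta>: "\<eta> > 0" "2 * \<eta> \<le> \<epsilon>" using 0(2) by (auto simp: \<eta>_def)
  obtain s1 where s1: "s1 > 0" "bx J y s1 \<subseteq> bx J x2 r2" using bx_open[OF J y] by blast
  obtain s2 where s2: "s2 > 0" "\<And>z b. z \<in> bx J y s2 \<Longrightarrow> b \<in> A z \<Longrightarrow> \<exists>a. a \<in> A y \<and> \<bar>b - a\<bar> < \<eta>"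
    using 1(3)[of y] y 2(2) \<eta>(1) unfolding usc_def by blast
  have "\<exists>s>0. \<forall>a\<in>A y. \<forall>z\<in>bx J y s. \<exists>b. b \<in> A z \<and> \<bar>b - a\<bar> < \<eta>"
    by (rule common_radius[OF finx[OF y]]) (use 2(3)[OF y] \<eta>(1) in \<open>unfold lsc_def, blast\<close>)
  then obtain s3 where s3: "s3 > 0" "\<And>a z. a \<in> A y \<Longrightarrow> z \<in> bx J y s3 \<Longrightarrow> \<exists>b. b \<in> A z \<and> \<bar>b - a\<bar> < \<eta>" by blast
  have gap: "2 * \<eta> \<le> \<bar>a - b\<bar>" if "z \<in> bx J x2 r2" "a \<in> A z" "b \<in> A z" "a \<noteq> b" for a b z
  proof -
    have "z \<in> bx J x0 r0" using that(1) 1(2) 2(2) by blast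
    from 0(4)[OF this] have "\<epsilon> \<le> \<bar>a - b\<bar>" using that(2-4) unfolding R_def by blast
    then show ?thesis using \<eta>(2) by linarith
  qed
  define s where "s = min s1 (min s2 s3)"
  have s: "s > 0" using s1(1) s2(1) s3(1) by (simp add: s_def)
  have sub: "z \<in> bx J y s1" "z \<in> bx J y s2" "z \<in> bx J y s3" if "z \<in> bx J y s" for z
    using that by (auto simp: s_def)
  have match: "\<exists>b. b \<in> A z \<and> \<bar>b - a\<bar> < \<eta> \<and> (\<forall>c. c \<in> A z \<and> \<bar>c - a\<bar> < \<eta> \<longrightarrow> c = b)"
    if z: "z \<in> bx J y s" and a: "a \<in> A y" for z a
  proof -
    obtain b where b: "b \<in> A z" "\<bar>b - a\<bar> < \<eta>" using s3(2)[OF a sub(3)[OF z]] by blast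
    have "c = b" if c: "c \<in> A z" "\<bar>c - a\<bar> < \<eta>" for c
    proof (rule ccontr)
      assume "c \<noteq> b"
      then have "2 * \<eta> \<le> \<bar>c - b\<bar>" using gap[of z c b] sub(1)[OF z] s1(2) b c by blast
      moreover have "\<bar>c - b\<bar> \<le> \<bar>c - a\<bar> + \<bar>b - a\<bar>" by linarith
      ultimately show False using b(2) c(2) by linarith
    qed
    then show ?thesis using b by blast
  qed
  have "good J A y" unfolding good_def
  proof (rule exI[of _ \<eta>], rule exI[of _ s], intro conjI allI impI ballI)
    show "2 * \<eta> \<le> \<bar>a - b\<bar>" if "a \<in> A y \<and> b \<in> A y \<and> a \<noteq> b" for a b
      using gap[OF y] that by blast
    show "\<exists>a. a \<in> A y \<and> \<bar>b - a\<bar> < \<eta>" if "z \<in> bx J y s" "b \<in> A z" for z b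
      using s2(2) sub(2) that by blast
  qed (fact \<eta>(1) s match)+
  then show "\<exists>y\<in>bx J x r. good J A y" using y 0(3) 1(2) 2(2) by blast
qed

text \<open>At good points the cardinality is locally constant, hence bounded by
  \<open>loc_const_finite J\<close>, and the points are enumerated by rank. Bad points lie on
  finitely many graphs, along which the family depends on one coordinate less.\<close>

lemma uniformly_finite_step:
  assumes J: "finite J" and LC: "loc_const_finite J" and TG: "thin_in_graphs J"
    and UF: "\<And>m. m \<in> J \<Longrightarrow> uniformly_finite (J - {m})"
  shows "uniformly_finite J"
  unfolding uniformly_finite_def
proof (intro allI impI)
  fix A :: "(nat \<Rightarrow> 'a) \<Rightarrow> 'a set" assume A: "dfam A" and fin0: "\<forall>x\<in>E J. finite (A x)"
  then have fin: "finite (A x)" if "x \<in> E J" for x using that by blast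
  have g: "dpred (good J A)" by (rule dpred_good[OF J A])
  have "\<exists>Q. dpred Q \<and> (\<forall>x\<in>E J. Q x \<longleftrightarrow> card (A x) = k)" for k
    by (intro exI[of _ "\<lambda>x. atleast k (A x) \<and> \<not> atleast (Suc k) (A x)"] conjI dpred_conj dpred_not dpred_atleast[OF A])
      (auto simp: atleast_iff_card fin)
  moreover have "nbhd J (\<lambda>y. good J A y \<longrightarrow> card (A y) = card (A x)) x" if "good J A x" for x
    using good_card[OF that] unfolding nbhd_def by blast
  ultimately have "finite ((\<lambda>x. card (A x)) ` {x \<in> E J. good J A x})"
    using LC[unfolded loc_const_finite_def, rule_format, OF g, of "\<lambda>x. card (A x)"] by blast
  then obtain K where K: "\<And>x. x \<in> E J \<Longrightarrow> good J A x \<Longrightarrow> card (A x) \<le> K"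
    unfolding finite_nat_set_iff_bounded_le by blast
  obtain G0 where G0: "finite G0" "\<And>g. g \<in> G0 \<Longrightarrow> dfun g"
    "\<And>x u. finite (A x) \<Longrightarrow> card (A x) \<le> K \<Longrightarrow> u \<in> A x \<Longrightarrow> \<exists>g\<in>G0. u = g x"
    by (rule ranked_functions[OF A]) (rule that)
  obtain H where H: "finite H" "\<And>m h. (m, h) \<in> H \<Longrightarrow> m \<in> J \<and> dfun h"
    "\<And>x. x \<in> E J \<Longrightarrow> \<not> good J A x \<Longrightarrow> \<exists>m h. (m, h) \<in> H \<and> x m = h (x(m := undefined))"
    by (rule thin_in_graphsE[OF TG dpred_not[OF g] bad_thin[OF J A fin]], assumption, rule that)
  have "\<exists>G. finite G \<and> (\<forall>g\<in>G. dfun g) \<and>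
    (\<forall>y\<in>E (J - {fst p}). \<forall>u\<in>A (y(fst p := snd p y)). \<exists>g\<in>G. u = g y)" if p: "p \<in> H" for p
  proof -
    have m: "fst p \<in> J" "dfun (snd p)" using H(2)[of "fst p" "snd p"] p by auto
    have "dfam (\<lambda>y. A (y(fst p := snd p y)))" using m(2) by (intro dfam_comp[OF A] d_intros)
    moreover have "\<forall>y\<in>E (J - {fst p}). finite (A (y(fst p := snd p y)))"
      using m(1) by (auto intro!: fin simp: extensional_def)
    ultimately show ?thesis using UF[OF m(1)] unfolding uniformly_finite_def by blast
  qed
  then have "\<forall>p\<in>H. \<exists>G. finite G \<and> (\<forall>g\<in>G. dfun g) \<and>
    (\<forall>y\<in>E (J - {fst p}). \<forall>u\<in>A (y(fst p := snd p y)). \<exists>g\<in>G. u = g y)" by blast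
  from bchoice[OF this] obtain F where F: "\<forall>p\<in>H. finite (F p) \<and> (\<forall>g\<in>F p. dfun g) \<and>
    (\<forall>y\<in>E (J - {fst p}). \<forall>u\<in>A (y(fst p := snd p y)). \<exists>g\<in>F p. u = g y)" ..
  define G where "G = G0 \<union> (\<Union>p\<in>H. (\<lambda>g x. g (x(fst p := undefined))) ` F p)"
  have "finite G" unfolding G_def using G0(1) H(1) F by auto
  moreover have "dfun g" if "g \<in> G" for g
  proof -
    from that consider "g \<in> G0" | p h where "p \<in> H" "h \<in> F p" "g = (\<lambda>x. h (x(fst p := undefined)))"
      unfolding G_def by blast
    then show ?thesis
    proof cases
      case (2 p h)
      then have "dfun h" using F by blast
      then show ?thesis unfolding 2(3) by (rule dfun_comp) (intro d_intros)
    qed (rule G0(2))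
  qed
  moreover have "\<exists>g\<in>G. u = g x" if x: "x \<in> E J" "u \<in> A x" for x u
  proof (cases "good J A x")
    case True
    then show ?thesis using G0(3)[OF fin[OF x(1)] K[OF x(1) True] x(2)] unfolding G_def by blast
  next
    case False
    then obtain m h where mh: "(m, h) \<in> H" "x m = h (x(m := undefined))" using H(3)[OF x(1)] by blast
    have *: "x(m := undefined) \<in> E (J - {m})" using x(1) by (auto simp: extensional_def)
    have "(x(m := undefined))(m := h (x(m := undefined))) = x" using mh(2) by (simp add: fun_upd_idem)
    then obtain g where g: "g \<in> F (m, h)" "u = g (x(m := undefined))"
      using F[rule_format, OF mh(1)] * x(2) by fastforce
    have "(\<lambda>x. g (x(m := undefined))) \<in> G" unfolding G_def
      by (intro UnI2 UN_I[OF mh(1)] image_eqI[OF _ g(1)]) simp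
    then show ?thesis using g(2) by (intro bexI[of _ "\<lambda>x. g (x(m := undefined))"])
  qed
  ultimately show "\<exists>G. finite G \<and> (\<forall>g\<in>G. dfun g) \<and> (\<forall>x\<in>E J. \<forall>u\<in>A x. \<exists>g\<in>G. u = g x)"
    by (intro exI[of _ G] conjI ballI)
qed

text \<open>\<open>thin_in_graphs\<close> and \<open>loc_const_finite\<close> rise from
  \<open>J - {m}\<close> for a single \<open>m\<close>, and they yield the other two on
  \<open>J\<close>. The latter meet graphs in every direction, so the induction hypothesis must
  cover all \<open>J - {m}\<close>.\<close>

theorem tameness:
  assumes "finite J"
  shows "uniformly_finite J \<and> piecewise_cont J \<and> thin_in_graphs J \<and> loc_const_finite J"
  using assms
proof (induction J rule: finite_psubset_induct)
  case (psubset J)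
  have IH: "uniformly_finite (J - {m}) \<and> piecewise_cont (J - {m}) \<and> thin_in_graphs (J - {m}) \<and> loc_const_finite (J - {m})"
    if "m \<in> J" for m
    using that by (intro psubset(2)) blast
  have *: "thin_in_graphs J \<and> loc_const_finite J"
  proof (cases "J = {}")
    case True
    then show ?thesis using thin_in_graphs_empty loc_const_finite_empty by simp
  next
    case False
    then obtain m where m: "m \<in> J" by blast
    then have "insert m (J - {m}) = J" by blast
    then show ?thesis
      using thin_in_graphs_insert[of "J - {m}" m] loc_const_finite_insert[of "J - {m}" m] IH[OF m] psubset(1) by auto
  qed
  then show ?case using uniformly_finite_step piecewise_cont_step IH psubset(1) by blast
qed

end

section \<open>Coverings of a product with the interval\<close>

context o_minimal_expansion begin

definition open_fam :: "nat set \<Rightarrow> ((nat \<Rightarrow> 'a) \<Rightarrow> 'a set) \<Rightarrow> bool" where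
  "open_fam J W \<longleftrightarrow> (\<forall>x\<in>E J. \<forall>t\<in>W x. \<exists>r>0. \<forall>y\<in>bx J x r. \<forall>s. \<bar>s - t\<bar> < r \<longrightarrow> s \<in> W y)"

lemma open_famD:
  assumes "open_fam J W" "x \<in> E J" "t \<in> W x"
  obtains r where "r > 0" "\<And>y s. y \<in> bx J x r \<Longrightarrow> \<bar>s - t\<bar> < r \<Longrightarrow> s \<in> W y"
  using assms unfolding open_fam_def by blast

text \<open>Closed intervals of R need not be compact. Instead, the \<open>v\<close> for which the
  segment from \<open>a\<close> to \<open>v\<close> has a tube form a definable set, whose supremum
  could be pushed further unless it were \<open>b\<close>.\<close>

lemma tube:
  assumes J: "finite J" and W: "dfam W" and op: "open_fam J W" and x: "x \<in> E J" and ab: "a \<le> b"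
    and sub: "\<And>t. a \<le> t \<Longrightarrow> t \<le> b \<Longrightarrow> t \<in> W x"
  obtains r where "r > 0" "\<And>y t. y \<in> bx J x r \<Longrightarrow> a - r < t \<Longrightarrow> t < b + r \<Longrightarrow> t \<in> W y"
proof -
  define T where "T = {v. a \<le> v \<and> v \<le> b \<and> (\<exists>\<epsilon>. \<epsilon> > 0 \<and> (\<forall>y\<in>bx J x \<epsilon>. \<forall>t. a - \<epsilon> < t \<and> t < v + \<epsilon> \<longrightarrow> t \<in> W y))}"
  have T: "def1 T" unfolding T_def
    by (rule def1_Collect) (intro d_intros J dfam_mem[OF W])
  have Tb: "\<forall>v\<in>T. v \<le> b" by (simp add: T_def)
  have TI: "v \<in> T" if "a \<le> v" "v \<le> b" "\<epsilon> > 0" "\<And>y t. y \<in> bx J x \<epsilon> \<Longrightarrow> a - \<epsilon> < t \<Longrightarrow> t < v + \<epsilon> \<Longrightarrow> t \<in> W y" for v \<epsilon>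
    unfolding T_def using that by blast
  have aT: "a \<in> T"
  proof -
    obtain r where r: "r > 0" "\<And>y s. y \<in> bx J x r \<Longrightarrow> \<bar>s - a\<bar> < r \<Longrightarrow> s \<in> W y"
      by (rule open_famD[OF op x sub[OF order_refl ab]]) (rule that)
    show ?thesis using r ab by (intro TI[of a r]) (auto simp: abs_less_iff algebra_simps)
  qed
  define v where "v = dsup T"
  have ne: "T \<noteq> {}" using aT by blast
  have v: "a \<le> v" "v \<le> b" using dsup_upper[OF T aT Tb] dsup_le[OF T ne Tb] by (auto simp: v_def)
  obtain r where r: "r > 0" "\<And>y s. y \<in> bx J x r \<Longrightarrow> \<bar>s - v\<bar> < r \<Longrightarrow> s \<in> W y"
    by (rule open_famD[OF op x sub[OF v]]) (rule that)
  have "v - r < dsup T" using r(1) by (simp add: v_def)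
  from less_dsup[OF T ne Tb this] obtain w where w: "w \<in> T" "v - r < w" by blast
  then obtain \<epsilon> where \<epsilon>: "\<epsilon> > 0" "\<And>y t. y \<in> bx J x \<epsilon> \<Longrightarrow> a - \<epsilon> < t \<Longrightarrow> t < w + \<epsilon> \<Longrightarrow> t \<in> W y"
    unfolding T_def by blast
  \<comment> \<open>The tube reaching past \<open>w\<close> and the cube around the supremum
    overlap, so together they give a tube up to this point.\<close>
  define v' where "v' = min b (v + r / 2)"
  have v': "a \<le> v'" "v' \<le> b" "v' \<le> v + r / 2" using v ab r(1) by (auto simp: v'_def)
  have "v' \<in> T"
  proof (rule TI[OF v'(1,2), of "min \<epsilon> (r / 2)"])
    show "min \<epsilon> (r / 2) > 0" using \<epsilon>(1) r(1) by simp
    fix y t assume y: "y \<in> bx J x (min \<epsilon> (r / 2))" and t: "a - min \<epsilon> (r / 2) < t" "t < v' + min \<epsilon> (r / 2)"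
    have "r / 2 \<le> r" using r(1) by simp
    then have y': "y \<in> bx J x \<epsilon>" "y \<in> bx J x r" using y bx_mono[of "r / 2" r J x] by auto
    have mn: "min \<epsilon> (r / 2) \<le> \<epsilon>" "min \<epsilon> (r / 2) \<le> r / 2" by auto
    show "t \<in> W y"
    proof (cases "t < w + \<epsilon>")
      case True
      then show ?thesis using \<epsilon>(2)[OF y'(1)] t(1) mn(1) by simp
    next
      case False
      then have "v - r < t" using w(2) \<epsilon>(1) by linarith
      moreover have "t < v + r"
      proof -
        have "t < v + r / 2 + r / 2" using t(2) v'(3) mn(2) by linarith
        then show ?thesis by simp
      qed
      ultimately show ?thesis using r(2)[OF y'(2)] by (simp add: abs_less_iff algebra_simps)
    qed
  qed
  then have "v' \<le> v" using dsup_upper[OF T _ Tb] by (simp add: v_def)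
  then have "v' = b" using r(1) by (auto simp: v'_def min_def split: if_splits)
  with \<open>v' \<in> T\<close> have "b \<in> T" by simp
  then show ?thesis unfolding T_def using that by blast
qed

text \<open>A subdivision of the time from \<open>\<sigma> x\<close> to 1, continuous in
  \<open>x\<close> on \<open>U\<close>; each step carries the index of a set that contains it.
  Consecutive times may coincide.\<close>

primrec chain :: "nat set \<Rightarrow> ('j \<Rightarrow> (nat \<Rightarrow> 'a) \<Rightarrow> 'a set) \<Rightarrow> ((nat \<Rightarrow> 'a) \<Rightarrow> bool) \<Rightarrow> ((nat \<Rightarrow> 'a) \<Rightarrow> 'a) \<Rightarrow>
    (((nat \<Rightarrow> 'a) \<Rightarrow> 'a) \<times> 'j) list \<Rightarrow> bool" where
  "chain J W U \<sigma> [] \<longleftrightarrow> (\<forall>x\<in>E J. U x \<longrightarrow> \<sigma> x = 1)"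
| "chain J W U \<sigma> (s # ps) \<longleftrightarrow> dfun (fst s) \<and> (\<forall>x\<in>E J. U x \<longrightarrow> cont_at J (fst s) x \<and> \<sigma> x \<le> fst s x \<and>
    (\<forall>t. \<sigma> x \<le> t \<and> t \<le> fst s x \<longrightarrow> t \<in> W (snd s) x)) \<and> chain J W U (fst s) ps"

text \<open>The domain on which a list of partial time functions forms a subdivision. Strict
  inequality between consecutive times, more than \<open>chain\<close> asks for, makes this domain
  open.\<close>

primrec chain_dom :: "('j \<Rightarrow> (nat \<Rightarrow> 'a) \<Rightarrow> 'a set) \<Rightarrow> ((nat \<Rightarrow> 'a) \<Rightarrow> 'a) \<Rightarrow>
    ((((nat \<Rightarrow> 'a) \<Rightarrow> 'a) \<times> ((nat \<Rightarrow> 'a) \<Rightarrow> bool)) \<times> 'j) list \<Rightarrow> (nat \<Rightarrow> 'a) \<Rightarrow> bool" where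
  "chain_dom W \<sigma> [] x \<longleftrightarrow> True"
| "chain_dom W \<sigma> (s # ps) x \<longleftrightarrow> snd (fst s) x \<and> \<sigma> x < fst (fst s) x \<and>
    (\<forall>t. \<sigma> x \<le> t \<and> t \<le> fst (fst s) x \<longrightarrow> t \<in> W (snd s) x) \<and> chain_dom W (fst (fst s)) ps x"

text \<open>The start enters only through its value at \<open>x\<close>; in \<open>covering\<close>
  this lets a constant be exchanged for a time function with that value at \<open>x\<close>.\<close>

lemma chain_dom_cong: "\<sigma> x = \<sigma>' x \<Longrightarrow> chain_dom W \<sigma> ps x = chain_dom W \<sigma>' ps x"
  by (cases ps) auto

lemma dpred_chain_dom:
  assumes "\<And>j. j \<in> snd ` set ps \<Longrightarrow> dfam (W j)" "\<And>g U. (g, U) \<in> fst ` set ps \<Longrightarrow> dfun g \<and> dpred U" "dfun \<sigma>"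
  shows "dpred (chain_dom W \<sigma> ps)"
  using assms
proof (induction ps arbitrary: \<sigma>)
  case Nil
  show ?case by (simp add: dpred_const)
next
  case (Cons s ps)
  obtain g U j where s: "s = ((g, U), j)" by (metis prod.collapse)
  have g: "dfun g" "dpred U" and W: "dfam (W j)" using Cons(2,3) s by force+
  have IH: "dpred (chain_dom W g ps)"
    using Cons(2,3) g(1) by (intro Cons(1)) auto
  have "dpred (\<lambda>x. U x \<and> \<sigma> x < g x \<and> (\<forall>t. \<sigma> x \<le> t \<and> t \<le> g x \<longrightarrow> t \<in> W j x) \<and> chain_dom W g ps x)"
    by (intro d_intros IH g dfam_mem[OF W] dfun_comp[OF g(1)] dfun_comp[OF Cons(4)] Cons(4))
  then show ?case by (simp add: s)
qed

lemma nbhd_conj: "nbhd J P x \<Longrightarrow> nbhd J Q x \<Longrightarrow> nbhd J (\<lambda>y. P y \<and> Q y) x"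
proof -
  assume "nbhd J P x" "nbhd J Q x"
  then obtain r s where "r > 0" "\<forall>y\<in>bx J x r. P y" "s > 0" "\<forall>y\<in>bx J x s. Q y"
    unfolding nbhd_def by blast
  then show ?thesis unfolding nbhd_def by (intro exI[of _ "min r s"]) simp
qed

lemma nbhd_mono: "nbhd J P x \<Longrightarrow> (\<And>y. P y \<Longrightarrow> Q y) \<Longrightarrow> nbhd J Q x"
  unfolding nbhd_def by blast

lemma nbhd_less:
  assumes "cont_at J f x" "cont_at J g x" "f x < g x"
  shows "nbhd J (\<lambda>y. f y < g y) x"
proof -
  define \<epsilon> where "\<epsilon> = (g x - f x) / 2"
  have \<epsilon>: "\<epsilon> > 0" using assms(3) by (simp add: \<epsilon>_def)
  have "nbhd J (\<lambda>y. \<bar>f y - f x\<bar> < \<epsilon>) x" "nbhd J (\<lambda>y. \<bar>g y - g x\<bar> < \<epsilon>) x"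
    using assms(1,2) \<epsilon> unfolding cont_at_def nbhd_def by blast+
  from nbhd_conj[OF this] show ?thesis
  proof (rule nbhd_mono)
    fix y assume *: "\<bar>f y - f x\<bar> < \<epsilon> \<and> \<bar>g y - g x\<bar> < \<epsilon>"
    have "2 * \<epsilon> = g x - f x" by (simp add: \<epsilon>_def)
    then show "f y < g y" using * by linarith
  qed
qed

lemma nbhd_interval:
  assumes J: "finite J" and W: "dfam W" and op: "open_fam J W" and x: "x \<in> E J"
    and f: "cont_at J f x" and g: "cont_at J g x" and fg: "f x \<le> g x"
    and sub: "\<And>t. f x \<le> t \<Longrightarrow> t \<le> g x \<Longrightarrow> t \<in> W x"
  shows "nbhd J (\<lambda>y. \<forall>t. f y \<le> t \<and> t \<le> g y \<longrightarrow> t \<in> W y) x"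
proof -
  obtain r where r: "r > 0" "\<And>y t. y \<in> bx J x r \<Longrightarrow> f x - r < t \<Longrightarrow> t < g x + r \<Longrightarrow> t \<in> W y"
    by (rule tube[OF J W op x fg sub], assumption, assumption, rule that)
  have "nbhd J (\<lambda>y. \<bar>f y - f x\<bar> < r) x" "nbhd J (\<lambda>y. \<bar>g y - g x\<bar> < r) x" "nbhd J (\<lambda>y. y \<in> bx J x r) x"
    using f g r(1) unfolding cont_at_def nbhd_def by blast+
  from nbhd_conj[OF this(1) nbhd_conj[OF this(2,3)]] show ?thesis
  proof (rule nbhd_mono)
    fix y assume *: "\<bar>f y - f x\<bar> < r \<and> \<bar>g y - g x\<bar> < r \<and> y \<in> bx J x r"
    show "\<forall>t. f y \<le> t \<and> t \<le> g y \<longrightarrow> t \<in> W y"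
    proof (intro allI impI)
      fix t assume "f y \<le> t \<and> t \<le> g y"
      then show "t \<in> W y" using * by (intro r(2)) (auto simp: abs_less_iff)
    qed
  qed
qed

lemma chain_dom_open:
  assumes J: "finite J" and x: "x \<in> E J"
    and "\<And>j. j \<in> snd ` set ps \<Longrightarrow> dfam (W j) \<and> open_fam J (W j)"
    and "\<And>g U x. (g, U) \<in> fst ` set ps \<Longrightarrow> x \<in> E J \<Longrightarrow> U x \<Longrightarrow> cont_at J g x \<and> nbhd J U x"
    and "cont_at J \<sigma> x" "chain_dom W \<sigma> ps x"
  shows "nbhd J (chain_dom W \<sigma> ps) x"
  using assms(3-)
proof (induction ps arbitrary: \<sigma>)
  case Nil
  show ?case unfolding nbhd_def by (intro exI[of _ 1]) simp
next
  case (Cons s ps)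
  obtain g U j where s: "s = ((g, U), j)" by (metis prod.collapse)
  have W: "dfam (W j)" "open_fam J (W j)" using Cons(2) s by force+
  have d: "U x" "\<sigma> x < g x" "\<And>t. \<sigma> x \<le> t \<Longrightarrow> t \<le> g x \<Longrightarrow> t \<in> W j x" "chain_dom W g ps x"
    using Cons(5) s by auto
  have g: "cont_at J g x" "nbhd J U x" using Cons(3)[of g U x] s x d(1) by auto
  have "nbhd J (chain_dom W g ps) x"
  proof (rule Cons(1))
    show "dfam (W i) \<and> open_fam J (W i)" if "i \<in> snd ` set ps" for i using Cons(2)[of i] that by simp
    show "cont_at J h z \<and> nbhd J V z" if "(h, V) \<in> fst ` set ps" "z \<in> E J" "V z" for h V z
      using Cons(3)[of h V z] that by simp
  qed (use g d in auto)
  moreover have "nbhd J (\<lambda>y. \<forall>t. \<sigma> y \<le> t \<and> t \<le> g y \<longrightarrow> t \<in> W j y) x"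
    using d(2) by (intro nbhd_interval[OF J W x Cons(4) g(1) _ d(3)]) auto
  moreover note nbhd_less[OF Cons(4) g(1) d(2)] g(2)
  ultimately have "nbhd J (\<lambda>y. U y \<and> \<sigma> y < g y \<and> (\<forall>t. \<sigma> y \<le> t \<and> t \<le> g y \<longrightarrow> t \<in> W j y) \<and> chain_dom W g ps y) x"
    by (intro nbhd_conj)
  then show ?case by (simp add: s)
qed

lemma chain_dom_chain:
  assumes "\<And>g U x. (g, U) \<in> fst ` set ps \<Longrightarrow> dfun g \<and> (x \<in> E J \<longrightarrow> U x \<longrightarrow> cont_at J g x)"
    and "\<And>x. x \<in> E J \<Longrightarrow> V x \<Longrightarrow> chain_dom W \<sigma> ps x"
    and "ps \<noteq> []" "fst (fst (last ps)) = (\<lambda>_. 1)"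
  shows "chain J W V \<sigma> (map (\<lambda>s. (fst (fst s), snd s)) ps)"
  using assms
proof (induction ps arbitrary: \<sigma>)
  case (Cons s ps)
  obtain g U j where s: "s = ((g, U), j)" by (metis prod.collapse)
  have "dfun g" using Cons(2)[of g U] s by auto
  moreover have "cont_at J g x \<and> \<sigma> x \<le> g x \<and> (\<forall>t. \<sigma> x \<le> t \<and> t \<le> g x \<longrightarrow> t \<in> W j x)" if "x \<in> E J" "V x" for x
    using Cons(3)[OF that] Cons(2)[of g U x] that s by auto
  moreover have "chain J W V g (map (\<lambda>s. (fst (fst s), snd s)) ps)"
  proof (cases "ps = []")
    case True
    then show ?thesis using Cons(5) s by simp
  next
    case False
    show ?thesis
    proof (rule Cons(1))
      show "dfun h \<and> (x \<in> E J \<longrightarrow> V' x \<longrightarrow> cont_at J h x)" if "(h, V') \<in> fst ` set ps" for h V' x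
        using Cons(2)[of h V' x] that by simp
      show "fst (fst (last ps)) = (\<lambda>_. 1)" using Cons(5) False by simp
      show "chain_dom W g ps x" if "x \<in> E J" "V x" for x using Cons(3)[OF that] s by simp
    qed (rule False)
  qed
  ultimately show ?case by (simp add: s)
qed simp

text \<open>Consecutive points of \<open>T\<close> are never both boundary points: between two of them lies their midpoint.\<close>

lemma consecutive:
  assumes W: "\<And>j. j \<in> L \<Longrightarrow> def1 (W j)" and op: "\<And>j t. j \<in> L \<Longrightarrow> t \<in> W j \<Longrightarrow> \<exists>r>0. \<forall>s. \<bar>s - t\<bar> < r \<longrightarrow> s \<in> W j"
    and cov: "\<And>t. 0 \<le> t \<Longrightarrow> t \<le> 1 \<Longrightarrow> \<exists>j\<in>L. t \<in> W j"
    and T: "\<And>a b. a \<in> P \<Longrightarrow> b \<in> P \<Longrightarrow> 0 \<le> (a + b) / 2 \<Longrightarrow> (a + b) / 2 \<le> 1 \<Longrightarrow> (a + b) / 2 \<in> T"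
    and bd: "\<And>j a. j \<in> L \<Longrightarrow> a \<in> bd (W j) \<Longrightarrow> 0 \<le> a \<Longrightarrow> a \<le> 1 \<Longrightarrow> a \<in> P"
    and cd: "0 \<le> c" "c < d" "d \<le> 1" "\<And>e. e \<in> T \<Longrightarrow> \<not> (c < e \<and> e < d)"
  shows "\<exists>j\<in>L. \<forall>t. c \<le> t \<and> t \<le> d \<longrightarrow> t \<in> W j"
proof -
  have PT: "a \<in> T" if "a \<in> P" "0 \<le> a" "a \<le> 1" for a using T[of a a] that by simp
  have nb: "a \<notin> bd (W j)" if "j \<in> L" "c < a" "a < d" for a j
    using bd[OF that(1), of a] PT[of a] cd(4)[of a] that cd(1,3) by auto
  have one: "c \<notin> bd (W j) \<or> d \<notin> bd (W i)" if "j \<in> L" "i \<in> L" for i j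
  proof (rule ccontr)
    assume "\<not> ?thesis"
    then have "c \<in> P" "d \<in> P" using bd that cd(1-3) by auto
    from T[OF this] have "(c + d) / 2 \<in> T" using cd(1-3) by simp
    then show False using cd(4)[of "(c + d) / 2"] cd(2) by simp
  qed
  have mem: "\<forall>t. c \<le> t \<and> t \<le> d \<longrightarrow> t \<in> W j"
    if j: "j \<in> L" and e: "e \<in> {c, d}" "e \<in> W j" and o: "\<And>z. z \<in> {c, d} \<Longrightarrow> z \<noteq> e \<Longrightarrow> z \<notin> bd (W j)" for j e
  proof -
    obtain r where r: "r > 0" "\<And>s. \<bar>s - e\<bar> < r \<Longrightarrow> s \<in> W j" using op[OF j e(2)] by blast
    have "e \<notin> bd (W j)" by (rule not_bdI[OF r(1)]) (use r(2) in blast)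
    then have no: "z \<notin> bd (W j)" if "c \<le> z" "z \<le> d" for z
      using nb[OF j, of z] o[of z] that e(1) by (cases "z = c"; cases "z = d"; auto)
    show ?thesis
    proof (intro allI impI)
      fix t assume t: "c \<le> t \<and> t \<le> d"
      show "t \<in> W j"
      proof (cases "e = c")
        case True
        then show ?thesis using no_bd_iff[OF W[OF j], of c t] no t e(2) by auto
      next
        case False
        then have "e = d" using e(1) by simp
        then show ?thesis using no_bd_iff[OF W[OF j], of t d] no t e(2) by auto
      qed
    qed
  qed
  obtain j where j: "j \<in> L" "c \<in> W j" using cov[of c] cd by auto
  obtain i where i: "i \<in> L" "d \<in> W i" using cov[of d] cd by auto
  show ?thesis
  proof (cases "d \<in> bd (W j)")
    case False
    then show ?thesis using mem[OF j(1) _ j(2)] j(1) by auto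
  next
    \<comment> \<open>The set \<open>W j\<close> containing \<open>c\<close> has \<open>d\<close> on
      its boundary; then \<open>c\<close> is not on the boundary of \<open>W i\<close>, which
      contains \<open>d\<close>, and \<open>W i\<close> serves instead.\<close>
    case True
    then have "c \<notin> bd (W i)" using one[OF i(1) j(1)] by blast
    then show ?thesis using mem[OF i(1) _ i(2)] i(1) by auto
  qed
qed

text \<open>All lists of bounded length over finitely many time functions and indices are
  candidates, so there are finitely many domains. At a given \<open>x\<close> the values of the time
  functions in increasing order form a subdivision, and one of the domains contains
  \<open>x\<close>.\<close>

lemma covering:
  assumes J: "finite J" and L: "finite L" and W: "\<And>j. j \<in> L \<Longrightarrow> dfam (W j)" and op: "\<And>j. j \<in> L \<Longrightarrow> open_fam J (W j)"
    and X: "X \<subseteq> E J" and cov: "\<And>x t. x \<in> X \<Longrightarrow> 0 \<le> t \<Longrightarrow> t \<le> 1 \<Longrightarrow> \<exists>j\<in>L. t \<in> W j x"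
  obtains C where "finite C" "\<And>U ps. (U, ps) \<in> C \<Longrightarrow> dpred U" "\<And>U ps x. (U, ps) \<in> C \<Longrightarrow> x \<in> E J \<Longrightarrow> U x \<Longrightarrow> nbhd J U x"
    "\<And>U ps. (U, ps) \<in> C \<Longrightarrow> chain J W U (\<lambda>_. 0) ps" "\<And>U ps. (U, ps) \<in> C \<Longrightarrow> snd ` set ps \<subseteq> L"
    "\<And>x. x \<in> X \<Longrightarrow> \<exists>U ps. (U, ps) \<in> C \<and> U x"
proof -
  define A where "A x = {t. \<exists>j\<in>L. t \<in> bd (W j x)}" for x
  have A: "dfam A" unfolding A_def
    by (intro dfam_Collect dpred_bex_finite L dfam_mem[OF dfam_bd[OF W]] d_intros)
  have fin: "finite (A x)" for x
  proof -
    have "A x = (\<Union>j\<in>L. bd (W j x))" by (auto simp: A_def)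
    then show ?thesis using L finite_bd[OF def1_fam[OF W]] by auto
  qed
  have UF: "uniformly_finite J" and PC: "piecewise_cont J" using tameness[OF J] by auto
  obtain G0 where G0: "finite G0" "\<And>g. g \<in> G0 \<Longrightarrow> dfun g" "\<And>x u. x \<in> E J \<Longrightarrow> u \<in> A x \<Longrightarrow> \<exists>g\<in>G0. u = g x"
    by (rule uniformly_finiteE[OF UF A fin]) (rule that)
  define good where "good G g \<longleftrightarrow> finite G \<and> (\<forall>(h, U)\<in>G. dfun h \<and> dpred U \<and> (\<forall>x\<in>E J. U x \<longrightarrow> cont_at J h x \<and> nbhd J U x)) \<and>
    (\<forall>x\<in>E J. \<exists>(h, U)\<in>G. U x \<and> g x = h x)" for G g
  have "\<forall>g\<in>G0. \<exists>G. good G g" unfolding good_def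
    using PC[unfolded piecewise_cont_def, rule_format] G0(2) by blast
  from bchoice[OF this] obtain F where F: "\<forall>g\<in>G0. good (F g) g" ..
  \<comment> \<open>The ends 0 and 1 are treated like boundary points; the remaining pairs are the
    continuous pieces of the boundary functions.\<close>
  define P where "P = {(\<lambda>_. 0, \<lambda>_. True), (\<lambda>_. 1, \<lambda>_. True)} \<union> (\<Union>g\<in>G0. F g)"
  have "finite P" unfolding P_def using G0(1) F by (auto simp: good_def)
  have cc: "cont_at J (\<lambda>_. c) x" "nbhd J (\<lambda>_. True) x" for x and c :: 'a
    unfolding cont_at_def nbhd_def by (auto intro!: exI[of _ 1])
  have PP: "dfun g \<and> dpred U \<and> (\<forall>x\<in>E J. U x \<longrightarrow> cont_at J g x \<and> nbhd J U x)" if "(g, U) \<in> P" for g U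
  proof -
    from that consider "g = (\<lambda>_. 0)" "U = (\<lambda>_. True)" | "g = (\<lambda>_. 1)" "U = (\<lambda>_. True)" | k where "k \<in> G0" "(g, U) \<in> F k"
      unfolding P_def by blast
    then show ?thesis
    proof cases
      case (3 k)
      then have "good (F k) k" using F by blast
      then show ?thesis using 3(2) unfolding good_def by blast
    qed (simp_all add: cc dfun_const dpred_const)
  qed
  define mid :: "((nat \<Rightarrow> 'a) \<Rightarrow> 'a) \<times> ((nat \<Rightarrow> 'a) \<Rightarrow> bool) \<Rightarrow> ((nat \<Rightarrow> 'a) \<Rightarrow> 'a) \<times> ((nat \<Rightarrow> 'a) \<Rightarrow> bool) \<Rightarrow> _"
    where "mid p q = (\<lambda>x. (fst p x + fst q x) / 2, \<lambda>x. snd p x \<and> snd q x)" for p q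
  \<comment> \<open>Pairs with equal components return the functions of \<open>P\<close>, so
    \<open>Th\<close> contains these together with the midpoints required by
    \<open>consecutive\<close>.\<close>
  define Th where "Th = (\<lambda>(p, q). mid p q) ` (P \<times> P)"
  have Thf: "finite Th" unfolding Th_def using \<open>finite P\<close> by simp
  have Th: "dfun g \<and> dpred U \<and> (\<forall>x\<in>E J. U x \<longrightarrow> cont_at J g x \<and> nbhd J U x)" if "(g, U) \<in> Th" for g U
  proof -
    obtain g1 U1 g2 U2 where *: "(g1, U1) \<in> P" "(g2, U2) \<in> P" "g = (\<lambda>x. (g1 x + g2 x) / 2)" "U = (\<lambda>x. U1 x \<and> U2 x)"
      using \<open>(g, U) \<in> Th\<close> unfolding Th_def mid_def by auto
    note a = PP[OF *(1)] and b = PP[OF *(2)]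
    have "dfun g" "dpred U" unfolding * using a b by (auto intro: d_intros)
    moreover have "cont_at J g x \<and> nbhd J U x" if x: "x \<in> E J" "U x" for x
    proof
      have c: "cont_at J g1 x" "cont_at J g2 x" and n: "nbhd J U1 x" "nbhd J U2 x"
        using a b x unfolding * by blast+
      show "nbhd J U x" unfolding * by (rule nbhd_conj[OF n])
      show "cont_at J g x" unfolding cont_at_def
      proof (intro allI impI)
        fix \<epsilon> :: 'a assume "\<epsilon> > 0"
        then have "nbhd J (\<lambda>y. \<bar>g1 y - g1 x\<bar> < \<epsilon>) x" "nbhd J (\<lambda>y. \<bar>g2 y - g2 x\<bar> < \<epsilon>) x"
          using c unfolding cont_at_def nbhd_def by blast+
        from nbhd_conj[OF this] have "nbhd J (\<lambda>y. \<bar>g y - g x\<bar> < \<epsilon>) x"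
        proof (rule nbhd_mono)
          fix y assume y: "\<bar>g1 y - g1 x\<bar> < \<epsilon> \<and> \<bar>g2 y - g2 x\<bar> < \<epsilon>"
          have "g y - g x = ((g1 y - g1 x) + (g2 y - g2 x)) / 2" unfolding * by (simp add: field_simps)
          then show "\<bar>g y - g x\<bar> < \<epsilon>" using y by (auto simp: abs_less_iff)
        qed
        then show "\<exists>r>0. \<forall>y\<in>bx J x r. \<bar>g y - g x\<bar> < \<epsilon>" unfolding nbhd_def .
      qed
    qed
    ultimately show ?thesis by blast
  qed
  define one :: "((nat \<Rightarrow> 'a) \<Rightarrow> 'a) \<times> ((nat \<Rightarrow> 'a) \<Rightarrow> bool)" where "one = (\<lambda>_. 1, \<lambda>_. True)"
  \<comment> \<open>At one point there are at most \<open>card Th\<close> distinct times, hence the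
    bound on the length. The last step always ends at the constant 1, defined everywhere.\<close>
  define Q where "Q = (\<lambda>(ps, j). ps @ [(one, j)]) ` ({ps. set ps \<subseteq> Th \<times> L \<and> length ps \<le> card Th} \<times> L)"
  have Qf: "finite Q" unfolding Q_def using finite_lists_length_le[of "Th \<times> L" "card Th"] Thf L by auto
  have Q: "fst ` set ps \<subseteq> insert one Th" "snd ` set ps \<subseteq> L" "ps \<noteq> []" "fst (last ps) = one" if "ps \<in> Q" for ps
    using that unfolding Q_def by auto
  have Q1: "dfun g \<and> dpred U \<and> (\<forall>x\<in>E J. U x \<longrightarrow> cont_at J g x \<and> nbhd J U x)" if "(g, U) \<in> fst ` set ps" "ps \<in> Q" for g U ps
  proof (cases "(g, U) = one")
    case True
    then show ?thesis by (simp add: one_def cc dfun_const dpred_const)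
  next
    case False
    then show ?thesis using Th Q(1)[OF that(2)] that(1) by blast
  qed
  define C where "C = (\<lambda>ps. (chain_dom W (\<lambda>_. 0) ps, map (\<lambda>s. (fst (fst s), snd s)) ps)) ` Q"
  show ?thesis
  proof (rule that[of C])
    show "finite C" unfolding C_def using Qf by simp
    fix U qs assume "(U, qs) \<in> C"
    then obtain ps where ps: "ps \<in> Q" "U = chain_dom W (\<lambda>_. 0) ps" "qs = map (\<lambda>s. (fst (fst s), snd s)) ps"
      unfolding C_def by blast
    have WL: "dfam (W j) \<and> open_fam J (W j)" if "j \<in> snd ` set ps" for j using that Q(2)[OF ps(1)] W op by blast
    show "dpred U" unfolding ps(2) by (rule dpred_chain_dom) (use WL Q1[OF _ ps(1)] dfun_const in blast)+
    show "snd ` set qs \<subseteq> L" unfolding ps(3) using Q(2)[OF ps(1)] by auto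
    show "chain J W U (\<lambda>_. 0) qs" unfolding ps(3)
    proof (rule chain_dom_chain)
      show "dfun g \<and> (x \<in> E J \<longrightarrow> V x \<longrightarrow> cont_at J g x)" if "(g, V) \<in> fst ` set ps" for g V x
        using Q1[OF that ps(1)] by blast
      show "fst (fst (last ps)) = (\<lambda>_. 1)" using Q(4)[OF ps(1)] by (simp add: one_def)
    qed (use ps(2) Q(3)[OF ps(1)] in auto)
    show "nbhd J U x" if x: "x \<in> E J" "U x" for x
      unfolding ps(2)
    proof (rule chain_dom_open[OF J x(1) WL])
      show "cont_at J g z \<and> nbhd J V z" if "(g, V) \<in> fst ` set ps" "z \<in> E J" "V z" for g V z
        using Q1[OF that(1) ps(1)] that(2,3) by blast
    qed (use cc x(2) ps(2) in auto)
  next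
    fix x assume x: "x \<in> X"
    then have xE: "x \<in> E J" using X by blast
    define T where "T = {g x | g U. (g, U) \<in> Th \<and> U x \<and> 0 \<le> g x \<and> g x \<le> 1}"
    define Px where "Px = {g x | g U. (g, U) \<in> P \<and> U x}"
    have "T \<subseteq> (\<lambda>p. fst p x) ` Th" unfolding T_def by force
    then have Tf: "finite T" and Tc: "card T \<le> card Th"
      using Thf finite_subset card_mono card_image_le order_trans by (blast, metis finite_imageI)
    have mT: "(a + b) / 2 \<in> T" if ab: "a \<in> Px" "b \<in> Px" "0 \<le> (a + b) / 2" "(a + b) / 2 \<le> 1" for a b
    proof -
      obtain g U h V where *: "(g, U) \<in> P" "U x" "a = g x" "(h, V) \<in> P" "V x" "b = h x"
        using ab(1,2) unfolding Px_def by blast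
      have "mid (g, U) (h, V) \<in> Th" unfolding Th_def using *(1,4) by force
      then have "((\<lambda>x. (g x + h x) / 2), (\<lambda>x. U x \<and> V x)) \<in> Th" by (simp add: mid_def)
      then show ?thesis unfolding T_def using * ab(3,4)
        by (intro CollectI exI[of _ "\<lambda>x. (g x + h x) / 2"] exI[of _ "\<lambda>x. U x \<and> V x"]) simp
    qed
    have "1 \<in> Px" unfolding Px_def P_def
      by (rule CollectI, rule exI[of _ "\<lambda>_. 1"], rule exI[of _ "\<lambda>_. True"]) simp
    moreover have "0 \<in> Px" unfolding Px_def P_def
      by (rule CollectI, rule exI[of _ "\<lambda>_. 0"], rule exI[of _ "\<lambda>_. True"]) simp
    ultimately have T1: "1 \<in> T" "0 \<in> T" using mT[of 1 1] mT[of 0 0] by simp_all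
    have bdP: "a \<in> Px" if "j \<in> L" "a \<in> bd (W j x)" for j a
    proof -
      have "a \<in> A x" unfolding A_def using that by blast
      then obtain g where g: "g \<in> G0" "a = g x" using G0(3)[OF xE] by blast
      then have "good (F g) g" using F by blast
      then obtain h U where "(h, U) \<in> F g" "U x" "g x = h x" using xE unfolding good_def by blast
      then show ?thesis unfolding Px_def P_def using g by blast
    qed
    have cons: "\<exists>j\<in>L. \<forall>t. c \<le> t \<and> t \<le> d \<longrightarrow> t \<in> W j x"
      if cd: "c \<in> T" "c < d" "d \<in> T" "\<And>e. e \<in> T \<Longrightarrow> \<not> (c < e \<and> e < d)" for c d
    proof (rule consecutive[where T = T and P = Px])
      show "\<exists>r>0. \<forall>s. \<bar>s - t\<bar> < r \<longrightarrow> s \<in> W j x" if jt: "j \<in> L" "t \<in> W j x" for j t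
      proof -
        obtain r where "r > 0" "\<And>y s. y \<in> bx J x r \<Longrightarrow> \<bar>s - t\<bar> < r \<Longrightarrow> s \<in> W j y"
          by (rule open_famD[OF op[OF jt(1)] xE jt(2)]) (rule that)
        then show ?thesis using self_in_bx[OF _ xE] by blast
      qed
      show "0 \<le> c" "d \<le> 1" using cd unfolding T_def by auto
    qed (use def1_fam[OF W] cov[OF x] mT bdP cd in auto)
    \<comment> \<open>Walk from \<open>c\<close> to the next larger time until 1 is reached. The
      number of times still ahead decreases and bounds the length of the list.\<close>
    have "\<exists>ps j. set ps \<subseteq> Th \<times> L \<and> length ps \<le> card {e \<in> T. c < e} \<and> j \<in> L \<and> chain_dom W (\<lambda>_. c) (ps @ [(one, j)]) x"
      if "c \<in> T" "c < 1" for c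
      using that
    proof (induction "card {e \<in> T. c < e}" arbitrary: c rule: less_induct)
      case less
      let ?N = "{e \<in> T. c < e}"
      have Nf: "finite ?N" using Tf by simp
      have N1: "1 \<in> ?N" using T1 less(3) by simp
      define d where "d = Min ?N"
      have dN: "d \<in> ?N" unfolding d_def using Nf N1 by (intro Min_in) blast+
      have dm: "d \<le> e" if "e \<in> ?N" for e unfolding d_def using Nf that by simp
      obtain j where j: "j \<in> L" "\<forall>t. c \<le> t \<and> t \<le> d \<longrightarrow> t \<in> W j x"
        using cons[of c d] less(2) dN dm by fastforce
      show ?case
      proof (cases "d = 1")
        case True
        then show ?thesis using j less(3) by (intro exI[of _ "[]"] exI[of _ j]) (simp add: one_def)
      next
        case False
        then have "d < 1" using dm[OF N1] by simp
        obtain g U where gU: "(g, U) \<in> Th" "U x" "d = g x" using dN unfolding T_def by blast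
        have "{e \<in> T. d < e} \<subset> ?N" using dN by auto
        then have lt: "card {e \<in> T. d < e} < card ?N" using Nf by (intro psubset_card_mono)
        from less(1)[OF this _ \<open>d < 1\<close>] dN obtain ps i where ps: "set ps \<subseteq> Th \<times> L"
          "length ps \<le> card {e \<in> T. d < e}" "i \<in> L" "chain_dom W (\<lambda>_. d) (ps @ [(one, i)]) x" by blast
        have "chain_dom W g (ps @ [(one, i)]) x" by (rule chain_dom_cong[of g x "\<lambda>_. d", OF gU(3)[symmetric], THEN iffD2, OF ps(4)])
        then have "chain_dom W (\<lambda>_. c) ((((g, U), j) # ps) @ [(one, i)]) x"
          using gU j(2) dN by simp
        moreover have "set (((g, U), j) # ps) \<subseteq> Th \<times> L" using gU(1) j(1) ps(1) by simp
        moreover have "length (((g, U), j) # ps) \<le> card ?N" using ps(2) lt by simp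
        ultimately show ?thesis using ps(3) by blast
      qed
    qed
    from this[OF T1(2) zero_less_one] obtain ps j where ps: "set ps \<subseteq> Th \<times> L" "length ps \<le> card {e \<in> T. 0 < e}"
      "j \<in> L" "chain_dom W (\<lambda>_. 0) (ps @ [(one, j)]) x" by blast
    have "card {e \<in> T. 0 < e} \<le> card T" using Tf by (intro card_mono) auto
    then have "ps @ [(one, j)] \<in> Q" unfolding Q_def using ps(1-3) Tc by force
    then show "\<exists>U ps. (U, ps) \<in> C \<and> U x" unfolding C_def using ps(4) by blast
  qed
qed

end

section \<open>Continuity and definable maps\<close>

lemma Rn_eq_E: "Rn n = E {..<n}"
  by (auto simp: PiE_def)

lemma open_abs_ball:
  fixes x :: "'a::{linordered_field, linorder_topology}"
  assumes "open U" "x \<in> U"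
  obtains r where "r > 0" "\<And>y. \<bar>y - x\<bar> < r \<Longrightarrow> y \<in> U"
proof -
  obtain b where b: "b > x" "{x..<b} \<subseteq> U" using open_right[OF assms, of "x + 1"] by auto
  obtain a where a: "a < x" "{a<..x} \<subseteq> U" using open_left[OF assms, of "x - 1"] by auto
  show ?thesis
  proof (rule that[of "min (b - x) (x - a)"])
    show "y \<in> U" if "\<bar>y - x\<bar> < min (b - x) (x - a)" for y
      using that a b by (cases "x \<le> y") (auto simp: subset_iff)
  qed (use a b in simp)
qed

lemma openin_product_cubes:
  fixes U :: "(nat \<Rightarrow> 'a::{linordered_field, linorder_topology}) set"
  assumes J: "finite J"
  shows "openin (product_topology (\<lambda>_. euclidean) J) U \<longleftrightarrow> U \<subseteq> E J \<and> (\<forall>x\<in>U. \<exists>r>0. bx J x r \<subseteq> U)"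
    (is "?l \<longleftrightarrow> ?r")
proof
  assume l: ?l
  have UE: "U \<subseteq> E J" using openin_subset[OF l] by (auto simp: PiE_def)
  moreover have "\<exists>r>0. bx J x r \<subseteq> U" if "x \<in> U" for x
  proof -
    obtain V where V: "\<And>i. i \<in> J \<Longrightarrow> open (V i)" "x \<in> Pi\<^sub>E J V" "Pi\<^sub>E J V \<subseteq> U"
      using l \<open>x \<in> U\<close> unfolding openin_product_topology_alt by (metis open_openin)
    have "\<exists>r>0. \<forall>y\<in>bx J x r. y i \<in> V i" if i: "i \<in> J" for i
    proof -
      have "x i \<in> V i" using V(2) i by (auto simp: PiE_def)
      then obtain r where "r > 0" "\<And>z. \<bar>z - x i\<bar> < r \<Longrightarrow> z \<in> V i" using open_abs_ball[OF V(1)[OF i]] by metis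
      then show ?thesis using i by (intro exI[of _ r]) (auto simp: bx_def)
    qed
    from common_radius[where P = "\<lambda>i y. y i \<in> V i", OF J this] obtain r where "r > 0" "\<forall>i\<in>J. \<forall>y\<in>bx J x r. y i \<in> V i" by blast
    then have "bx J x r \<subseteq> Pi\<^sub>E J V" by (auto simp: PiE_def bx_def extensional_def)
    with V(3) \<open>r > 0\<close> show ?thesis by blast
  qed
  ultimately show ?r by blast
next
  assume r: ?r
  show ?l unfolding openin_product_topology_alt
  proof
    fix x assume x: "x \<in> U"
    then obtain r where "r > 0" "bx J x r \<subseteq> U" using r by blast
    moreover have "Pi\<^sub>E J (\<lambda>i. {x i - r<..<x i + r}) = bx J x r"
      by (auto simp: PiE_def bx_def abs_less_iff algebra_simps)
    moreover have "x \<in> E J" using r x by blast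
    ultimately show "\<exists>V. finite {i \<in> J. V i \<noteq> topspace euclidean} \<and> (\<forall>i\<in>J. openin euclidean (V i)) \<and>
        x \<in> Pi\<^sub>E J V \<and> Pi\<^sub>E J V \<subseteq> U"
      using J self_in_bx[of r x J] by (intro exI[of _ "\<lambda>i. {x i - r<..<x i + r}"]) auto
  qed
qed

lemma cat_in_E: "y \<in> E {..<m} \<Longrightarrow> cat n x y \<in> E {..<n + m}"
  by (auto simp: cat_def extensional_def)

lemma restrict_cat: "x \<in> E {..<n} \<Longrightarrow> restrict (cat n x y) {..<n} = x"
  by (auto simp: cat_def extensional_def fun_eq_iff)

lemma cat_nth_ge [simp]: "cat n x y (n + i) = y i"
  by (simp add: cat_def)

lemma cat_inject: "x \<in> E {..<n} \<Longrightarrow> x' \<in> E {..<n} \<Longrightarrow> cat n x y = cat n x' y' \<longleftrightarrow> x = x' \<and> y = y'"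
  by (metis cat_nth_ge ext restrict_cat)

lemma cat_restrict: "z \<in> E {..<n + m} \<Longrightarrow> cat n (restrict z {..<n}) (\<lambda>i. if i < m then z (n + i) else undefined) = z"
  by (auto simp: cat_def extensional_def fun_eq_iff)

lemma cat_vec1: "x \<in> E {..<n} \<Longrightarrow> cat n x (vec1 t) = x(n := t)"
  by (auto simp: cat_def vec1_def extensional_def fun_eq_iff)

lemma restrict_upd: "x \<in> E {..<n} \<Longrightarrow> restrict (x(n := t)) {..<n} = x"
  by (auto simp: extensional_def fun_eq_iff)

lemma pts_prod_I:
  assumes "pts A \<subseteq> E {..<dim A}"
  shows "pts (A \<otimes> unit_I) = {x(dim A := t) | x t. x \<in> pts A \<and> 0 \<le> t \<and> t \<le> 1}"
proof -
  have "pts (A \<otimes> unit_I) = {cat (dim A) x (vec1 t) | x t. x \<in> pts A \<and> 0 \<le> t \<and> t \<le> 1}"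
    by (force simp: rprod_def unit_I_def)
  also have "\<dots> = {x(dim A := t) | x t. x \<in> pts A \<and> 0 \<le> t \<and> t \<le> 1}"
    using assms cat_vec1 by (metis (no_types, opaque_lifting) subsetD)
  finally show ?thesis .
qed

lemma dim_prod_I [simp]: "dim (A \<otimes> unit_I) = Suc (dim A)"
  by (simp add: rprod_def unit_I_def)

section \<open>Definable sets and continuity within a subset\<close>

context o_minimal_expansion begin

definition dset :: "nat set \<Rightarrow> (nat \<Rightarrow> 'a) set \<Rightarrow> bool" where
  "dset J S \<longleftrightarrow> (\<exists>P. dpred P \<and> S = {x \<in> E J. P x})"

lemma dset_subset: "dset J S \<Longrightarrow> S \<subseteq> E J"
  by (auto simp: dset_def)

lemma dset_mem:
  assumes "dset J S" "dvec v" "\<And>e. v e \<in> E J"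
  shows "dpred (\<lambda>e. v e \<in> S)"
  using assms dpred_comp[OF _ assms(2)] by (auto simp: dset_def)

lemma definable_iff_dset: "definable M A \<longleftrightarrow> dset {..<dim A} (pts A)"
proof
  assume "definable M A"
  then obtain \<phi> where "pts A = {x \<in> E {..<dim A}. sat M x \<phi>}" unfolding definable_def Rn_eq_E by blast
  then show "dset {..<dim A} (pts A)" unfolding dset_def dpred_def by (intro exI[of _ "\<lambda>x. sat M x \<phi>"]) auto
next
  assume "dset {..<dim A} (pts A)"
  then obtain P \<phi> where "\<And>e. sat M e \<phi> = P e" "pts A = {x \<in> E {..<dim A}. P x}"
    unfolding dset_def dpred_def by blast
  then show "definable M A" unfolding definable_def Rn_eq_E by (intro exI[of _ \<phi>]) simp
qed

lemma dvec_restrict: "dvec v \<Longrightarrow> dvec (\<lambda>e. restrict (v e) K)"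
proof (rule dvecI)
  fix i assume "dvec v" then show "dfun (\<lambda>e. restrict (v e) K i)"
    by (cases "i \<in> K") (auto simp: dvec_def dfun_const)
qed

lemma dvec_cat: "dvec v \<Longrightarrow> dvec w \<Longrightarrow> dvec (\<lambda>e. cat n (v e) (w e))"
proof (rule dvecI)
  fix i assume "dvec v" "dvec w" then show "dfun (\<lambda>e. cat n (v e) (w e) i)"
    by (cases "i < n") (auto simp: dvec_def cat_def)
qed

text \<open>Total spaces and bases are arbitrary definable sets, so maps on them are continuous only
  relative to \<open>S\<close>, not on full neighbourhoods as in \<open>cont_at\<close>.\<close>

definition cw :: "nat set \<Rightarrow> (nat \<Rightarrow> 'a) set \<Rightarrow> ((nat \<Rightarrow> 'a) \<Rightarrow> 'a) \<Rightarrow> (nat \<Rightarrow> 'a) \<Rightarrow> bool" where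
  "cw J S g x \<longleftrightarrow> (\<forall>\<epsilon>>0. nbhd J (\<lambda>y. y \<in> S \<longrightarrow> \<bar>g y - g x\<bar> < \<epsilon>) x)"

definition vcw :: "nat set \<Rightarrow> (nat \<Rightarrow> 'a) set \<Rightarrow> nat set \<Rightarrow> ((nat \<Rightarrow> 'a) \<Rightarrow> nat \<Rightarrow> 'a) \<Rightarrow> (nat \<Rightarrow> 'a) \<Rightarrow> bool" where
  "vcw J S K f x \<longleftrightarrow> (\<forall>\<epsilon>>0. nbhd J (\<lambda>y. y \<in> S \<longrightarrow> f y \<in> bx K (f x) \<epsilon>) x)"

lemma nbhd_all: "(\<And>y. y \<in> E J \<Longrightarrow> P y) \<Longrightarrow> nbhd J P x"
  unfolding nbhd_def by (intro exI[of _ 1]) (auto dest: subsetD[OF bx_subset_E])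

lemma nbhd_ball: "finite K \<Longrightarrow> (\<And>i. i \<in> K \<Longrightarrow> nbhd J (P i) x) \<Longrightarrow> nbhd J (\<lambda>y. \<forall>i\<in>K. P i y) x"
  by (induction K rule: finite_induct) (auto intro: nbhd_all nbhd_conj)

lemma nbhd_self: "nbhd J P x \<Longrightarrow> x \<in> E J \<Longrightarrow> P x"
  unfolding nbhd_def using self_in_bx by blast

lemma cw_const: "cw J S (\<lambda>_. c) x"
  unfolding cw_def by (auto intro: nbhd_all)

lemma cw_coord: "i \<in> J \<Longrightarrow> cw J S (\<lambda>y. y i) x"
  unfolding cw_def nbhd_def by (auto simp: bx_def)

lemma cw_cont_at: "cont_at J g x \<Longrightarrow> cw J S g x"
  unfolding cw_def cont_at_def nbhd_def by blast

lemma cw_lipschitz2: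
  assumes "cw J S f x" "cw J S g x" and h: "\<And>a b c d. \<bar>h a b - h c d\<bar> \<le> \<bar>a - c\<bar> + \<bar>b - d\<bar>"
  shows "cw J S (\<lambda>y. h (f y) (g y)) x"
  unfolding cw_def
proof (intro allI impI)
  fix \<epsilon> :: 'a assume "\<epsilon> > 0"
  then have h2: "\<epsilon> / 2 > 0" by simp
  have "nbhd J (\<lambda>y. y \<in> S \<longrightarrow> \<bar>f y - f x\<bar> < \<epsilon> / 2) x" "nbhd J (\<lambda>y. y \<in> S \<longrightarrow> \<bar>g y - g x\<bar> < \<epsilon> / 2) x"
    using assms(1,2)[unfolded cw_def, rule_format, OF h2] .
  from nbhd_conj[OF this] show "nbhd J (\<lambda>y. y \<in> S \<longrightarrow> \<bar>h (f y) (g y) - h (f x) (g x)\<bar> < \<epsilon>) x"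
  proof (rule nbhd_mono)
    fix y assume *: "(y \<in> S \<longrightarrow> \<bar>f y - f x\<bar> < \<epsilon> / 2) \<and> (y \<in> S \<longrightarrow> \<bar>g y - g x\<bar> < \<epsilon> / 2)"
    show "y \<in> S \<longrightarrow> \<bar>h (f y) (g y) - h (f x) (g x)\<bar> < \<epsilon>"
    proof
      assume "y \<in> S"
      then have "\<bar>f y - f x\<bar> + \<bar>g y - g x\<bar> < \<epsilon> / 2 + \<epsilon> / 2" using * by (intro add_strict_mono) auto
      then show "\<bar>h (f y) (g y) - h (f x) (g x)\<bar> < \<epsilon>" using h[of "f y" "g y" "f x" "g x"] by simp
    qed
  qed
qed

lemma cw_min: "cw J S f x \<Longrightarrow> cw J S g x \<Longrightarrow> cw J S (\<lambda>y. min (f y) (g y)) x"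
  by (rule cw_lipschitz2[where h = min], assumption, assumption, linarith)

lemma cw_max: "cw J S f x \<Longrightarrow> cw J S g x \<Longrightarrow> cw J S (\<lambda>y. max (f y) (g y)) x"
  by (rule cw_lipschitz2[where h = max], assumption, assumption, linarith)

lemma cw_add: "cw J S f x \<Longrightarrow> cw J S g x \<Longrightarrow> cw J S (\<lambda>y. f y + g y) x"
  by (rule cw_lipschitz2[where h = "(+)"], assumption, assumption, linarith)

lemma cw_diff: "cw J S f x \<Longrightarrow> cw J S g x \<Longrightarrow> cw J S (\<lambda>y. f y - g y) x"
  by (rule cw_lipschitz2[where h = "(-)"], assumption, assumption, linarith)

lemma cw_sum: "finite C \<Longrightarrow> (\<And>c. c \<in> C \<Longrightarrow> cw J S (f c) x) \<Longrightarrow> cw J S (\<lambda>y. \<Sum>c\<in>C. f c y) x"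
  by (induction C rule: finite_induct) (auto intro: cw_const cw_add)

lemma cw_cmult:
  assumes "cw J S f x" "c > 0"
  shows "cw J S (\<lambda>y. c * f y) x"
  unfolding cw_def
proof (intro allI impI)
  fix \<epsilon> :: 'a assume "\<epsilon> > 0"
  then have "nbhd J (\<lambda>y. y \<in> S \<longrightarrow> \<bar>f y - f x\<bar> < \<epsilon> / c) x"
    using assms unfolding cw_def by auto
  then show "nbhd J (\<lambda>y. y \<in> S \<longrightarrow> \<bar>c * f y - c * f x\<bar> < \<epsilon>) x"
  proof (rule nbhd_mono)
    fix y assume "y \<in> S \<longrightarrow> \<bar>f y - f x\<bar> < \<epsilon> / c"
    then have "y \<in> S \<longrightarrow> c * \<bar>f y - f x\<bar> < \<epsilon>"
      using assms(2) by (simp add: pos_less_divide_eq mult.commute)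
    moreover have "\<bar>c * f y - c * f x\<bar> = c * \<bar>f y - f x\<bar>"
      using assms(2) by (simp only: right_diff_distrib[symmetric] abs_mult abs_of_pos)
    ultimately show "y \<in> S \<longrightarrow> \<bar>c * f y - c * f x\<bar> < \<epsilon>" by simp
  qed
qed

lemma cw_ratio:
  assumes f: "cw J S f x" and g: "cw J S g x" and x: "g x > 0" "0 \<le> f x" "f x \<le> g x"
  shows "cw J S (\<lambda>y. f y / g y) x"
  unfolding cw_def
proof (intro allI impI)
  fix \<epsilon> :: 'a assume \<epsilon>: "\<epsilon> > 0"
  \<comment> \<open>The first bound keeps \<open>g y\<close> above \<open>g x / 2\<close>; the
    second brings the final estimate \<open>2 * \<eta> / g y\<close> below
    \<open>\<epsilon>\<close>.\<close>
  define \<eta> where "\<eta> = min (g x / 2) (\<epsilon> * g x / 4)"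
  have \<eta>: "\<eta> > 0" "\<eta> \<le> g x / 2" "\<eta> \<le> \<epsilon> * g x / 4" using x \<epsilon> by (auto simp: \<eta>_def)
  have "nbhd J (\<lambda>y. y \<in> S \<longrightarrow> \<bar>f y - f x\<bar> < \<eta>) x" "nbhd J (\<lambda>y. y \<in> S \<longrightarrow> \<bar>g y - g x\<bar> < \<eta>) x"
    using f g \<eta>(1) unfolding cw_def by auto
  from nbhd_conj[OF this] show "nbhd J (\<lambda>y. y \<in> S \<longrightarrow> \<bar>f y / g y - f x / g x\<bar> < \<epsilon>) x"
  proof (rule nbhd_mono, intro impI)
    fix y assume "(y \<in> S \<longrightarrow> \<bar>f y - f x\<bar> < \<eta>) \<and> (y \<in> S \<longrightarrow> \<bar>g y - g x\<bar> < \<eta>)" and "y \<in> S"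
    then have fy: "\<bar>f y - f x\<bar> < \<eta>" and gy: "\<bar>g y - g x\<bar> < \<eta>" by auto
    have "g x < g y + \<eta>" using gy by linarith
    then have "g x < g y + g x / 2" using \<eta>(2) by linarith
    then have gy2: "g x / 2 < g y" by simp
    then have gp: "g y > 0" using x(1) by (meson half_gt_zero less_trans)
    have "f y / g y - f x / g x = ((f y - f x) * g x - f x * (g y - g x)) / (g y * g x)"
      using gp x(1) by (simp add: field_simps)
    also have "\<bar>\<dots>\<bar> = \<bar>(f y - f x) * g x - f x * (g y - g x)\<bar> / (g y * g x)"
      using gp x(1) by simp
    also have "\<dots> \<le> (\<eta> * g x + g x * \<eta>) / (g y * g x)"
    proof (rule divide_right_mono)
      have "\<bar>(f y - f x) * g x - f x * (g y - g x)\<bar> \<le> \<bar>f y - f x\<bar> * g x + f x * \<bar>g y - g x\<bar>"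
        using abs_triangle_ineq4[of "(f y - f x) * g x" "f x * (g y - g x)"] x by (simp add: abs_mult)
      also have "\<dots> \<le> \<eta> * g x + g x * \<eta>"
        using fy gy x \<eta>(1) by (intro add_mono mult_mono) auto
      finally show "\<bar>(f y - f x) * g x - f x * (g y - g x)\<bar> \<le> \<eta> * g x + g x * \<eta>" .
    qed (use gp x(1) in simp)
    also have "\<dots> = 2 * \<eta> / g y" using gp x(1) by (simp add: field_simps)
    also have "\<dots> < \<epsilon>"
    proof -
      have "2 * \<eta> \<le> \<epsilon> * (g x / 2)" using \<eta>(3) by (simp add: field_simps)
      also have "\<dots> < \<epsilon> * g y" using gy2 \<epsilon> by (rule mult_strict_left_mono)
      finally show ?thesis using gp by (simp add: pos_divide_less_eq)
    qed
    finally show "\<bar>f y / g y - f x / g x\<bar> < \<epsilon>" .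
  qed
qed

lemma vcw_coords:
  assumes "finite K" "\<And>y. y \<in> S \<Longrightarrow> f y \<in> E K" "\<And>i. i \<in> K \<Longrightarrow> cw J S (\<lambda>y. f y i) x"
  shows "vcw J S K f x"
  unfolding vcw_def
proof (intro allI impI)
  fix \<epsilon> :: 'a assume "\<epsilon> > 0"
  then have "nbhd J (\<lambda>y. \<forall>i\<in>K. y \<in> S \<longrightarrow> \<bar>f y i - f x i\<bar> < \<epsilon>) x"
    using assms by (intro nbhd_ball) (auto simp: cw_def)
  then show "nbhd J (\<lambda>y. y \<in> S \<longrightarrow> f y \<in> bx K (f x) \<epsilon>) x"
    by (rule nbhd_mono) (use assms(2) in \<open>auto simp: bx_def\<close>)
qed

lemma vcw_coordD: "vcw J S K f x \<Longrightarrow> i \<in> K \<Longrightarrow> cw J S (\<lambda>y. f y i) x"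
  unfolding vcw_def cw_def by (auto simp: bx_def elim!: nbhd_mono)

lemma cw_comp:
  assumes f: "vcw J S K f x" and g: "cw K S' g (f x)" and m: "\<And>y. y \<in> S \<Longrightarrow> f y \<in> S'"
  shows "cw J S (\<lambda>y. g (f y)) x"
  unfolding cw_def
proof (intro allI impI)
  fix \<epsilon> :: 'a assume "\<epsilon> > 0"
  then obtain r where "r > 0" "\<forall>z\<in>bx K (f x) r. z \<in> S' \<longrightarrow> \<bar>g z - g (f x)\<bar> < \<epsilon>"
    using g unfolding cw_def nbhd_def by blast
  moreover have "nbhd J (\<lambda>y. y \<in> S \<longrightarrow> f y \<in> bx K (f x) r) x"
    using f \<open>r > 0\<close> unfolding vcw_def by blast
  ultimately show "nbhd J (\<lambda>y. y \<in> S \<longrightarrow> \<bar>g (f y) - g (f x)\<bar> < \<epsilon>) x"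
    using m by (auto elim!: nbhd_mono)
qed

lemma vcw_comp:
  assumes f: "vcw J S K f x" and g: "vcw K S' L g (f x)" and m: "\<And>y. y \<in> S \<Longrightarrow> f y \<in> S'"
  shows "vcw J S L (\<lambda>y. g (f y)) x"
  unfolding vcw_def
proof (intro allI impI)
  fix \<epsilon> :: 'a assume "\<epsilon> > 0"
  then obtain r where "r > 0" "\<forall>z\<in>bx K (f x) r. z \<in> S' \<longrightarrow> g z \<in> bx L (g (f x)) \<epsilon>"
    using g unfolding vcw_def nbhd_def by blast
  moreover have "nbhd J (\<lambda>y. y \<in> S \<longrightarrow> f y \<in> bx K (f x) r) x"
    using f \<open>r > 0\<close> unfolding vcw_def by blast
  ultimately show "nbhd J (\<lambda>y. y \<in> S \<longrightarrow> g (f y) \<in> bx L (g (f x)) \<epsilon>) x"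
    using m by (auto elim!: nbhd_mono)
qed

lemma nbhd_vcw:
  assumes "vcw J S K f x" "nbhd K (\<lambda>z. z \<in> S' \<longrightarrow> P z) (f x)" "\<And>y. y \<in> S \<Longrightarrow> f y \<in> S'"
  shows "nbhd J (\<lambda>y. y \<in> S \<longrightarrow> P (f y)) x"
proof -
  obtain r where "r > 0" "\<forall>z\<in>bx K (f x) r. z \<in> S' \<longrightarrow> P z" using assms(2) unfolding nbhd_def by blast
  moreover have "nbhd J (\<lambda>y. y \<in> S \<longrightarrow> f y \<in> bx K (f x) r) x"
    using assms(1) \<open>r > 0\<close> unfolding vcw_def by blast
  ultimately show ?thesis using assms(3) by (auto elim!: nbhd_mono)
qed

lemma vcw_cong:
  assumes "nbhd J (\<lambda>y. y \<in> S \<longrightarrow> f y = g y) x" "x \<in> S" "x \<in> E J" "vcw J S K g x"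
  shows "vcw J S K f x"
  unfolding vcw_def
proof (intro allI impI)
  fix \<epsilon> :: 'a assume "\<epsilon> > 0"
  then have "nbhd J (\<lambda>y. y \<in> S \<longrightarrow> g y \<in> bx K (g x) \<epsilon>) x" using assms(4) unfolding vcw_def by blast
  from nbhd_conj[OF assms(1) this] show "nbhd J (\<lambda>y. y \<in> S \<longrightarrow> f y \<in> bx K (f x) \<epsilon>) x"
    by (rule nbhd_mono) (use nbhd_self[OF assms(1,3)] assms(2) in auto)
qed

lemma cw_cong:
  assumes "nbhd J (\<lambda>y. y \<in> S \<longrightarrow> f y = g y) x" "x \<in> S" "x \<in> E J" "cw J S g x"
  shows "cw J S f x"
  unfolding cw_def
proof (intro allI impI)
  fix \<epsilon> :: 'a assume "\<epsilon> > 0"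
  then have "nbhd J (\<lambda>y. y \<in> S \<longrightarrow> \<bar>g y - g x\<bar> < \<epsilon>) x" using assms(4) unfolding cw_def by blast
  from nbhd_conj[OF assms(1) this] show "nbhd J (\<lambda>y. y \<in> S \<longrightarrow> \<bar>f y - f x\<bar> < \<epsilon>) x"
    by (rule nbhd_mono) (use nbhd_self[OF assms(1,3)] assms(2) in auto)
qed

lemma cw_less:
  assumes "cw J S f x" "cw J S g x" "f x < g x"
  shows "nbhd J (\<lambda>y. y \<in> S \<longrightarrow> f y < g y) x"
proof -
  have "nbhd J (\<lambda>y. y \<in> S \<longrightarrow> \<bar>(g y - f y) - (g x - f x)\<bar> < g x - f x) x"
    using cw_diff[OF assms(2,1)] assms(3) unfolding cw_def by simp
  then show ?thesis by (rule nbhd_mono) (auto simp: abs_less_iff)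
qed

section \<open>Topology through cubes, and total versions of definable maps\<close>

lemma topspace_top_of: "pts A \<subseteq> E {..<dim A} \<Longrightarrow> topspace (top_of A) = pts A"
  unfolding top_of_def by (auto simp: PiE_def)

lemma openin_top_of:
  assumes A: "pts A \<subseteq> E {..<dim A}"
  shows "openin (top_of A) U \<longleftrightarrow> U \<subseteq> pts A \<and> (\<forall>x\<in>U. nbhd {..<dim A} (\<lambda>y. y \<in> pts A \<longrightarrow> y \<in> U) x)"
    (is "?l \<longleftrightarrow> ?r")
proof
  assume ?l
  then obtain V where V: "openin (product_topology (\<lambda>_. euclidean) {..<dim A}) V" "U = V \<inter> pts A"
    unfolding top_of_def openin_subtopology by blast
  then show ?r unfolding openin_product_cubes[OF finite_lessThan] nbhd_def by blast
next
  assume r: ?r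
  define V where "V = {y \<in> E {..<dim A}. nbhd {..<dim A} (\<lambda>y. y \<in> pts A \<longrightarrow> y \<in> U) y}"
  have "openin (product_topology (\<lambda>_. euclidean) {..<dim A}) V"
    unfolding openin_product_cubes[OF finite_lessThan]
  proof (intro conjI ballI)
    fix x assume "x \<in> V"
    then have "nbhd {..<dim A} (\<lambda>y. y \<in> pts A \<longrightarrow> y \<in> U) x" by (simp add: V_def)
    from nbhd_nbhd[OF finite_lessThan this]
    obtain s where "s > 0" "\<forall>y\<in>bx {..<dim A} x s. nbhd {..<dim A} (\<lambda>y. y \<in> pts A \<longrightarrow> y \<in> U) y"
      unfolding nbhd_def[of _ "nbhd _ _"] by blast
    then show "\<exists>r>0. bx {..<dim A} x r \<subseteq> V" unfolding V_def using bx_subset_E by blast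
  qed (auto simp: V_def)
  moreover have "x \<in> U" if "x \<in> V" "x \<in> pts A" for x
    using nbhd_self[of "{..<dim A}" "\<lambda>y. y \<in> pts A \<longrightarrow> y \<in> U" x] that by (simp add: V_def)
  moreover have "U \<subseteq> V \<inter> pts A" using r A by (auto simp: V_def)
  ultimately have "openin (product_topology (\<lambda>_. euclidean) {..<dim A}) V" "U = V \<inter> pts A" by blast+
  then show ?l unfolding top_of_def openin_subtopology by blast
qed

lemma continuous_map_top_of:
  assumes A: "pts A \<subseteq> E {..<dim A}" and B: "pts B \<subseteq> E {..<dim B}"
  shows "continuous_map (top_of A) (top_of B) f \<longleftrightarrow>
    (\<forall>x\<in>pts A. f x \<in> pts B \<and> vcw {..<dim A} (pts A) {..<dim B} f x)" (is "?l \<longleftrightarrow> ?r")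
proof
  assume l: ?l
  have fB: "f x \<in> pts B" if "x \<in> pts A" for x
    using l that unfolding continuous_map_def topspace_top_of[OF A] topspace_top_of[OF B] by blast
  moreover have "vcw {..<dim A} (pts A) {..<dim B} f x" if x: "x \<in> pts A" for x
    unfolding vcw_def
  proof (intro allI impI)
    fix \<epsilon> :: 'a assume \<epsilon>: "\<epsilon> > 0"
    have "openin (top_of B) (bx {..<dim B} (f x) \<epsilon> \<inter> pts B)"
      unfolding openin_top_of[OF B] nbhd_def using bx_open[OF finite_lessThan]
      by (metis (no_types, lifting) IntD1 IntI inf_le2 subsetD)
    then have "openin (top_of A) {z \<in> pts A. f z \<in> bx {..<dim B} (f x) \<epsilon> \<inter> pts B}"
      using l unfolding continuous_map_def topspace_top_of[OF A] by blast
    moreover have "f x \<in> bx {..<dim B} (f x) \<epsilon> \<inter> pts B" using fB[OF x] B \<epsilon> self_in_bx by blast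
    ultimately have "nbhd {..<dim A} (\<lambda>y. y \<in> pts A \<longrightarrow> y \<in> {z \<in> pts A. f z \<in> bx {..<dim B} (f x) \<epsilon> \<inter> pts B}) x"
      unfolding openin_top_of[OF A] using x by blast
    then show "nbhd {..<dim A} (\<lambda>y. y \<in> pts A \<longrightarrow> f y \<in> bx {..<dim B} (f x) \<epsilon>) x"
      by (rule nbhd_mono) blast
  qed
  ultimately show ?r by blast
next
  assume r: ?r
  show ?l unfolding continuous_map_def topspace_top_of[OF A] topspace_top_of[OF B]
  proof (intro conjI allI impI)
    show "f \<in> pts A \<rightarrow> pts B" using r by blast
    fix U assume U: "openin (top_of B) U"
    show "openin (top_of A) {x \<in> pts A. f x \<in> U}"
      unfolding openin_top_of[OF A]
    proof (intro conjI ballI)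
      fix x assume x: "x \<in> {x \<in> pts A. f x \<in> U}"
      have "nbhd {..<dim A} (\<lambda>y. y \<in> pts A \<longrightarrow> f y \<in> U) x"
        by (rule nbhd_vcw[where K = "{..<dim B}" and S' = "pts B"])
          (use x r U in \<open>auto simp: openin_top_of[OF B]\<close>)
      then show "nbhd {..<dim A} (\<lambda>y. y \<in> pts A \<longrightarrow> y \<in> {x \<in> pts A. f x \<in> U}) x" by (rule nbhd_mono) blast
    qed blast
  qed
qed

text \<open>The function in a \<open>definable_map\<close> is unconstrained off its domain and hence
  need not be a \<open>dvec\<close>. A total map is definable on all environments with values in
  \<open>E\<close>, so it can be used freely inside formulas; membership and continuity are still
  asked on \<open>pts A\<close> only.\<close>

definition total :: "'a rset \<Rightarrow> 'a rset \<Rightarrow> ((nat \<Rightarrow> 'a) \<Rightarrow> nat \<Rightarrow> 'a) \<Rightarrow> bool" where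
  "total A B g \<longleftrightarrow> dvec g \<and> (\<forall>e. g e \<in> E {..<dim B}) \<and>
    (\<forall>x\<in>pts A. g x \<in> pts B \<and> vcw {..<dim A} (pts A) {..<dim B} g x)"

text \<open>Each coordinate is read off the definable graph through \<open>the1\<close>, which
  supplies default values outside the domain.\<close>

lemma total_version:
  assumes "definable M (graph_of A B f)" "pts A \<subseteq> E {..<dim A}" "\<And>x. x \<in> pts A \<Longrightarrow> f x \<in> E {..<dim B}"
  obtains g where "dvec g" "\<And>e. g e \<in> E {..<dim B}" "\<And>x. x \<in> pts A \<Longrightarrow> g x = f x"
proof -
  define G where "G = pts (graph_of A B f)"
  have G: "dset {..<dim A + dim B} G" using assms(1) unfolding definable_iff_dset G_def by (simp add: graph_of_def)
  have Gi: "cat (dim A) x y \<in> G \<longleftrightarrow> y = f x" if "x \<in> pts A" for x y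
    unfolding G_def graph_of_def using that assms(2) by (auto simp: subset_iff cat_inject)
  define g where "g e i = (if i \<in> {..<dim B} then
    the1 (\<lambda>a. \<exists>y\<in>E {..<dim B}. cat (dim A) (restrict e {..<dim A}) y \<in> G \<and> y i = a) else undefined)" for e i
  show ?thesis
  proof (rule that[of g])
    show "dvec g"
    proof (rule dvecI)
      fix i show "dfun (\<lambda>e. g e i)"
        unfolding g_def
        by (intro dfun_if dfun_the1 d_intros finite_lessThan dset_mem[OF G] dvec_cat dvec_restrict cat_in_E)
    qed
    show "g e \<in> E {..<dim B}" for e by (simp add: g_def extensional_def)
    show "g x = f x" if x: "x \<in> pts A" for x
    proof
      fix i
      have r: "restrict x {..<dim A} = x" using x assms(2) extensional_restrict by blast
      show "g x i = f x i"
      proof (cases "i < dim B")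
        case True
        have "the1 (\<lambda>a. \<exists>y\<in>E {..<dim B}. cat (dim A) x y \<in> G \<and> y i = a) = f x i"
          by (rule the1_equality) (use Gi[OF x] assms(3)[OF x] in auto)
        then show ?thesis using True by (simp add: g_def r)
      next
        case False
        then show ?thesis using assms(3)[OF x] by (simp add: g_def extensional_def)
      qed
    qed
  qed
qed

lemma definable_mapE:
  assumes "definable_map M A B f"
  obtains g where "total A B g" "\<And>x. x \<in> pts A \<Longrightarrow> g x = f x"
proof -
  have A: "pts A \<subseteq> E {..<dim A}" and B: "pts B \<subseteq> E {..<dim B}"
    using assms dset_subset unfolding definable_map_def definable_iff_dset by blast+
  have f: "f x \<in> pts B" "vcw {..<dim A} (pts A) {..<dim B} f x" if "x \<in> pts A" for x
    using assms that unfolding definable_map_def continuous_map_top_of[OF A B] by blast+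
  obtain g where g: "dvec g" "\<And>e. g e \<in> E {..<dim B}" "\<And>x. x \<in> pts A \<Longrightarrow> g x = f x"
    by (rule total_version[of A B f]) (use assms A B f that in \<open>auto simp: definable_map_def\<close>)
  have "vcw {..<dim A} (pts A) {..<dim B} g x" if "x \<in> pts A" for x
    by (rule vcw_cong[OF _ that _ f(2)[OF that]]) (use that A g(3) in \<open>auto intro: nbhd_all\<close>)
  then have "total A B g" unfolding total_def using g f by auto
  then show ?thesis using that g(3) by blast
qed

lemma definable_graph:
  assumes S: "dset {..<dim A} (pts A)" and g: "dvec g" "\<And>e. g e \<in> E {..<dim B}" and fg: "\<And>x. x \<in> pts A \<Longrightarrow> f x = g x"
  shows "definable M (graph_of A B f)"
proof -
  let ?r = "\<lambda>z. restrict z {..<dim A}"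
  let ?P = "\<lambda>z. ?r z \<in> pts A \<and> (\<forall>i\<in>{..<dim B}. z (dim A + i) = g (?r z) i)"
  have "dpred ?P"
    by (intro dpred_conj dpred_ball_finite dset_mem[OF S] dvec_restrict d_intros finite_lessThan
        dfun_nth[OF dvec_comp[OF g(1)]]) auto
  moreover have "pts (graph_of A B f) = {z \<in> E {..<dim A + dim B}. ?P z}"
  proof (intro set_eqI iffI)
    fix z assume "z \<in> pts (graph_of A B f)"
    then obtain x where x: "x \<in> pts A" "z = cat (dim A) x (g x)" unfolding graph_of_def using fg by auto
    then have "?r z = x" using restrict_cat[of x "dim A"] dset_subset[OF S] by blast
    then show "z \<in> {z \<in> E {..<dim A + dim B}. ?P z}" using x cat_in_E[OF g(2)] by auto
  next
    fix z assume z: "z \<in> {z \<in> E {..<dim A + dim B}. ?P z}"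
    have "(\<lambda>i. if i < dim B then z (dim A + i) else undefined) = g (?r z)"
      using z g(2)[of "?r z"] by (auto simp: fun_eq_iff extensional_def)
    then have "cat (dim A) (?r z) (g (?r z)) = z" using z cat_restrict[of z "dim A" "dim B"] by auto
    then show "z \<in> pts (graph_of A B f)" unfolding graph_of_def using z fg by force
  qed
  ultimately show ?thesis unfolding definable_iff_dset dset_def by (auto simp: graph_of_def)
qed

lemma definable_mapI:
  assumes A: "dset {..<dim A} (pts A)" and B: "dset {..<dim B} (pts B)" and g: "total A B g" and fg: "\<And>x. x \<in> pts A \<Longrightarrow> f x = g x"
  shows "definable_map M A B f"
proof -
  note AE = dset_subset[OF A] and BE = dset_subset[OF B]
  have "continuous_map (top_of A) (top_of B) g"
    unfolding continuous_map_top_of[OF AE BE] using g unfolding total_def by blast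
  then have "continuous_map (top_of A) (top_of B) f"
    by (rule continuous_map_eq) (use fg topspace_top_of[OF AE] in auto)
  moreover have "definable M (graph_of A B f)"
    using g fg unfolding total_def by (intro definable_graph[OF A]) auto
  ultimately show ?thesis unfolding definable_map_def definable_iff_dset using A B by blast
qed

lemma dset_prod_I:
  assumes A: "dset {..<dim A} (pts A)"
  shows "dset {..<dim (A \<otimes> unit_I)} (pts (A \<otimes> unit_I))"
proof -
  let ?r = "\<lambda>z. restrict z {..<dim A}"
  let ?P = "\<lambda>z. ?r z \<in> pts A \<and> 0 \<le> z (dim A) \<and> z (dim A) \<le> 1"
  have "dpred ?P"
    by (intro dpred_conj dset_mem[OF A] dvec_restrict d_intros) auto
  moreover have "pts (A \<otimes> unit_I) = {z \<in> E {..<Suc (dim A)}. ?P z}"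
  proof (intro set_eqI iffI)
    fix z assume "z \<in> pts (A \<otimes> unit_I)"
    then obtain x t where x: "x \<in> pts A" "z = x(dim A := t)" "0 \<le> t" "t \<le> 1"
      unfolding pts_prod_I[OF dset_subset[OF A]] by blast
    then have xE: "x \<in> E {..<dim A}" using dset_subset[OF A] by blast
    then show "z \<in> {z \<in> E {..<Suc (dim A)}. ?P z}" using x restrict_upd[OF xE] by (auto simp: extensional_def)
  next
    fix z assume z: "z \<in> {z \<in> E {..<Suc (dim A)}. ?P z}"
    then have "z = (?r z)(dim A := z (dim A))" by (auto simp: extensional_def fun_eq_iff)
    then show "z \<in> pts (A \<otimes> unit_I)" unfolding pts_prod_I[OF dset_subset[OF A]] using z by blast
  qed
  ultimately show ?thesis unfolding dset_def dim_prod_I by blast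
qed

lemma dfun_sum: "finite C \<Longrightarrow> (\<And>c. c \<in> C \<Longrightarrow> dfun (f c)) \<Longrightarrow> dfun (\<lambda>x. \<Sum>c\<in>C. f c x)"
  by (induction C rule: finite_induct) (auto intro: dfun_const dfun_plus)

text \<open>Distance from \<open>x\<close> to the complement of \<open>U\<close> in the sup norm,
  cut off at 1. The element 0 keeps the set nonempty when \<open>U\<close> contains no cube about
  \<open>x\<close>.\<close>

definition inner_dist :: "nat set \<Rightarrow> ((nat \<Rightarrow> 'a) \<Rightarrow> bool) \<Rightarrow> (nat \<Rightarrow> 'a) \<Rightarrow> 'a" where
  "inner_dist J U x = dsup {r. r = 0 \<or> (0 < r \<and> r \<le> 1 \<and> (\<forall>y\<in>bx J x r. U y))}"

lemma inner_dist:
  assumes J: "finite J" and U: "dpred U"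
  shows "dfun (inner_dist J U)" "0 \<le> inner_dist J U x"
    "x \<in> E J \<Longrightarrow> cw J S (inner_dist J U) x" "nbhd J U x \<Longrightarrow> 0 < inner_dist J U x"
    "x \<in> E J \<Longrightarrow> \<not> U x \<Longrightarrow> inner_dist J U x = 0"
proof -
  define R where "R x = {r. r = 0 \<or> (0 < r \<and> r \<le> 1 \<and> (\<forall>y\<in>bx J x r. U y))}" for x
  have R: "dfam R" unfolding R_def by (intro dfam_Collect d_intros J dpred_comp[OF U])
  note R1 = def1_fam[OF R]
  have Rb: "\<forall>r\<in>R x. r \<le> 1" for x unfolding R_def by auto
  have R0: "0 \<in> R x" for x unfolding R_def by simp
  then have ne: "R x \<noteq> {}" for x by blast
  have eq: "inner_dist J U = (\<lambda>x. dsup (R x))" unfolding inner_dist_def R_def by (rule refl)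
  show "dfun (inner_dist J U)" unfolding eq by (rule dfun_dsup[OF R])
  show pos: "0 \<le> inner_dist J U x" for x unfolding eq by (rule dsup_upper[OF R1 R0 Rb])
  show "0 < inner_dist J U x" if nb: "nbhd J U x"
  proof -
    obtain r where r: "r > 0" "\<forall>y\<in>bx J x r. U y" using nb unfolding nbhd_def by blast
    then have "min 1 r \<in> R x" unfolding R_def by auto
    from dsup_upper[OF R1 this Rb] show ?thesis unfolding eq using r(1) by (meson less_le_trans min_less_iff_conj zero_less_one)
  qed
  show "inner_dist J U x = 0" if x: "x \<in> E J" "\<not> U x"
  proof -
    have "R x = {0}" unfolding R_def using self_in_bx[OF _ x(1)] x(2) by auto
    then have "inner_dist J U x \<le> 0" unfolding eq using dsup_le[OF R1 ne, of x 0] by simp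
    then show ?thesis using pos[of x] by simp
  qed
  \<comment> \<open>The cube of radius \<open>r\<close> about \<open>x\<close> contains the cube of
    radius \<open>r - \<eta>\<close> about \<open>y\<close>: the function is 1-Lipschitz in the sup
    norm.\<close>
  have lip: "inner_dist J U x \<le> inner_dist J U y + \<eta>" if y: "y \<in> bx J x \<eta>" and \<eta>: "\<eta> > 0" for x y \<eta>
    unfolding eq
  proof (rule dsup_le[OF R1 ne], intro ballI)
    fix r assume r: "r \<in> R x"
    show "r \<le> dsup (R y) + \<eta>"
    proof (cases "r \<le> \<eta>")
      case True
      then show ?thesis using pos[of y] unfolding eq by (simp add: add_increasing)
    next
      case False
      have "z \<in> bx J x r" if z: "z \<in> bx J y (r - \<eta>)" for z
      proof -
        have "\<bar>z i - x i\<bar> < r" if "i \<in> J" for i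
        proof -
          have "\<bar>z i - y i\<bar> < r - \<eta>" "\<bar>y i - x i\<bar> < \<eta>" using y z that by (auto simp: bx_def)
          then show ?thesis by linarith
        qed
        then show ?thesis using z by (simp add: bx_def)
      qed
      then have "r - \<eta> \<in> R y" using r False \<eta> unfolding R_def by auto
      from dsup_upper[OF R1 this Rb] show ?thesis by (simp add: algebra_simps)
    qed
  qed
  show "cw J S (inner_dist J U) x" if x: "x \<in> E J"
    unfolding cw_def
  proof (intro allI impI)
    fix \<epsilon> :: 'a assume \<epsilon>: "\<epsilon> > 0"
    have "\<bar>inner_dist J U y - inner_dist J U x\<bar> < \<epsilon>" if y: "y \<in> bx J x (\<epsilon> / 2)" for y
    proof -
      have x': "x \<in> bx J y (\<epsilon> / 2)" using y x by (auto simp: bx_def abs_minus_commute)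
      have "\<epsilon> / 2 > 0" "\<epsilon> / 2 < \<epsilon>" using \<epsilon> by auto
      then show ?thesis using lip[OF y] lip[OF x'] by (simp add: abs_less_iff)
    qed
    then show "nbhd J (\<lambda>y. y \<in> S \<longrightarrow> \<bar>inner_dist J U y - inner_dist J U x\<bar> < \<epsilon>) x"
      unfolding nbhd_def using \<epsilon> by (intro exI[of _ "\<epsilon> / 2"]) auto
  qed
qed

text \<open>The distances divided by their sum \<open>s\<close> have average \<open>1 / k\<close>,
  so at each point one of them is at least \<open>1 / k\<close>. Rescaling and truncating turns this
  into a cutoff with value 1, which suffices in place of a partition of unity.\<close>

lemma cutoffs:
  assumes J: "finite J" and C: "finite C" and U: "\<And>U. U \<in> C \<Longrightarrow> dpred U"
    "\<And>U x. U \<in> C \<Longrightarrow> x \<in> E J \<Longrightarrow> U x \<Longrightarrow> nbhd J U x" and X: "X \<subseteq> E J" and cov: "\<And>x. x \<in> X \<Longrightarrow> \<exists>U\<in>C. U x"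
  obtains u where "\<And>U. U \<in> C \<Longrightarrow> dfun (u U)" "\<And>U x. U \<in> C \<Longrightarrow> x \<in> X \<Longrightarrow> cw J X (u U) x"
    "\<And>U x. U \<in> C \<Longrightarrow> x \<in> X \<Longrightarrow> 0 \<le> u U x \<and> u U x \<le> (1::'a)"
    "\<And>U x. U \<in> C \<Longrightarrow> x \<in> X \<Longrightarrow> \<not> U x \<Longrightarrow> nbhd J (\<lambda>y. y \<in> X \<longrightarrow> u U y = 0) x"
    "\<And>x. x \<in> X \<Longrightarrow> \<exists>U\<in>C. u U x = 1"
proof (cases "X = {}")
  case True
  then show ?thesis by (intro that[of "\<lambda>_ _. 0"]) (auto intro: dfun_const)
next
  case False
  define d where "d = inner_dist J"
  note D = inner_dist[OF J U(1), folded d_def]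
  define s where "s x = (\<Sum>U\<in>C. d U x)" for x
  define k :: 'a where "k = of_nat (card C)"
  have "C \<noteq> {}" using False cov by blast
  then have k: "k > 0" using C by (simp add: k_def card_gt_0_iff)
  have s: "dfun s" "cw J X s x" if "x \<in> X" for x
    unfolding s_def using that X C D by (auto intro!: dfun_sum cw_sum)
  have ds: "d U x \<le> s x" if "U \<in> C" for U x
    unfolding s_def using that C D(2) by (intro member_le_sum) auto
  have spos: "s x > 0" if x: "x \<in> X" for x
  proof -
    obtain U0 where U0: "U0 \<in> C" "U0 x" using cov[OF x] by blast
    then have "d U0 x > 0" using D(4) U(2) x X by blast
    then show ?thesis using ds[OF U0(1)] by (rule less_le_trans)
  qed
  \<comment> \<open>As a function of the normalised distance: 0 up to \<open>1 / (2 * k)\<close> and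
    1 from \<open>1 / k\<close> on. The first threshold is positive, so \<open>u U\<close> vanishes
    on a whole neighbourhood of a point of \<open>X\<close> outside \<open>U\<close>.\<close>
  define u where "u U x = min 1 (max 0 (2 * k * (d U x / s x) - 1))" for U x
  have r: "cw J X (\<lambda>y. 2 * k * (d U y / s y) - 1) x" if "U \<in> C" "x \<in> X" for U x
  proof -
    have "cw J X (\<lambda>y. d U y / s y) x"
      using that X D s spos ds by (intro cw_ratio) auto
    then show ?thesis using k by (intro cw_diff cw_cmult cw_const) auto
  qed
  show ?thesis
  proof (rule that[of u])
    show "dfun (u U)" if "U \<in> C" for U unfolding u_def
      using False s(1) by (intro d_intros D(1) that) auto
    show "cw J X (u U) x" if "U \<in> C" "x \<in> X" for U x unfolding u_def
      by (intro cw_min cw_max cw_const r that)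
    show "0 \<le> u U x \<and> u U x \<le> 1" for U x unfolding u_def by auto
    show "nbhd J (\<lambda>y. y \<in> X \<longrightarrow> u U y = 0) x" if "U \<in> C" "x \<in> X" "\<not> U x" for U x
    proof -
      have "d U x = 0" using D(5) that X by blast
      then have "nbhd J (\<lambda>y. y \<in> X \<longrightarrow> 2 * k * (d U y / s y) - 1 < 0) x"
        using cw_less[OF r[OF that(1,2)] cw_const[of _ _ 0]] by simp
      then show ?thesis by (rule nbhd_mono) (auto simp: u_def max_def)
    qed
    show "\<exists>U\<in>C. u U x = 1" if x: "x \<in> X" for x
    proof -
      have "\<exists>U\<in>C. s x / k \<le> d U x"
      proof (rule ccontr)
        assume "\<not> ?thesis"
        then have "(\<Sum>U\<in>C. d U x) < (\<Sum>U\<in>C. s x / k)"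
          using C \<open>C \<noteq> {}\<close> by (intro sum_strict_mono) auto
        also have "\<dots> = s x" using k by (simp add: k_def)
        finally show False by (simp add: s_def)
      qed
      then obtain U0 where U0: "U0 \<in> C" "s x / k \<le> d U0 x" by blast
      then have "1 \<le> k * (d U0 x / s x)" using k spos[OF x] by (simp add: field_simps)
      then have "1 \<le> 2 * k * (d U0 x / s x) - 1" by (simp add: mult.assoc)
      then have "u U0 x = 1" by (simp add: u_def)
      then show ?thesis using U0(1) by blast
    qed
  qed
qed

end

section \<open>Lifting a truncated homotopy\<close>

lemma pts_preim [simp]: "pts (preim B p U) = {b \<in> pts B. p b \<in> U}"
  by (simp add: preim_def)

lemma dim_preim [simp]: "dim (preim B p U) = dim B"
  by (simp add: preim_def)

text \<open>All maps are total versions, so definable expressions can be formed with them. The map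
  that \<open>f\<close> induces on the bases appears as the homotopy at time 0.\<close>

locale bundle_lift = o_minimal_expansion M
  for M :: "('a::{linordered_field, linorder_topology}, 'f, 'r) expansion" +
  fixes B X B' X' :: "'a rset" and p p' f ht :: "(nat \<Rightarrow> 'a) \<Rightarrow> nat \<Rightarrow> 'a"
  assumes dB: "dset {..<dim B} (pts B)" and dX: "dset {..<dim X} (pts X)"
    and dB': "dset {..<dim B'} (pts B')" and dX': "dset {..<dim X'} (pts X')"
    and p: "total B X p" and p': "total B' X' p'" and f: "total B B' f" and ht: "total (X \<otimes> unit_I) X' ht"
    and f_over: "\<And>b. b \<in> pts B \<Longrightarrow> p' (f b) = ht ((p b)(dim X := 0))"
    and f_fibre: "\<And>x. x \<in> pts X \<Longrightarrow>
      homeomorphic_map (top_of (preim B p {x})) (top_of (preim B' p' {ht (x(dim X := 0))})) f"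
begin

lemma BE: "pts B \<subseteq> E {..<dim B}" and XE: "pts X \<subseteq> E {..<dim X}"
  and B'E: "pts B' \<subseteq> E {..<dim B'}" and X'E: "pts X' \<subseteq> E {..<dim X'}"
  using dB dX dB' dX' dset_subset by blast+

abbreviation BI :: "(nat \<Rightarrow> 'a) set" where "BI \<equiv> pts (B \<otimes> unit_I)"
abbreviation XI :: "(nat \<Rightarrow> 'a) set" where "XI \<equiv> pts (X \<otimes> unit_I)"

abbreviation base :: "(nat \<Rightarrow> 'a) \<Rightarrow> nat \<Rightarrow> 'a" where
  "base c \<equiv> p (restrict c {..<dim B})"

lemma pX: "b \<in> pts B \<Longrightarrow> p b \<in> pts X"
  using p by (simp add: total_def)

lemma p_base: "b \<in> pts B \<Longrightarrow> base (b(dim B := t)) = p b"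
  using BE restrict_upd by (metis subsetD)

lemma BI_iff: "c \<in> BI \<longleftrightarrow> (\<exists>b t. c = b(dim B := t) \<and> b \<in> pts B \<and> 0 \<le> t \<and> t \<le> 1)"
  unfolding pts_prod_I[OF BE] by blast

lemma XI_I: "x \<in> pts X \<Longrightarrow> 0 \<le> t \<Longrightarrow> t \<le> 1 \<Longrightarrow> x(dim X := t) \<in> XI"
  unfolding pts_prod_I[OF XE] by blast

lemma htX': "x \<in> pts X \<Longrightarrow> 0 \<le> t \<Longrightarrow> t \<le> 1 \<Longrightarrow> ht (x(dim X := t)) \<in> pts X'"
  using ht XI_I by (simp add: total_def)

lemma base_X: "c \<in> BI \<Longrightarrow> base c \<in> pts X"
  unfolding BI_iff using p_base pX by auto

lemma BI_E: "c \<in> BI \<Longrightarrow> c \<in> E {..<Suc (dim B)}"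
  using dset_subset[OF dset_prod_I[OF dB]] by auto

lemma BI_nth: "c \<in> BI \<Longrightarrow> 0 \<le> c (dim B) \<and> c (dim B) \<le> 1"
  unfolding BI_iff by auto

lemma vcw_base: "c \<in> BI \<Longrightarrow> vcw {..<Suc (dim B)} BI {..<dim X} base c"
proof -
  assume c: "c \<in> BI"
  have r: "restrict c {..<dim B} \<in> pts B" if c: "c \<in> BI" for c
  proof -
    obtain b t where b: "c = b(dim B := t)" "b \<in> pts B" using c unfolding BI_iff by blast
    then have "restrict c {..<dim B} = b" using restrict_upd[of b "dim B" t] BE by blast
    then show ?thesis using b(2) by simp
  qed
  have v: "vcw {..<Suc (dim B)} BI {..<dim B} (\<lambda>c. restrict c {..<dim B}) c"
    by (rule vcw_coords) (auto intro: cw_coord)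
  show ?thesis
    by (rule vcw_comp[OF v, of "pts B"]) (use p r[OF c] r in \<open>auto simp: total_def\<close>)
qed

lemma cw_base:
  assumes "c \<in> BI" "\<And>x. x \<in> pts X \<Longrightarrow> cw {..<dim X} (pts X) S x"
  shows "cw {..<Suc (dim B)} BI (\<lambda>c. S (base c)) c"
  by (rule cw_comp[OF vcw_base[OF assms(1)], of "pts X"]) (use assms base_X in auto)

lemma nbhd_base:
  assumes "c \<in> BI" "nbhd {..<dim X} (\<lambda>x. x \<in> pts X \<longrightarrow> P x) (base c)"
  shows "nbhd {..<Suc (dim B)} (\<lambda>c. c \<in> BI \<longrightarrow> P (base c)) c"
  by (rule nbhd_vcw[OF vcw_base[OF assms(1)] assms(2)]) (rule base_X)

lemma dvec_base: "dvec v \<Longrightarrow> dvec (\<lambda>e. base (v e))"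
  using p dvec_comp[OF _ dvec_restrict, of p] by (simp add: total_def)

lemma base_E: "base c \<in> E {..<dim X}"
  using p by (simp add: total_def)

text \<open>Points of \<open>B \<times> I\<close> and \<open>X \<times> I\<close> appear as \<open>b(dim B := t)\<close> and \<open>x(dim X := t)\<close>.\<close>

definition Lift :: "((nat \<Rightarrow> 'a) \<Rightarrow> 'a) \<Rightarrow> ((nat \<Rightarrow> 'a) \<Rightarrow> nat \<Rightarrow> 'a) \<Rightarrow> bool" where
  "Lift S H \<longleftrightarrow> total (B \<otimes> unit_I) B' H \<and>
    (\<forall>b\<in>pts B. \<forall>t. 0 \<le> t \<and> t \<le> 1 \<longrightarrow> p' (H (b(dim B := t))) = ht ((p b)(dim X := min t (S (p b))))) \<and>
    (\<forall>b\<in>pts B. H (b(dim B := 0)) = f b) \<and>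
    (\<forall>x\<in>pts X. \<forall>t. 0 \<le> t \<and> t \<le> 1 \<longrightarrow> homeomorphic_map (top_of (preim B p {x}))
      (top_of (preim B' p' {ht (x(dim X := min t (S x)))})) (\<lambda>b. H (b(dim B := t)))) \<and>
    (\<forall>b\<in>pts B. \<forall>t1 t2. 0 \<le> t1 \<and> t1 \<le> t2 \<and> t2 \<le> 1 \<and>
      (\<forall>t. t1 \<le> t \<and> t \<le> t2 \<longrightarrow> ht ((p b)(dim X := t)) = ht ((p b)(dim X := t1))) \<longrightarrow>
      H (b(dim B := t1)) = H (b(dim B := t2)))"

text \<open>\<open>tr y b\<close> is the point over \<open>y\<close> that has the same fibre coordinate as \<open>b\<close> in a trivialisation over \<open>V\<close>.\<close>

definition transport :: "(nat \<Rightarrow> 'a) set \<Rightarrow> ((nat \<Rightarrow> 'a) \<Rightarrow> (nat \<Rightarrow> 'a) \<Rightarrow> nat \<Rightarrow> 'a) \<Rightarrow> bool" where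
  "transport V tr \<longleftrightarrow> (\<forall>v w. dvec v \<longrightarrow> dvec w \<longrightarrow> dvec (\<lambda>e. tr (v e) (w e))) \<and>
    (\<forall>y b. tr y b \<in> E {..<dim B'}) \<and>
    (\<forall>y\<in>V. \<forall>b\<in>pts B'. p' b \<in> V \<longrightarrow> tr y b \<in> pts B' \<and> p' (tr y b) = y \<and> tr (p' b) b = b \<and>
      (\<forall>y'\<in>V. tr y' (tr y b) = tr y' b)) \<and>
    (\<forall>y\<in>V. \<forall>b\<in>pts B'. \<forall>\<epsilon>. p' b \<in> V \<and> \<epsilon> > 0 \<longrightarrow> (\<exists>\<delta>>0. \<forall>y2\<in>bx {..<dim X'} y \<delta>. \<forall>b2\<in>bx {..<dim B'} b \<delta>.
      y2 \<in> V \<and> b2 \<in> pts B' \<and> p' b2 \<in> V \<longrightarrow> tr y2 b2 \<in> bx {..<dim B'} (tr y b) \<epsilon>))"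

text \<open>The inverse is transport back to \<open>y1\<close>, since the fibre coordinate is kept
  on both ways.\<close>

lemma transport_homeomorphic:
  assumes tr: "transport V tr" and y: "y1 \<in> V" "y2 \<in> V"
  shows "homeomorphic_map (top_of (preim B' p' {y1})) (top_of (preim B' p' {y2})) (tr y2)"
proof -
  have T: "tr y b \<in> pts B'" "p' (tr y b) = y" "tr (p' b) b = b" "\<And>y'. y' \<in> V \<Longrightarrow> tr y' (tr y b) = tr y' b"
    if "y \<in> V" "b \<in> pts B'" "p' b \<in> V" for y b
    using tr that unfolding transport_def by blast+
  have cont: "continuous_map (top_of (preim B' p' {y})) (top_of (preim B' p' {z})) (tr z)" if yz: "y \<in> V" "z \<in> V" for y z
  proof -
    have "vcw {..<dim B'} {b \<in> pts B'. p' b \<in> {y}} {..<dim B'} (tr z) b" if b: "b \<in> pts B'" "p' b = y" for b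
      unfolding vcw_def
    proof (intro allI impI)
      fix \<epsilon> :: 'a assume \<epsilon>: "\<epsilon> > 0"
      have "p' b \<in> V" using b yz by simp
      then obtain \<delta> where \<delta>: "\<delta> > 0" "\<forall>y2\<in>bx {..<dim X'} z \<delta>. \<forall>b2\<in>bx {..<dim B'} b \<delta>.
        y2 \<in> V \<and> b2 \<in> pts B' \<and> p' b2 \<in> V \<longrightarrow> tr y2 b2 \<in> bx {..<dim B'} (tr z b) \<epsilon>"
        using tr yz(2) b(1) \<epsilon> unfolding transport_def by blast
      have "z \<in> pts X'"
        using T(1,2)[OF yz(2) b(1) \<open>p' b \<in> V\<close>] p' unfolding total_def by metis
      then have "z \<in> bx {..<dim X'} z \<delta>" using X'E self_in_bx[OF \<delta>(1)] by blast
      then show "nbhd {..<dim B'} (\<lambda>y'. y' \<in> {b \<in> pts B'. p' b \<in> {y}} \<longrightarrow> tr z y' \<in> bx {..<dim B'} (tr z b) \<epsilon>) b"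
        unfolding nbhd_def using \<delta> yz by (intro exI[of _ \<delta>]) auto
    qed
    moreover have "pts (preim B' p' U) \<subseteq> E {..<dim (preim B' p' U)}" for U using B'E by auto
    ultimately show ?thesis
      using T yz by (subst continuous_map_top_of) auto
  qed
  have ts: "topspace (top_of (preim B' p' U)) = {b \<in> pts B'. p' b \<in> U}" for U
    using topspace_top_of[of "preim B' p' U"] B'E by auto
  have "homeomorphic_maps (top_of (preim B' p' {y1})) (top_of (preim B' p' {y2})) (tr y2) (tr y1)"
    unfolding homeomorphic_maps_def ts
  proof (intro conjI ballI cont y)
    show "tr y1 (tr y2 b) = b" if "b \<in> {b \<in> pts B'. p' b \<in> {y1}}" for b
      using T(4)[OF y(2) _ _ y(1), of b] T(3)[of y1 b] that y by auto
    show "tr y2 (tr y1 b) = b" if "b \<in> {b \<in> pts B'. p' b \<in> {y2}}" for b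
      using T(4)[OF y(1) _ _ y(2), of b] T(3)[of y2 b] that y by auto
  qed
  then show ?thesis unfolding homeomorphic_map_maps by blast
qed

text \<open>For \<open>V\<close> relatively open this is, on X x I, the preimage of \<open>V\<close>
  under the homotopy (\<open>pullback_iff\<close>). Away from X x I it is enlarged to an open subset
  of R^n x R, so that \<open>covering\<close> and \<open>tube\<close> apply to an arbitrary
  definable X.\<close>

definition pullback :: "(nat \<Rightarrow> 'a) set \<Rightarrow> (nat \<Rightarrow> 'a) \<Rightarrow> 'a set" where
  "pullback V x = {t. \<exists>r. r > 0 \<and> (\<forall>y\<in>bx {..<dim X} x r. y \<in> pts X \<longrightarrow>
    (\<forall>s. 0 \<le> s \<and> s \<le> 1 \<and> \<bar>s - t\<bar> < r \<longrightarrow> ht (y(dim X := s)) \<in> V))}"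

lemma dpred_ht: "dset {..<dim X'} V \<Longrightarrow> dvec v \<Longrightarrow> dpred (\<lambda>e. ht (v e) \<in> V)"
  using ht dvec_comp[of ht v] dset_mem[of _ V "\<lambda>e. ht (v e)"] by (simp add: total_def)

lemma dfam_pullback:
  assumes V: "dset {..<dim X'} V"
  shows "dfam (pullback V)"
  unfolding pullback_def
  by (intro dfam_Collect d_intros finite_lessThan dpred_ht[OF V] dset_mem[OF dX])

lemma open_fam_pullback: "open_fam {..<dim X} (pullback V)"
  unfolding open_fam_def
proof (intro ballI)
  fix x t assume x: "x \<in> E {..<dim X}" and "t \<in> pullback V x"
  then obtain r where r: "r > 0" "\<And>y s. y \<in> bx {..<dim X} x r \<Longrightarrow> y \<in> pts X \<Longrightarrow> 0 \<le> s \<Longrightarrow> s \<le> 1 \<Longrightarrow> \<bar>s - t\<bar> < r \<Longrightarrow>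
    ht (y(dim X := s)) \<in> V" unfolding pullback_def by blast
  have "s \<in> pullback V y" if y: "y \<in> bx {..<dim X} x (r / 2)" and s: "\<bar>s - t\<bar> < r / 2" for y s
  proof -
    have "ht (z(dim X := u)) \<in> V" if z: "z \<in> bx {..<dim X} y (r / 2)" "z \<in> pts X" and u: "0 \<le> u" "u \<le> 1" "\<bar>u - s\<bar> < r / 2" for z u
    proof (rule r(2)[OF _ z(2) u(1,2)])
      have "\<bar>z i - x i\<bar> < r" if "i < dim X" for i
      proof -
        have "\<bar>z i - y i\<bar> < r / 2" "\<bar>y i - x i\<bar> < r / 2" using z(1) y that by (auto simp: bx_def)
        then have "\<bar>z i - x i\<bar> < r / 2 + r / 2" by linarith
        then show ?thesis by simp
      qed
      then show "z \<in> bx {..<dim X} x r" using z(1) by (simp add: bx_def)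
      have "\<bar>u - t\<bar> < r / 2 + r / 2" using u(3) s by linarith
      then show "\<bar>u - t\<bar> < r" by simp
    qed
    then show ?thesis unfolding pullback_def using r(1) by (intro CollectI exI[of _ "r / 2"]) auto
  qed
  then show "\<exists>r>0. \<forall>y\<in>bx {..<dim X} x r. \<forall>s. \<bar>s - t\<bar> < r \<longrightarrow> s \<in> pullback V y"
    using r(1) by (intro exI[of _ "r / 2"]) auto
qed

lemma pullback_iff:
  assumes V: "\<And>y. y \<in> V \<Longrightarrow> nbhd {..<dim X'} (\<lambda>z. z \<in> pts X' \<longrightarrow> z \<in> V) y"
    and x: "x \<in> pts X" and t: "0 \<le> t" "t \<le> 1"
  shows "t \<in> pullback V x \<longleftrightarrow> ht (x(dim X := t)) \<in> V"
proof
  assume "t \<in> pullback V x"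
  then obtain r where r: "r > 0" "\<And>y s. y \<in> bx {..<dim X} x r \<Longrightarrow> y \<in> pts X \<Longrightarrow> 0 \<le> s \<Longrightarrow> s \<le> 1 \<Longrightarrow> \<bar>s - t\<bar> < r \<Longrightarrow>
    ht (y(dim X := s)) \<in> V" unfolding pullback_def by blast
  have "x \<in> bx {..<dim X} x r" using self_in_bx[OF r(1)] x XE by blast
  from r(2)[OF this x t] show "ht (x(dim X := t)) \<in> V" using r(1) by simp
next
  assume h: "ht (x(dim X := t)) \<in> V"
  have v: "vcw {..<Suc (dim X)} XI {..<dim X'} ht (x(dim X := t))"
    using ht XI_I[OF x t] by (simp add: total_def)
  have m: "ht z \<in> pts X'" if "z \<in> XI" for z using ht that by (simp add: total_def)
  have "nbhd {..<Suc (dim X)} (\<lambda>z. z \<in> XI \<longrightarrow> ht z \<in> V) (x(dim X := t))"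
    by (rule nbhd_vcw[where P = "\<lambda>z. z \<in> V" and S' = "pts X'", OF v V[OF h] m])
  then obtain r where r: "r > 0" "\<And>z. z \<in> bx {..<Suc (dim X)} (x(dim X := t)) r \<Longrightarrow> z \<in> XI \<Longrightarrow> ht z \<in> V"
    unfolding nbhd_def by blast
  have "ht (y(dim X := s)) \<in> V" if y: "y \<in> bx {..<dim X} x r" "y \<in> pts X" and s: "0 \<le> s" "s \<le> 1" "\<bar>s - t\<bar> < r" for y s
  proof (rule r(2))
    show "y(dim X := s) \<in> bx {..<Suc (dim X)} (x(dim X := t)) r"
      using y(1) s(3) by (auto simp: bx_def extensional_def)
  qed (rule XI_I[OF y(2) s(1,2)])
  then show "t \<in> pullback V x" unfolding pullback_def using r(1) by blast
qed

text \<open>The homotopy stopped at time 0 does not move, so \<open>f\<close>, ignoring time, lifts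
  it.\<close>

lemma lift_base: "Lift (\<lambda>_. 0) (\<lambda>c. f (restrict c {..<dim B}))"
proof -
  have r: "restrict (b(dim B := t)) {..<dim B} = b" if "b \<in> pts B" for b t
    using that BE by (intro restrict_upd) blast
  have fE: "dvec f" "\<And>e. f e \<in> E {..<dim B'}" "\<And>b. b \<in> pts B \<Longrightarrow> f b \<in> pts B' \<and> vcw {..<dim B} (pts B) {..<dim B'} f b"
    using f unfolding total_def by blast+
  have rB: "restrict c {..<dim B} \<in> pts B" if "c \<in> BI" for c
    using that r unfolding BI_iff by auto
  have v: "vcw {..<Suc (dim B)} BI {..<dim B} (\<lambda>c. restrict c {..<dim B}) c" for c
    by (rule vcw_coords) (auto intro: cw_coord)
  have "vcw {..<Suc (dim B)} BI {..<dim B'} (\<lambda>c. f (restrict c {..<dim B})) c" if "c \<in> BI" for c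
    by (rule vcw_comp[OF v, of "pts B"]) (use fE(3) rB that in auto)
  moreover have "dvec (\<lambda>c. f (restrict c {..<dim B}))"
    by (intro dvec_comp[OF fE(1)] dvec_restrict dvec_id)
  ultimately have "total (B \<otimes> unit_I) B' (\<lambda>c. f (restrict c {..<dim B}))"
    unfolding total_def using fE rB by simp
  moreover have "homeomorphic_map (top_of (preim B p {x})) (top_of (preim B' p' {ht (x(dim X := 0))}))
      (\<lambda>b. f (restrict (b(dim B := t)) {..<dim B}))" if "x \<in> pts X" for x t
  proof -
    have ts: "topspace (top_of (preim B p {x})) = {b \<in> pts B. p b = x}"
      using topspace_top_of[of "preim B p {x}"] BE by auto
    show ?thesis
      by (rule homeomorphic_map_eq[OF f_fibre[OF that(1)]]) (use r ts in auto)
  qed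
  ultimately show ?thesis unfolding Lift_def using r f_over
    by (simp add: min_absorb2 del: fun_upd_apply restrict_upd_same)
qed

text \<open>Transport to the base point over which a bundle point already lies is the identity. For
  this reason the branches of \<open>H'\<close> agree at time \<open>S\<close>, nothing changes
  where \<open>S = S'\<close>, and the lift rests while the path in the base rests.\<close>

lemma lift_step:
  assumes H: "Lift S H"
    and S: "\<And>x. x \<in> pts X \<Longrightarrow> cw {..<dim X} (pts X) S x" "dfun S"
    and S': "\<And>x. x \<in> pts X \<Longrightarrow> cw {..<dim X} (pts X) S' x" "dfun S'"
    and SS: "\<And>x. x \<in> pts X \<Longrightarrow> 0 \<le> S x \<and> S x \<le> S' x \<and> S' x \<le> 1"
    and V: "dset {..<dim X'} V" "\<And>y. y \<in> V \<Longrightarrow> nbhd {..<dim X'} (\<lambda>z. z \<in> pts X' \<longrightarrow> z \<in> V) y"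
    and tr: "transport V tr"
    and step: "\<And>x. x \<in> pts X \<Longrightarrow> nbhd {..<dim X} (\<lambda>y. y \<in> pts X \<longrightarrow> S y = S' y) x \<or>
      (\<forall>t. S x \<le> t \<and> t \<le> S' x \<longrightarrow> ht (x(dim X := t)) \<in> V)"
  shows "\<exists>H'. Lift S' H'"
proof -
  let ?n = "dim B" and ?N = "dim X" and ?J = "{..<Suc (dim B)}"
  have H1: "dvec H" "\<And>e. H e \<in> E {..<dim B'}" "\<And>c. c \<in> BI \<Longrightarrow> H c \<in> pts B'"
    "\<And>c. c \<in> BI \<Longrightarrow> vcw ?J BI {..<dim B'} H c"
    using H unfolding Lift_def total_def by auto
  have H2: "p' (H (b(?n := t))) = ht ((p b)(?N := min t (S (p b))))" if "b \<in> pts B" "0 \<le> t" "t \<le> 1" for b t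
    using H that unfolding Lift_def by blast
  have H3: "H (b(?n := 0)) = f b" if "b \<in> pts B" for b using H that unfolding Lift_def by blast
  have H4: "homeomorphic_map (top_of (preim B p {x})) (top_of (preim B' p' {ht (x(?N := min t (S x)))})) (\<lambda>b. H (b(?n := t)))"
    if "x \<in> pts X" "0 \<le> t" "t \<le> 1" for x t using H that unfolding Lift_def by blast
  have H5: "H (b(?n := t1)) = H (b(?n := t2))" if "b \<in> pts B" "0 \<le> t1" "t1 \<le> t2" "t2 \<le> 1"
    "\<And>t. t1 \<le> t \<Longrightarrow> t \<le> t2 \<Longrightarrow> ht ((p b)(?N := t)) = ht ((p b)(?N := t1))" for b t1 t2
    using H that unfolding Lift_def by blast
  have T: "tr y b \<in> pts B'" "p' (tr y b) = y" "tr (p' b) b = b"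
    if "y \<in> V" "b \<in> pts B'" "p' b \<in> V" for y b
    using tr that unfolding transport_def by blast+
  \<comment> \<open>The points whose path stays in \<open>V\<close> from \<open>S\<close> to
    \<open>S'\<close>. They form a relatively open set by the tube lemma, and near each other point
    of X the assumption \<open>step\<close> gives \<open>S = S'\<close>.\<close>
  define N where "N x \<longleftrightarrow> (\<forall>t. S x \<le> t \<and> t \<le> S' x \<longrightarrow> ht (x(?N := t)) \<in> V)" for x
  have Nd: "dpred N" unfolding N_def
    by (intro d_intros dfun_comp[OF S(2)] dfun_comp[OF S'(2)] dpred_ht[OF V(1)])
  have Nopen: "nbhd {..<?N} (\<lambda>y. y \<in> pts X \<longrightarrow> N y) x" if x: "x \<in> pts X" "N x" for x
  proof -
    have xE: "x \<in> E {..<?N}" using x(1) XE by blast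
    have le: "S x \<le> S' x" using SS[OF x(1)] by blast
    have W: "t \<in> pullback V x" if t: "S x \<le> t" "t \<le> S' x" for t
      using pullback_iff[OF V(2) x(1), of t] x(2) t SS[OF x(1)] unfolding N_def by auto
    obtain r where r: "r > 0" "\<And>y t. y \<in> bx {..<?N} x r \<Longrightarrow> S x - r < t \<Longrightarrow> t < S' x + r \<Longrightarrow> t \<in> pullback V y"
      by (rule tube[OF finite_lessThan dfam_pullback[OF V(1)] open_fam_pullback xE le W], assumption, assumption, rule that)
    have "nbhd {..<?N} (\<lambda>y. y \<in> pts X \<longrightarrow> \<bar>S y - S x\<bar> < r) x" "nbhd {..<?N} (\<lambda>y. y \<in> pts X \<longrightarrow> \<bar>S' y - S' x\<bar> < r) x"
      "nbhd {..<?N} (\<lambda>y. y \<in> bx {..<?N} x r) x"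
      using S(1)[OF x(1)] S'(1)[OF x(1)] r(1) unfolding cw_def by (blast, blast, auto simp: nbhd_def)
    from nbhd_conj[OF this(1) nbhd_conj[OF this(2,3)]] show ?thesis
    proof (rule nbhd_mono, intro impI)
      fix y assume *: "(y \<in> pts X \<longrightarrow> \<bar>S y - S x\<bar> < r) \<and> (y \<in> pts X \<longrightarrow> \<bar>S' y - S' x\<bar> < r) \<and> y \<in> bx {..<?N} x r"
        and y: "y \<in> pts X"
      show "N y" unfolding N_def
      proof (intro allI impI)
        fix t assume t: "S y \<le> t \<and> t \<le> S' y"
        have "S x - r < t" "t < S' x + r" using * y t by (auto simp: abs_less_iff)
        then have "t \<in> pullback V y" using * by (intro r(2)) auto
        then show "ht (y(?N := t)) \<in> V" using pullback_iff[OF V(2) y, of t] t SS[OF y] by auto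
      qed
    qed
  qed
  define g where "g c = ht ((base c)(?N := min (c ?n) (S' (base c))))" for c
  define H' where "H' c = (if N (base c) \<and> S (base c) < c ?n then tr (g c) (H c) else H c)" for c
  have htd: "dvec ht" using ht by (simp add: total_def)
  have gv: "dvec g" unfolding g_def
    by (intro dvec_comp[OF htd] d_intros dvec_base dfun_comp[OF S'(2)])
  have "dvec (\<lambda>e. tr (g e) (H e))" using tr gv H1(1) unfolding transport_def by blast
  then have "dvec H'" unfolding H'_def
    by (intro dvec_if dpred_conj dpred_comp[OF Nd] d_intros dvec_base dfun_comp[OF S(2)] H1(1))
  moreover have "H' e \<in> E {..<dim B'}" for e
    unfolding H'_def using H1(2) tr by (auto simp: transport_def)
  moreover have gvcw: "vcw ?J BI {..<dim X'} g c" if c: "c \<in> BI" for c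
  proof -
    have 1: "(base c)(?N := min (c ?n) (S' (base c))) \<in> XI" if "c \<in> BI" for c
      using BI_nth[OF that] SS[OF base_X[OF that]] by (intro XI_I base_X that) auto
    have 2: "vcw ?J BI {..<Suc ?N} (\<lambda>c. (base c)(?N := min (c ?n) (S' (base c)))) c"
    proof (rule vcw_coords)
      fix i assume "i \<in> {..<Suc ?N}"
      show "cw ?J BI (\<lambda>y. ((base y)(?N := min (y ?n) (S' (base y)))) i) c"
      proof (cases "i = ?N")
        case True
        have "cw ?J BI (\<lambda>y. min (y ?n) (S' (base y))) c"
          by (intro cw_min cw_coord cw_base[OF c S'(1)]) auto
        then show ?thesis using True by simp
      next
        case False
        then have "i \<in> {..<?N}" using \<open>i \<in> {..<Suc ?N}\<close> by auto
        from vcw_coordD[OF vcw_base[OF c] this] show ?thesis using False by simp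
      qed
    next
      fix y show "(base y)(?N := min (y ?n) (S' (base y))) \<in> E {..<Suc ?N}"
        using base_E[of y] by (auto simp: extensional_def)
    qed simp
    show ?thesis unfolding g_def
      by (rule vcw_comp[OF 2, of XI]) (use ht 1 c in \<open>auto simp: total_def\<close>)
  qed
  have key: "g c \<in> V" "p' (H c) = ht ((base c)(?N := S (base c)))" "p' (H c) \<in> V"
    if c: "c \<in> BI" "N (base c)" "S (base c) \<le> c ?n" for c
  proof -
    obtain b t where b: "c = b(?n := t)" "b \<in> pts B" "0 \<le> t" "t \<le> 1" using c(1) unfolding BI_iff by blast
    have pb: "base c = p b" using p_base b by simp
    have s: "S (p b) \<le> S' (p b)" "S (p b) \<le> t" using SS[OF pX[OF b(2)]] c(3) pb b(1) by auto
    then show "g c \<in> V" unfolding g_def pb using c(2) b(1) unfolding N_def pb by simp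
    show h: "p' (H c) = ht ((base c)(?N := S (base c)))"
      unfolding pb using H2[OF b(2-4)] s by (simp add: b(1) min_absorb2)
    show "p' (H c) \<in> V" unfolding h using c(2) s unfolding N_def pb by simp
  qed
  have same: "H' c = H c" if c: "c \<in> BI" "S (base c) = S' (base c)" for c
  proof (cases "N (base c) \<and> S (base c) < c ?n")
    case True
    then have "g c = p' (H c)" using key(2)[OF c(1)] c(2) unfolding g_def by simp
    then show ?thesis using True T(3)[of "g c" "H c"] key[OF c(1)] H1(3)[OF c(1)] by (simp add: H'_def)
  qed (auto simp: H'_def)
  have H'B: "H' c \<in> pts B'" if "c \<in> BI" for c
    unfolding H'_def using key[OF that] T(1) H1(3)[OF that] by auto
  moreover have "vcw ?J BI {..<dim B'} H' c" if c: "c \<in> BI" for c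
  proof (cases "nbhd {..<?N} (\<lambda>y. y \<in> pts X \<longrightarrow> S y = S' y) (base c)")
    case True
    have "nbhd ?J (\<lambda>c. c \<in> BI \<longrightarrow> H' c = H c) c"
      using nbhd_base[OF c True] same by (auto elim!: nbhd_mono)
    then show ?thesis by (rule vcw_cong[OF _ c BI_E[OF c] H1(4)[OF c]])
  next
    case False
    then have Nc: "N (base c)" using step[OF base_X[OF c]] unfolding N_def by blast
    have Nn: "nbhd ?J (\<lambda>c. c \<in> BI \<longrightarrow> N (base c)) c" by (rule nbhd_base[OF c Nopen[OF base_X[OF c] Nc]])
    have cn: "cw ?J BI (\<lambda>c. c ?n) c" by (rule cw_coord) simp
    have cS: "cw ?J BI (\<lambda>c. S (base c)) c" by (rule cw_base[OF c S(1)])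
    show ?thesis
    proof (cases "c ?n < S (base c)")
      case True
      from cw_less[OF cn cS True] have "nbhd ?J (\<lambda>c. c \<in> BI \<longrightarrow> H' c = H c) c"
      proof (rule nbhd_mono, intro impI)
        fix d assume "d \<in> BI \<longrightarrow> d ?n < S (base d)" and "d \<in> BI"
        then have "\<not> S (base d) < d ?n" by (meson less_asym)
        then show "H' d = H d" unfolding H'_def by simp
      qed
      then show ?thesis by (rule vcw_cong[OF _ c BI_E[OF c] H1(4)[OF c]])
    next
      case False
      then have le: "S (base c) \<le> c ?n" by simp
      note k = key[OF c Nc le]
      \<comment> \<open>At time exactly \<open>S\<close> the point already lies over
        \<open>g c\<close>, so the transport formula holds there too; continuity at \<open>c\<close>
        then covers both branches of \<open>H'\<close>.\<close>
      have val: "H' c = tr (g c) (H c)"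
      proof (cases "S (base c) < c ?n")
        case False
        then have eq: "S (base c) = c ?n" using le by simp
        then have "g c = p' (H c)" using k(2) SS[OF base_X[OF c]] unfolding g_def by (simp add: min_absorb1)
        then show ?thesis using False T(3)[OF k(1) H1(3)[OF c] k(3)] by (simp add: H'_def)
      qed (simp add: H'_def Nc)
      show ?thesis unfolding vcw_def
      proof (intro allI impI)
        fix \<epsilon> :: 'a assume \<epsilon>: "\<epsilon> > 0"
        obtain \<delta> where \<delta>: "\<delta> > 0" "\<And>y2 b2. y2 \<in> bx {..<dim X'} (g c) \<delta> \<Longrightarrow> b2 \<in> bx {..<dim B'} (H c) \<delta> \<Longrightarrow>
          y2 \<in> V \<Longrightarrow> b2 \<in> pts B' \<Longrightarrow> p' b2 \<in> V \<Longrightarrow> tr y2 b2 \<in> bx {..<dim B'} (tr (g c) (H c)) \<epsilon>"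
          using tr[unfolded transport_def, THEN conjunct2, THEN conjunct2, THEN conjunct2, rule_format,
              OF k(1) H1(3)[OF c] conjI[OF k(3) \<epsilon>]] by blast
        have n1: "nbhd ?J (\<lambda>d. d \<in> BI \<longrightarrow> g d \<in> bx {..<dim X'} (g c) \<delta>) c"
          using gvcw[OF c] \<delta>(1) unfolding vcw_def by blast
        have n2: "nbhd ?J (\<lambda>d. d \<in> BI \<longrightarrow> H d \<in> bx {..<dim B'} (H c) \<delta>) c"
          "nbhd ?J (\<lambda>d. d \<in> BI \<longrightarrow> H d \<in> bx {..<dim B'} (H c) \<epsilon>) c"
          using H1(4)[OF c] \<delta>(1) \<epsilon> unfolding vcw_def by blast+
        have n3: "nbhd ?J (\<lambda>d. d \<in> BI \<longrightarrow> S (base c) < c ?n \<longrightarrow> S (base d) < d ?n) c"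
          using cw_less[OF cS cn] by (cases "S (base c) < c ?n") (auto elim!: nbhd_mono intro: nbhd_all)
        show "nbhd ?J (\<lambda>d. d \<in> BI \<longrightarrow> H' d \<in> bx {..<dim B'} (H' c) \<epsilon>) c"
        proof (rule nbhd_mono[OF nbhd_conj[OF nbhd_conj[OF n1 n2(1)] nbhd_conj[OF n2(2) nbhd_conj[OF n3 Nn]]]], intro impI)
          fix d assume d: "d \<in> BI" and *: "((d \<in> BI \<longrightarrow> g d \<in> bx {..<dim X'} (g c) \<delta>) \<and> (d \<in> BI \<longrightarrow> H d \<in> bx {..<dim B'} (H c) \<delta>)) \<and>
            (d \<in> BI \<longrightarrow> H d \<in> bx {..<dim B'} (H c) \<epsilon>) \<and>
            (d \<in> BI \<longrightarrow> S (base c) < c ?n \<longrightarrow> S (base d) < d ?n) \<and> (d \<in> BI \<longrightarrow> N (base d))"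
          show "H' d \<in> bx {..<dim B'} (H' c) \<epsilon>"
          proof (cases "S (base d) < d ?n")
            case True
            then have "H' d = tr (g d) (H d)" using * d by (simp add: H'_def)
            moreover have "tr (g d) (H d) \<in> bx {..<dim B'} (tr (g c) (H c)) \<epsilon>"
              using * d True key[OF d] H1(3)[OF d] by (intro \<delta>(2)) auto
            ultimately show ?thesis using val by simp
          next
            case False
            then have "H' d = H d" "H' c = H c" using * d by (auto simp: H'_def)
            then show ?thesis using * d by simp
          qed
        qed
      qed
    qed
  qed
  ultimately have "total (B \<otimes> unit_I) B' H'" unfolding total_def by simp
  moreover have c_BI: "b(?n := t) \<in> BI" if "b \<in> pts B" "0 \<le> t" "t \<le> 1" for b t
    using that BI_iff by blast
  have H'eq: "H' (b(?n := t)) = (if N (p b) \<and> S (p b) < t then tr (ht ((p b)(?N := min t (S' (p b))))) (H (b(?n := t)))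
      else H (b(?n := t)))" if "b \<in> pts B" for b t
    unfolding H'_def g_def using p_base[OF that, of t] by simp
  have minS: "min t (S x) = min t (S' x)" if "x \<in> pts X" "\<not> (N x \<and> S x < t)" for x t
  proof (cases "N x")
    case True
    then have "t \<le> S x" using that by auto
    then show ?thesis using SS[OF that(1)] by (auto simp: min_absorb1)
  next
    case False
    then have "nbhd {..<?N} (\<lambda>y. y \<in> pts X \<longrightarrow> S y = S' y) x" using step[OF that(1)] unfolding N_def by blast
    from nbhd_self[OF this] that(1) XE have "S x = S' x" by blast
    then show ?thesis by simp
  qed
  have V12: "ht (x(?N := min t (S x))) \<in> V" "ht (x(?N := min t (S' x))) \<in> V"
    if "x \<in> pts X" "N x" "S x < t" for x t
    using that SS[OF that(1)] unfolding N_def by (auto simp: min_def)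
  have "p' (H' (b(?n := t))) = ht ((p b)(?N := min t (S' (p b))))" if b: "b \<in> pts B" "0 \<le> t" "t \<le> 1" for b t
  proof (cases "N (p b) \<and> S (p b) < t")
    case True
    note v = V12[OF pX[OF b(1)] True[THEN conjunct1] True[THEN conjunct2]]
    have "p' (H (b(?n := t))) \<in> V" unfolding H2[OF b] by (rule v(1))
    from T(2)[OF v(2) H1(3)[OF c_BI[OF b]] this] show ?thesis unfolding H'eq[OF b(1)] using True by simp
  next
    case False
    then show ?thesis using H'eq[OF b(1)] H2[OF b] minS[OF pX[OF b(1)] False] by (simp only: if_False)
  qed
  moreover have "H' (b(?n := 0)) = f b" if "b \<in> pts B" for b
    using H'eq[OF that, of 0] H3[OF that] SS[OF pX[OF that]] by auto
  moreover have "homeomorphic_map (top_of (preim B p {x})) (top_of (preim B' p' {ht (x(?N := min t (S' x)))})) (\<lambda>b. H' (b(?n := t)))"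
    if x: "x \<in> pts X" "0 \<le> t" "t \<le> 1" for x t
  proof -
    have ts: "topspace (top_of (preim B p {x})) = {b \<in> pts B. p b = x}"
      using topspace_top_of[of "preim B p {x}"] BE by auto
    show ?thesis
    proof (cases "N x \<and> S x < t")
      case True
      note v = V12[OF x(1) True[THEN conjunct1] True[THEN conjunct2]]
      have "homeomorphic_map (top_of (preim B p {x})) (top_of (preim B' p' {ht (x(?N := min t (S' x)))}))
        (tr (ht (x(?N := min t (S' x)))) \<circ> (\<lambda>b. H (b(?n := t))))"
        by (rule homeomorphic_map_compose[OF H4[OF x] transport_homeomorphic[OF tr v]])
      then show ?thesis by (rule homeomorphic_map_eq) (use H'eq True ts in auto)
    next
      case False
      have "homeomorphic_map (top_of (preim B p {x})) (top_of (preim B' p' {ht (x(?N := min t (S' x)))})) (\<lambda>b. H (b(?n := t)))"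
        using H4[OF x] unfolding minS[OF x(1) False] .
      then show ?thesis by (rule homeomorphic_map_eq) (use H'eq False ts in auto)
    qed
  qed
  moreover have "H' (b(?n := t1)) = H' (b(?n := t2))" if b: "b \<in> pts B" and t: "0 \<le> t1" "t1 \<le> t2" "t2 \<le> 1"
    and const: "\<And>t. t1 \<le> t \<Longrightarrow> t \<le> t2 \<Longrightarrow> ht ((p b)(?N := t)) = ht ((p b)(?N := t1))" for b t1 t2
  proof -
    have e: "H (b(?n := t1)) = H (b(?n := t2))" by (rule H5[OF b t const])
    have s: "S (p b) \<le> S' (p b)" using SS[OF pX[OF b]] by blast
    show ?thesis
    proof (cases "N (p b) \<and> S (p b) < t2")
      case False
      then have n1: "\<not> (N (p b) \<and> S (p b) < t1)" using t(2) by auto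
      show ?thesis unfolding H'eq[OF b] if_not_P[OF n1] if_not_P[OF False] by (rule e)
    next
      case True
      have t0: "0 \<le> t2" "t1 \<le> 1" using t by auto
      have h2: "H' (b(?n := t2)) = tr (ht ((p b)(?N := min t2 (S' (p b))))) (H (b(?n := t1)))"
        unfolding H'eq[OF b] if_P[OF True] e ..
      show ?thesis
      proof (cases "S (p b) < t1")
        case s1: True
        have "ht ((p b)(?N := min t1 (S' (p b)))) = ht ((p b)(?N := min t2 (S' (p b))))"
        proof (cases "S' (p b) \<le> t1")
          case True
          then show ?thesis using t(2) by (simp add: min_absorb2)
        next
          case False
          then show ?thesis using const[of "min t2 (S' (p b))"] t(2) by (simp add: min_absorb1)
        qed
        then show ?thesis using h2 H'eq[OF b, of t1] True s1 by simp
      next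
        \<comment> \<open>The path rests from \<open>t1\<close> to \<open>t2\<close>, and the
          stopping time \<open>S\<close> lies in between: the target of the transport is the point
          over which \<open>H\<close> already lies.\<close>
        case s1: False
        have "ht ((p b)(?N := min t2 (S' (p b)))) = ht ((p b)(?N := t1))"
          using s1 s t(2) by (intro const) auto
        also have "\<dots> = p' (H (b(?n := t1)))" using H2[OF b t(1) t0(2)] s1 by (simp add: min_absorb1)
        finally have "H' (b(?n := t2)) = tr (p' (H (b(?n := t1)))) (H (b(?n := t1)))" using h2 by simp
        also have "\<dots> = H (b(?n := t1))"
        proof (rule T(3))
          show "H (b(?n := t1)) \<in> pts B'" using H1(3) c_BI[OF b t(1) t0(2)] by blast
          have "p' (H (b(?n := t1))) = ht ((p b)(?N := S (p b)))"
            unfolding e using H2[OF b t0(1) t(3)] True by (simp add: min_absorb2)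
          then show "p' (H (b(?n := t1))) \<in> V" using True s unfolding N_def by simp
          then show "p' (H (b(?n := t1))) \<in> V" .
        qed
        also have "\<dots> = H' (b(?n := t1))" using H'eq[OF b, of t1] s1 by simp
        finally show ?thesis by simp
      qed
    qed
  qed
  ultimately show ?thesis unfolding Lift_def by (intro exI[of _ H']) blast
qed

end

section \<open>The covering homotopy theorem\<close>

context bundle_lift begin

text \<open>Transport applies the chart to the new base point and the old fibre coordinate
  \<open>q\<close>; continuity of both the chart and its inverse makes it jointly
  continuous.\<close>

lemma chart_transport:
  assumes V: "definable M (RSet (dim X') V)" and op: "openin (top_of X') V" and F: "definable M F"
    and hom: "definable_homeo M (RSet (dim X') V \<otimes> F) (preim B' p' V) \<phi>"
    and over: "\<And>y v. y \<in> V \<Longrightarrow> v \<in> pts F \<Longrightarrow> p' (\<phi> (cat (dim X') y v)) = y"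
  shows "dset {..<dim X'} V" "\<And>y. y \<in> V \<Longrightarrow> nbhd {..<dim X'} (\<lambda>z. z \<in> pts X' \<longrightarrow> z \<in> V) y" "\<exists>tr. transport V tr"
proof -
  show dV: "dset {..<dim X'} V" using V unfolding definable_iff_dset by simp
  show "nbhd {..<dim X'} (\<lambda>z. z \<in> pts X' \<longrightarrow> z \<in> V) y" if "y \<in> V" for y
    using op that unfolding openin_top_of[OF X'E] by blast
  let ?N = "dim X'" and ?k = "dim F" and ?n = "dim B'"
  let ?W = "RSet (dim X') V \<otimes> F" and ?P = "preim B' p' V"
  have VE: "V \<subseteq> E {..<?N}" by (rule dset_subset[OF dV])
  have dF: "dset {..<?k} (pts F)" using F unfolding definable_iff_dset .
  have FE: "pts F \<subseteq> E {..<?k}" by (rule dset_subset[OF dF])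
  have W: "pts ?W = {cat ?N y v | y v. y \<in> V \<and> v \<in> pts F}" "dim ?W = ?N + ?k"
    by (simp_all add: rprod_def)
  have WE: "pts ?W \<subseteq> E {..<dim ?W}" unfolding W using FE cat_in_E by blast
  have PE: "pts ?P \<subseteq> E {..<dim ?P}" using B'E by auto
  have "definable_map M ?W ?P \<phi>" using hom by (simp add: definable_homeo_def)
  then obtain \<Phi> where \<Phi>: "total ?W ?P \<Phi>" "\<And>w. w \<in> pts ?W \<Longrightarrow> \<Phi> w = \<phi> w" using definable_mapE by metis
  have \<Phi>d: "dvec \<Phi>" and \<Phi>E: "\<And>e. \<Phi> e \<in> E {..<?n}" using \<Phi>(1) by (auto simp: total_def)
  obtain \<psi> where \<psi>: "homeomorphic_maps (top_of ?W) (top_of ?P) \<phi> \<psi>"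
    using hom unfolding definable_homeo_def homeomorphic_map_maps by blast
  have \<psi>1: "\<psi> (\<Phi> w) = w" if "w \<in> pts ?W" for w
    using \<psi> that \<Phi>(2) unfolding homeomorphic_maps_def topspace_top_of[OF WE] by simp
  have \<psi>2: "\<phi> (\<psi> b) = b" if "b \<in> pts ?P" for b
    using \<psi> that unfolding homeomorphic_maps_def topspace_top_of[OF PE] by blast
  have \<psi>3: "\<psi> b \<in> pts ?W" "vcw {..<?n} (pts ?P) {..<?N + ?k} \<psi> b" if "b \<in> pts ?P" for b
    using \<psi> that unfolding homeomorphic_maps_def continuous_map_top_of[OF PE WE] by (auto simp: W(2))
  \<comment> \<open>The fibre coordinate of the inverse chart. The inverse \<open>\<psi>\<close>
    comes only as a continuous map, so \<open>q\<close> is defined by a formula from the total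
    version \<open>\<Phi>\<close> of the chart, which makes transport definable.\<close>
  define q where "q b i = (if i \<in> {..<?k} then the1 (\<lambda>a. \<exists>v\<in>E {..<?k}. v \<in> pts F \<and>
    (\<forall>j\<in>{..<?n}. \<Phi> (cat ?N (p' b) v) j = b j) \<and> v i = a) else undefined)" for b i
  have p'd: "dvec p'" using p' by (simp add: total_def)
  have qd: "dvec q"
  proof (rule dvecI)
    fix i show "dfun (\<lambda>b. q b i)" unfolding q_def
      by (intro dfun_if dfun_the1 d_intros finite_lessThan dpred_ball_finite dset_mem[OF dF]
          dfun_nth[OF dvec_comp[OF \<Phi>d]] dvec_cat dvec_comp[OF p'd] dfun_nth[OF dvec_id])
  qed
  have qE: "q b \<in> E {..<?k}" for b by (simp add: q_def extensional_def)
  have psi: "\<psi> b = cat ?N (p' b) (q b) \<and> q b \<in> pts F" if b: "b \<in> pts ?P" for b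
  proof -
    obtain y v where yv: "y \<in> V" "v \<in> pts F" "\<psi> b = cat ?N y v" using \<psi>3(1)[OF b] unfolding W by blast
    have y: "p' b = y" using over[OF yv(1,2)] \<psi>2[OF b] yv(3) by simp
    have w: "cat ?N y v \<in> pts ?W" unfolding W using yv by blast
    have \<Phi>b: "\<Phi> (cat ?N y v) = b" using \<Phi>(2)[OF w] \<psi>2[OF b] yv(3) by simp
    have "q b i = v i" for i
    proof (cases "i < ?k")
      case True
      have "the1 (\<lambda>a. \<exists>v\<in>E {..<?k}. v \<in> pts F \<and> (\<forall>j\<in>{..<?n}. \<Phi> (cat ?N (p' b) v) j = b j) \<and> v i = a) = v i"
      proof (rule the1_equality)
        show "\<exists>u\<in>E {..<?k}. u \<in> pts F \<and> (\<forall>j\<in>{..<?n}. \<Phi> (cat ?N (p' b) u) j = b j) \<and> u i = v i"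
          using yv(2) FE \<Phi>b y by (intro bexI[of _ v]) auto
        fix a assume "\<exists>u\<in>E {..<?k}. u \<in> pts F \<and> (\<forall>j\<in>{..<?n}. \<Phi> (cat ?N (p' b) u) j = b j) \<and> u i = a"
        then obtain u where u: "u \<in> pts F" "\<forall>j\<in>{..<?n}. \<Phi> (cat ?N y u) j = b j" "u i = a" using y by blast
        have "\<Phi> (cat ?N y u) = b"
          using u(2) \<Phi>E[of "cat ?N y u"] PE b by (intro extensionalityI[of _ "{..<?n}"]) auto
        moreover have "cat ?N y u \<in> pts ?W" unfolding W using yv(1) u(1) by blast
        ultimately have "cat ?N y u = cat ?N y v" using \<psi>1 w \<Phi>b by metis
        then have "u = v" using cat_inject yv(1) VE by blast
        then show "a = v i" using u(3) by simp
      qed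
      then show ?thesis using True by (simp add: q_def)
    next
      case False
      then show ?thesis using yv(2) FE by (auto simp: q_def extensional_def)
    qed
    then have "q b = v" by blast
    then show ?thesis using yv y by simp
  qed
  define tr where "tr y b = \<Phi> (cat ?N y (q b))" for y b
  have catW: "cat ?N y (q b) \<in> pts ?W" if "y \<in> V" "b \<in> pts ?P" for y b
    unfolding W using that psi by blast
  have trP: "tr y b \<in> pts ?P" "p' (tr y b) = y" if "y \<in> V" "b \<in> pts ?P" for y b
    using catW[OF that] \<Phi> over[OF that(1)] psi[OF that(2)] unfolding tr_def total_def by auto
  have q_tr: "q (tr y b) = q b" if "y \<in> V" "b \<in> pts ?P" for y b
  proof -
    have "cat ?N (p' (tr y b)) (q (tr y b)) = cat ?N y (q b)"
      using psi[OF trP(1)[OF that]] \<psi>1[OF catW[OF that]] unfolding tr_def by simp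
    then show ?thesis using cat_inject[of y ?N y] trP(2)[OF that] that(1) VE by auto
  qed
  have "transport V tr"
    unfolding transport_def
  proof (intro conjI allI impI ballI)
    show "dvec (\<lambda>e. tr (v e) (w e))" if "dvec v" "dvec w" for v w
      unfolding tr_def by (intro dvec_comp[OF \<Phi>d] dvec_cat that dvec_comp[OF qd])
    show "tr y b \<in> E {..<?n}" for y b unfolding tr_def by (rule \<Phi>E)
    fix y b assume y: "y \<in> V" and b: "b \<in> pts B'"
    {
      assume "p' b \<in> V"
      then have bP: "b \<in> pts ?P" using b by simp
      show "tr y b \<in> pts B'" "p' (tr y b) = y" using trP[OF y bP] by auto
      show "tr (p' b) b = b"
        using psi[OF bP] \<psi>2[OF bP] \<Phi>(2)[OF catW[OF \<open>p' b \<in> V\<close> bP]] unfolding tr_def by simp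
      show "tr y' (tr y b) = tr y' b" if "y' \<in> V" for y'
        using q_tr[OF y bP] unfolding tr_def by simp
    }
    fix \<epsilon> :: 'a assume as: "p' b \<in> V \<and> \<epsilon> > 0"
    then have bP: "b \<in> pts ?P" using b by simp
    have "vcw {..<?N + ?k} (pts ?W) {..<?n} \<Phi> (cat ?N y (q b))"
      using \<Phi>(1) catW[OF y bP] unfolding total_def by (simp add: W(2))
    then obtain r where r: "r > 0" "\<And>w. w \<in> bx {..<?N + ?k} (cat ?N y (q b)) r \<Longrightarrow> w \<in> pts ?W \<Longrightarrow>
      \<Phi> w \<in> bx {..<?n} (tr y b) \<epsilon>"
      using as unfolding vcw_def nbhd_def tr_def by blast
    have "vcw {..<?n} (pts ?P) {..<?k} q b"
    proof (rule vcw_coords)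
      fix i assume "i \<in> {..<?k}"
      then have "cw {..<?n} (pts ?P) (\<lambda>b. \<psi> b (?N + i)) b" by (intro vcw_coordD[OF \<psi>3(2)[OF bP]]) auto
      then show "cw {..<?n} (pts ?P) (\<lambda>b. q b i) b"
        by (rule cw_cong[rotated 3]) (use psi bP PE in \<open>auto intro!: nbhd_all\<close>)
    qed (simp_all add: qE)
    then obtain s where s: "s > 0" "\<And>b2. b2 \<in> bx {..<?n} b s \<Longrightarrow> b2 \<in> pts ?P \<Longrightarrow> q b2 \<in> bx {..<?k} (q b) r"
      using r(1) unfolding vcw_def nbhd_def by blast
    show "\<exists>\<delta>>0. \<forall>y2\<in>bx {..<?N} y \<delta>. \<forall>b2\<in>bx {..<?n} b \<delta>.
      y2 \<in> V \<and> b2 \<in> pts B' \<and> p' b2 \<in> V \<longrightarrow> tr y2 b2 \<in> bx {..<?n} (tr y b) \<epsilon>"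
    proof (intro exI[of _ "min r s"] conjI ballI impI)
      fix y2 b2 assume 2: "y2 \<in> bx {..<?N} y (min r s)" "b2 \<in> bx {..<?n} b (min r s)" "y2 \<in> V \<and> b2 \<in> pts B' \<and> p' b2 \<in> V"
      then have b2: "b2 \<in> pts ?P" by simp
      have q2: "q b2 \<in> bx {..<?k} (q b) r" using s(2)[OF _ b2] 2(2) by simp
      have "\<bar>cat ?N y2 (q b2) i - cat ?N y (q b) i\<bar> < r" if "i < ?N + ?k" for i
        using that q2 2(1) by (cases "i < ?N") (auto simp: cat_def bx_def)
      then have "cat ?N y2 (q b2) \<in> bx {..<?N + ?k} (cat ?N y (q b)) r"
        using cat_in_E[OF qE] by (simp add: bx_def)
      from r(2)[OF this catW[OF _ b2]] show "tr y2 b2 \<in> bx {..<?n} (tr y b) \<epsilon>"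
        using 2(3) unfolding tr_def[of y2] by blast
    qed (use r(1) s(1) in simp)
  qed
  then show "\<exists>tr. transport V tr" by blast
qed

definition liftable :: "((nat \<Rightarrow> 'a) \<Rightarrow> 'a) \<Rightarrow> bool" where
  "liftable S \<longleftrightarrow> dfun S \<and> (\<forall>x\<in>pts X. cw {..<dim X} (pts X) S x \<and> 0 \<le> S x \<and> S x \<le> 1) \<and> (\<exists>H. Lift S H)"

text \<open>Invariant: on \<open>U\<close> the lift already reaches
  \<open>min (u x) (\<sigma> x)\<close>. Each step replaces \<open>\<sigma>\<close> by the next time
  \<open>\<tau>\<close> and raises \<open>S\<close> to match; at the end \<open>\<sigma>\<close> is
  1, so \<open>u\<close> itself is reached.\<close>

lemma chain_lift:
  assumes Vs: "\<And>V. V \<in> \<V> \<Longrightarrow> dset {..<dim X'} V" "\<And>V y. V \<in> \<V> \<Longrightarrow> y \<in> V \<Longrightarrow> nbhd {..<dim X'} (\<lambda>z. z \<in> pts X' \<longrightarrow> z \<in> V) y"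
      "\<And>V. V \<in> \<V> \<Longrightarrow> \<exists>tr. transport V tr"
    and U: "dpred U" "\<And>x. x \<in> E {..<dim X} \<Longrightarrow> U x \<Longrightarrow> nbhd {..<dim X} U x"
    and u: "dfun u" "\<And>x. x \<in> pts X \<Longrightarrow> cw {..<dim X} (pts X) u x" "\<And>x. x \<in> pts X \<Longrightarrow> 0 \<le> u x \<and> u x \<le> 1"
      "\<And>x. x \<in> pts X \<Longrightarrow> \<not> U x \<Longrightarrow> nbhd {..<dim X} (\<lambda>y. y \<in> pts X \<longrightarrow> u y = 0) x"
    and ps: "chain {..<dim X} pullback U \<sigma> ps" "snd ` set ps \<subseteq> \<V>"
    and \<sigma>: "\<And>x. x \<in> pts X \<Longrightarrow> U x \<Longrightarrow> 0 \<le> \<sigma> x \<and> cont_at {..<dim X} \<sigma> x"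
    and S: "liftable S" "\<And>x. x \<in> pts X \<Longrightarrow> U x \<Longrightarrow> min (u x) (\<sigma> x) \<le> S x"
  shows "\<exists>S'. liftable S' \<and> (\<forall>x\<in>pts X. S x \<le> S' x \<and> u x \<le> S' x)"
  using ps \<sigma> S
proof (induction ps arbitrary: \<sigma> S)
  case Nil
  have "u x \<le> S x" if x: "x \<in> pts X" for x
  proof (cases "U x")
    case True
    then have "\<sigma> x = 1" using Nil(1) x XE by auto
    then show ?thesis using Nil(5)[OF x True] u(3)[OF x] by simp
  next
    case False
    have "u x = 0" using nbhd_self[OF u(4)[OF x False]] x XE by blast
    then show ?thesis using Nil(4) x unfolding liftable_def by simp
  qed
  then show ?case using Nil(4) by blast
next
  case (Cons s ps)
  let ?N = "{..<dim X}"
  obtain \<tau> V where s: "s = (\<tau>, V)" by (metis prod.collapse)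
  have V: "V \<in> \<V>" using Cons(3) s by auto
  have c: "dfun \<tau>" "chain ?N pullback U \<tau> ps" "\<And>x. x \<in> pts X \<Longrightarrow> U x \<Longrightarrow> cont_at ?N \<tau> x \<and> \<sigma> x \<le> \<tau> x"
    "\<And>x t. x \<in> pts X \<Longrightarrow> U x \<Longrightarrow> \<sigma> x \<le> t \<Longrightarrow> t \<le> \<tau> x \<Longrightarrow> t \<in> pullback V x"
    using Cons(2) s XE by auto
  have L: "dfun S" "\<And>x. x \<in> pts X \<Longrightarrow> cw ?N (pts X) S x" "\<And>x. x \<in> pts X \<Longrightarrow> 0 \<le> S x \<and> S x \<le> 1"
    using Cons(5) unfolding liftable_def by blast+
  obtain H where H: "Lift S H" using Cons(5) unfolding liftable_def by blast
  have \<tau>0: "0 \<le> \<tau> x" if "x \<in> pts X" "U x" for x using c(3)[OF that] Cons(4)[OF that] by auto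
  \<comment> \<open>The extension by 0 is continuous on X because \<open>u\<close> vanishes near
    every point of X outside \<open>U\<close>.\<close>
  define v where "v x = (if U x then min (u x) (\<tau> x) else 0)" for x
  define S1 where "S1 x = max (S x) (v x)" for x
  have v_cw: "cw ?N (pts X) v x" if x: "x \<in> pts X" for x
  proof (cases "U x")
    case True
    have "nbhd ?N (\<lambda>y. y \<in> pts X \<longrightarrow> v y = min (u y) (\<tau> y)) x"
      by (rule nbhd_mono[OF U(2)[OF _ True]]) (use x XE in \<open>auto simp: v_def\<close>)
    then show ?thesis
      by (rule cw_cong[OF _ x _ cw_min[OF u(2)[OF x] cw_cont_at]]) (use x XE c(3)[OF x True] in auto)
  next
    case False
    have "nbhd ?N (\<lambda>y. y \<in> pts X \<longrightarrow> v y = 0) x"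
      by (rule nbhd_mono[OF u(4)[OF x False]]) (use \<tau>0 in \<open>auto simp: v_def min_absorb1\<close>)
    then show ?thesis by (rule cw_cong[OF _ x _ cw_const]) (use x XE in auto)
  qed
  have v1: "v x \<le> 1" if "x \<in> pts X" for x using u(3)[OF that] by (auto simp: v_def min_le_iff_disj)
  have S1d: "dfun S1" unfolding S1_def v_def
    by (intro dfun_max dfun_if L(1) U(1) dfun_min u(1) c(1) dfun_const)
  have S1c: "cw ?N (pts X) S1 x" if "x \<in> pts X" for x unfolding S1_def by (intro cw_max L(2) v_cw that)
  have S1b: "0 \<le> S x \<and> S x \<le> S1 x \<and> S1 x \<le> 1" if "x \<in> pts X" for x
    using L(3)[OF that] v1[OF that] by (auto simp: S1_def)
  have near: "nbhd ?N (\<lambda>y. y \<in> pts X \<longrightarrow> S y = S1 y) x"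
    if "nbhd ?N (\<lambda>y. y \<in> pts X \<longrightarrow> v y \<le> S y) x" for x
    using that by (rule nbhd_mono) (auto simp: S1_def max_absorb1)
  have step: "nbhd ?N (\<lambda>y. y \<in> pts X \<longrightarrow> S y = S1 y) x \<or> (\<forall>t. S x \<le> t \<and> t \<le> S1 x \<longrightarrow> ht (x(dim X := t)) \<in> V)"
    if x: "x \<in> pts X" for x
  proof (cases "U x")
    case False
    have "nbhd ?N (\<lambda>y. y \<in> pts X \<longrightarrow> v y \<le> S y) x"
      by (rule nbhd_mono[OF u(4)[OF x False]]) (use L(3) in \<open>auto simp: v_def min_le_iff_disj\<close>)
    then show ?thesis using near by blast
  next
    case True
    have xE: "x \<in> E ?N" using x XE by blast
    note Un = U(2)[OF xE True]
    \<comment> \<open>The alternative required by \<open>lift_step\<close>. Below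
      \<open>\<sigma>\<close> the invariant forces \<open>u \<le> S\<close> nearby, and above
      \<open>\<tau>\<close> nearby \<open>v \<le> \<tau> < S\<close>, so nothing is raised; in
      between the path runs inside \<open>V\<close>.\<close>
    consider "S x < \<sigma> x" | "\<tau> x < S x" | "\<sigma> x \<le> S x" "S x \<le> \<tau> x" by linarith
    then show ?thesis
    proof cases
      case 1
      have "nbhd ?N (\<lambda>y. y \<in> pts X \<longrightarrow> S y < \<sigma> y) x"
        by (rule cw_less[OF L(2)[OF x] cw_cont_at[of _ \<sigma>] 1]) (use Cons(4)[OF x True] in blast)
      from nbhd_conj[OF this Un] have "nbhd ?N (\<lambda>y. y \<in> pts X \<longrightarrow> v y \<le> S y) x"
      proof (rule nbhd_mono, intro impI)
        fix y assume *: "(y \<in> pts X \<longrightarrow> S y < \<sigma> y) \<and> U y" and y: "y \<in> pts X"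
        have "min (u y) (\<sigma> y) \<le> S y" using Cons(6)[OF y] * by blast
        then have "u y \<le> S y" using * y by (auto simp: min_le_iff_disj)
        then show "v y \<le> S y" using * by (auto simp: v_def min_le_iff_disj)
      qed
      then show ?thesis using near by blast
    next
      case 2
      have "nbhd ?N (\<lambda>y. y \<in> pts X \<longrightarrow> \<tau> y < S y) x"
        by (rule cw_less[OF cw_cont_at[of _ \<tau>] L(2)[OF x] 2]) (use c(3)[OF x True] in blast)
      from nbhd_conj[OF this Un] have "nbhd ?N (\<lambda>y. y \<in> pts X \<longrightarrow> v y \<le> S y) x"
        by (rule nbhd_mono) (auto simp: v_def min_le_iff_disj)
      then show ?thesis using near by blast
    next
      case 3
      have "ht (x(dim X := t)) \<in> V" if t: "S x \<le> t" "t \<le> S1 x" for t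
      proof -
        have "S1 x \<le> \<tau> x" using 3 True by (auto simp: S1_def v_def min_le_iff_disj)
        then have "t \<in> pullback V x" using c(4)[OF x True] 3 t by auto
        then show ?thesis using pullback_iff[OF Vs(2)[OF V] x, of t] S1b[OF x] t by auto
      qed
      then show ?thesis by blast
    qed
  qed
  obtain tr where tr: "transport V tr" using Vs(3)[OF V] by blast
  have "\<exists>H. Lift S1 H"
    by (rule lift_step[OF H L(2,1) S1c S1d S1b Vs(1)[OF V] Vs(2)[OF V] tr step])
  then have S1L: "liftable S1" unfolding liftable_def using S1d S1c S1b by (meson order_trans)
  have "\<exists>S'. liftable S' \<and> (\<forall>x\<in>pts X. S1 x \<le> S' x \<and> u x \<le> S' x)"
  proof (rule Cons(1)[OF c(2) _ _ S1L])
    show "snd ` set ps \<subseteq> \<V>" using Cons(3) by auto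
    show "0 \<le> \<tau> x \<and> cont_at ?N \<tau> x" if "x \<in> pts X" "U x" for x using \<tau>0[OF that] c(3)[OF that] by blast
    show "min (u x) (\<tau> x) \<le> S1 x" if "x \<in> pts X" "U x" for x using that by (simp add: S1_def v_def)
  qed
  then show ?case using S1b by (meson order_trans)
qed

text \<open>The domains are handled one after another while the stopping time never decreases. It
  finally dominates every cutoff, one of which is 1 at each point.\<close>

lemma full_lift:
  assumes fin: "finite \<V>" and cov: "pts X' \<subseteq> \<Union>\<V>"
    and Vs: "\<And>V. V \<in> \<V> \<Longrightarrow> dset {..<dim X'} V" "\<And>V y. V \<in> \<V> \<Longrightarrow> y \<in> V \<Longrightarrow> nbhd {..<dim X'} (\<lambda>z. z \<in> pts X' \<longrightarrow> z \<in> V) y"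
      "\<And>V. V \<in> \<V> \<Longrightarrow> \<exists>tr. transport V tr"
  obtains S H where "Lift S H" "\<And>x. x \<in> pts X \<Longrightarrow> S x = 1"
proof -
  let ?N = "{..<dim X}"
  have ex: "\<exists>V\<in>\<V>. t \<in> pullback V x" if x: "x \<in> pts X" and t: "0 \<le> t" "t \<le> 1" for x t
  proof -
    obtain V where V: "V \<in> \<V>" "ht (x(dim X := t)) \<in> V" using htX'[OF x t] cov by blast
    then show ?thesis using pullback_iff[OF Vs(2)[OF V(1)] x t] by blast
  qed
  obtain C where C: "finite C" "\<And>U ps. (U, ps) \<in> C \<Longrightarrow> dpred U" "\<And>U ps x. (U, ps) \<in> C \<Longrightarrow> x \<in> E ?N \<Longrightarrow> U x \<Longrightarrow> nbhd ?N U x"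
    "\<And>U ps. (U, ps) \<in> C \<Longrightarrow> chain ?N pullback U (\<lambda>_. 0) ps" "\<And>U ps. (U, ps) \<in> C \<Longrightarrow> snd ` set ps \<subseteq> \<V>"
    "\<And>x. x \<in> pts X \<Longrightarrow> \<exists>U ps. (U, ps) \<in> C \<and> U x"
    by (rule covering[OF finite_lessThan fin dfam_pullback[OF Vs(1)] open_fam_pullback XE ex],
        assumption, assumption, assumption, assumption, rule that)
  have C1: "dpred U" "x \<in> E ?N \<Longrightarrow> U x \<Longrightarrow> nbhd ?N U x" if "U \<in> fst ` C" for U x
    using that C(2,3)[of U] by fastforce+
  have C2: "\<exists>U\<in>fst ` C. U x" if x: "x \<in> pts X" for x
  proof -
    obtain U ps where Ux: "(U, ps) \<in> C" "U x" using C(6)[OF x] by blast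
    then have "U \<in> fst ` C" by (metis fst_conv imageI)
    then show ?thesis using Ux(2) by blast
  qed
  obtain u where u: "\<And>U. U \<in> fst ` C \<Longrightarrow> dfun (u U)" "\<And>U x. U \<in> fst ` C \<Longrightarrow> x \<in> pts X \<Longrightarrow> cw ?N (pts X) (u U) x"
    "\<And>U x. U \<in> fst ` C \<Longrightarrow> x \<in> pts X \<Longrightarrow> 0 \<le> u U x \<and> u U x \<le> 1"
    "\<And>U x. U \<in> fst ` C \<Longrightarrow> x \<in> pts X \<Longrightarrow> \<not> U x \<Longrightarrow> nbhd ?N (\<lambda>y. y \<in> pts X \<longrightarrow> u U y = 0) x"
    "\<And>x. x \<in> pts X \<Longrightarrow> \<exists>U\<in>fst ` C. u U x = 1"
    by (rule cutoffs[OF finite_lessThan finite_imageI[OF C(1)] C1 XE C2], assumption+, rule that)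
  have "\<exists>S. liftable S \<and> (\<forall>(U, ps)\<in>D. \<forall>x\<in>pts X. u U x \<le> S x)" if "finite D" "D \<subseteq> C" for D
    using that
  proof (induction D rule: finite_induct)
    case empty
    have "liftable (\<lambda>_. 0)" unfolding liftable_def using lift_base by (auto intro: dfun_const cw_const)
    then show ?case by blast
  next
    case (insert q D)
    then obtain S where S: "liftable S" "\<forall>(U, ps)\<in>D. \<forall>x\<in>pts X. u U x \<le> S x" by auto
    obtain U ps where q: "q = (U, ps)" by fastforce
    then have qC: "(U, ps) \<in> C" and UC: "U \<in> fst ` C" using insert(4) by force+
    have c0: "0 \<le> (0::'a) \<and> cont_at ?N (\<lambda>_. 0) x" for x unfolding cont_at_def by (auto intro!: exI[of _ 1])
    have m0: "min (u U x) 0 \<le> S x" if "x \<in> pts X" for x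
      using S(1) that unfolding liftable_def by (auto simp: min_le_iff_disj)
    have "\<exists>S'. liftable S' \<and> (\<forall>x\<in>pts X. S x \<le> S' x \<and> u U x \<le> S' x)"
      by (rule chain_lift[OF Vs C(2)[OF qC] C(3)[OF qC] u(1-4)[OF UC] C(4)[OF qC] C(5)[OF qC] c0 S(1) m0])
    then obtain S' where "liftable S'" "\<forall>x\<in>pts X. S x \<le> S' x \<and> u U x \<le> S' x" by blast
    then show ?case using S(2) q by (intro exI[of _ S']) (fastforce intro: order_trans)
  qed
  from this[OF C(1) order_refl] obtain S where S: "liftable S" "\<forall>(U, ps)\<in>C. \<forall>x\<in>pts X. u U x \<le> S x" by blast
  have "S x = 1" if x: "x \<in> pts X" for x
  proof -
    obtain U where "U \<in> fst ` C" "u U x = 1" using u(5)[OF x] by blast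
    then have "1 \<le> S x" using S(2) x by fastforce
    then show ?thesis using S(1) x unfolding liftable_def by (simp add: order_antisym)
  qed
  then show ?thesis using that S(1) unfolding liftable_def by blast
qed

end

context o_minimal_expansion begin

lemma definable_slice:
  assumes A: "dset {..<dim A} (pts A)" and C: "dset {..<dim C} (pts C)" and K: "total (A \<otimes> unit_I) C K"
    and k: "\<And>z. z \<in> pts (A \<otimes> unit_I) \<Longrightarrow> k z = K z" and t: "0 \<le> t" "t \<le> 1"
  shows "definable_map M A C (slice A k t)"
proof (rule definable_mapI[OF A C, where g = "\<lambda>x. K (x(dim A := t))"])
  have AE: "pts A \<subseteq> E {..<dim A}" by (rule dset_subset[OF A])
  have in_I: "x(dim A := t) \<in> pts (A \<otimes> unit_I)" if "x \<in> pts A" for x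
    unfolding pts_prod_I[OF AE] using that t by blast
  show "slice A k t x = K (x(dim A := t))" if x: "x \<in> pts A" for x
  proof -
    have "cat (dim A) x (vec1 t) = x(dim A := t)" using x AE by (intro cat_vec1) blast
    then show ?thesis unfolding slice_def using k[OF in_I[OF x]] by simp
  qed
  have Kd: "dvec K" using K by (simp add: total_def)
  have v: "vcw {..<dim A} (pts A) {..<Suc (dim A)} (\<lambda>x. x(dim A := t)) x" for x
  proof (rule vcw_coords)
    fix i assume "i \<in> {..<Suc (dim A)}"
    then show "cw {..<dim A} (pts A) (\<lambda>y. (y(dim A := t)) i) x"
      by (cases "i = dim A") (auto intro: cw_const cw_coord)
  next
    fix y assume "y \<in> pts A"
    then have "y \<in> E {..<dim A}" using AE by blast
    then show "y(dim A := t) \<in> E {..<Suc (dim A)}" by (auto simp: extensional_def)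
  qed simp
  have "vcw {..<dim A} (pts A) {..<dim C} (\<lambda>x. K (x(dim A := t))) x" if "x \<in> pts A" for x
    by (rule vcw_comp[OF v, of "pts (A \<otimes> unit_I)"]) (use K in_I that in \<open>auto simp: total_def\<close>)
  moreover have "dvec (\<lambda>x. K (x(dim A := t)))" by (intro dvec_comp[OF Kd] d_intros)
  ultimately show "total A C (\<lambda>x. K (x(dim A := t)))"
    using K in_I unfolding total_def by auto
qed

end

theorem theorem2p14:
  fixes M :: "('a::{real_closed_field, linorder_topology}, 'f, 'r) expansion"
    and B X F B' X' :: "'a rset"
    and p p' f fbar htilde :: "(nat \<Rightarrow> 'a) \<Rightarrow> nat \<Rightarrow> 'a"
  assumes "o_minimal M"
    and "definable_fibre_bundle M (B, X, p, F)"
    and "definable_fibre_bundle M (B', X', p', F)"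
    and "bundle_map_over M (B, X, p, F) (B', X', p', F) f fbar"
    and "definable_map M (X \<otimes> unit_I) X' htilde"
    and "\<forall>x\<in>pts X. slice X htilde 0 x = fbar x"
  shows "\<exists>h. bundle_homotopy M (B, X, p, F) (B', X', p', F) h \<and>
      (\<forall>b\<in>pts B. slice B h 0 b = f b) \<and>
      induced_homotopy M (B, X, p, F) (B', X', p', F) h htilde \<and>
      stationary_with (B, X, p, F) h htilde"
proof -
  interpret o_minimal_expansion M by unfold_locales (rule assms(1))
  have ds: "dset {..<dim B} (pts B)" "dset {..<dim X} (pts X)" "dset {..<dim B'} (pts B')" "dset {..<dim X'} (pts X')"
    using assms(2,3) by (auto simp: definable_map_def definable_iff_dset)
  note BE = dset_subset[OF ds(1)] and XE = dset_subset[OF ds(2)]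
  have maps: "definable_map M B X p" "definable_map M B' X' p'" "definable_map M B B' f"
    using assms(2-4) by simp_all
  \<comment> \<open>Total versions replace the given maps in the construction; they agree with these
    on the relevant sets, which is how the result is carried back.\<close>
  obtain P where P: "total B X P" "\<And>b. b \<in> pts B \<Longrightarrow> P b = p b"
    by (rule definable_mapE[OF maps(1)]) (rule that)
  obtain P' where P': "total B' X' P'" "\<And>b. b \<in> pts B' \<Longrightarrow> P' b = p' b"
    by (rule definable_mapE[OF maps(2)]) (rule that)
  obtain f' where f': "total B B' f'" "\<And>b. b \<in> pts B \<Longrightarrow> f' b = f b"
    by (rule definable_mapE[OF maps(3)]) (rule that)
  obtain ht where htt: "total (X \<otimes> unit_I) X' ht" "\<And>z. z \<in> pts (X \<otimes> unit_I) \<Longrightarrow> ht z = htilde z"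
    by (rule definable_mapE[OF assms(5)]) (rule that)
  have p_X: "p b \<in> pts X" if "b \<in> pts B" for b using P that by (metis total_def)
  have fB': "f b \<in> pts B'" if "b \<in> pts B" for b using f' that by (metis total_def)
  have pre: "preim B P U = preim B p U" for U unfolding preim_def using P(2) by (auto cong: conj_cong)
  have pre': "preim B' P' U = preim B' p' U" for U unfolding preim_def using P'(2) by (auto cong: conj_cong)
  have sl: "slice X htilde t x = ht (x(dim X := t))" if x: "x \<in> pts X" and t: "0 \<le> t" "t \<le> 1" for x t
  proof -
    have "x(dim X := t) \<in> pts (X \<otimes> unit_I)" unfolding pts_prod_I[OF XE] using x t by blast
    moreover have "cat (dim X) x (vec1 t) = x(dim X := t)" using x XE by (intro cat_vec1) blast
    ultimately show ?thesis unfolding slice_def using htt(2) by simp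
  qed
  have h0: "ht (x(dim X := 0)) = fbar x" if "x \<in> pts X" for x
    using sl[OF that, of 0] assms(6) that by simp
  have tsB: "topspace (top_of (preim B p {x})) = {b \<in> pts B. p b = x}" for x
    using topspace_top_of[of "preim B p {x}"] BE by auto
  interpret bundle_lift M B X B' X' P P' f' ht
  proof unfold_locales
    show "P' (f' b) = ht ((P b)(dim X := 0))" if b: "b \<in> pts B" for b
      using assms(4) b h0[OF p_X[OF b]] P(2) P'(2)[OF fB'[OF b]] f'(2) by simp
    show "homeomorphic_map (top_of (preim B P {x})) (top_of (preim B' P' {ht (x(dim X := 0))})) f'" if x: "x \<in> pts X" for x
      unfolding pre pre' h0[OF x]
    proof (rule homeomorphic_map_eq)
      show "homeomorphic_map (top_of (preim B p {x})) (top_of (preim B' p' {fbar x})) f"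
        using assms(4) x by simp
    qed (use f'(2) tsB in auto)
  qed (rule ds P(1) P'(1) f'(1) htt(1))+
  obtain \<V> where \<V>: "finite \<V>" "\<Union>\<V> = pts X'" "\<And>V. V \<in> \<V> \<Longrightarrow> definable M (RSet (dim X') V)"
    "\<And>V. V \<in> \<V> \<Longrightarrow> openin (top_of X') V"
    "\<And>V. V \<in> \<V> \<Longrightarrow> \<exists>\<phi>. definable_homeo M (RSet (dim X') V \<otimes> F) (preim B' p' V) \<phi> \<and>
      (\<forall>x\<in>V. \<forall>v\<in>pts F. p' (\<phi> (cat (dim X') x v)) = x)"
    using assms(3) by auto
  have F: "definable M F" using assms(2) by simp
  have chart: "dset {..<dim X'} V \<and> (\<forall>y\<in>V. nbhd {..<dim X'} (\<lambda>z. z \<in> pts X' \<longrightarrow> z \<in> V) y) \<and> (\<exists>tr. transport V tr)"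
    if V: "V \<in> \<V>" for V
  proof -
    obtain \<phi> where \<phi>: "definable_homeo M (RSet (dim X') V \<otimes> F) (preim B' P' V) \<phi>"
      "\<And>x v. x \<in> V \<Longrightarrow> v \<in> pts F \<Longrightarrow> p' (\<phi> (cat (dim X') x v)) = x"
      using \<V>(5)[OF V] unfolding pre' by blast
    have "continuous_map (top_of (RSet (dim X') V \<otimes> F)) (top_of (preim B' P' V)) \<phi>"
      using \<phi>(1) by (simp add: definable_homeo_def definable_map_def)
    moreover have "pts (RSet (dim X') V \<otimes> F) \<subseteq> E {..<dim (RSet (dim X') V \<otimes> F)}"
      "pts (preim B' P' V) \<subseteq> E {..<dim (preim B' P' V)}"
      using \<phi>(1) dset_subset unfolding definable_homeo_def definable_map_def definable_iff_dset by blast+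
    ultimately have "\<phi> w \<in> pts (preim B' P' V)" if "w \<in> pts (RSet (dim X') V \<otimes> F)" for w
      using that by (simp add: continuous_map_top_of)
    \<comment> \<open>The chart condition is given for \<open>p'\<close>. It passes to
      \<open>P'\<close> because the chart takes its values in \<open>pts B'\<close>, where both
      agree.\<close>
    then have "P' (\<phi> (cat (dim X') x v)) = x" if "x \<in> V" "v \<in> pts F" for x v
      using \<phi>(2)[OF that] P'(2) that by (force simp: rprod_def)
    from chart_transport[OF \<V>(3,4)[OF V] F \<phi>(1) this] show ?thesis by blast
  qed
  obtain S H where SH: "Lift S H" "\<And>x. x \<in> pts X \<Longrightarrow> S x = 1"
    by (rule full_lift[OF \<V>(1)]) (use \<V>(2) chart that in blast)+
  have H1: "total (B \<otimes> unit_I) B' H" using SH(1) unfolding Lift_def by blast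
  have H2: "p' (H (b(dim B := t))) = ht ((p b)(dim X := t))" if b: "b \<in> pts B" and t: "0 \<le> t" "t \<le> 1" for b t
  proof -
    have "b(dim B := t) \<in> BI" unfolding BI_iff using b t by blast
    then have "H (b(dim B := t)) \<in> pts B'" using H1 unfolding total_def by blast
    moreover have "P' (H (b(dim B := t))) = ht ((P b)(dim X := min t (S (P b))))"
      using SH(1) b t unfolding Lift_def by blast
    ultimately show ?thesis using P(2)[OF b] P'(2) SH(2)[OF p_X[OF b]] t by (simp add: min_absorb1)
  qed
  have H3: "H (b(dim B := 0)) = f b" if "b \<in> pts B" for b
    using SH(1) that f'(2) unfolding Lift_def by simp
  have H4: "homeomorphic_map (top_of (preim B p {x})) (top_of (preim B' p' {ht (x(dim X := t))})) (\<lambda>b. H (b(dim B := t)))"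
    if x: "x \<in> pts X" and t: "0 \<le> t" "t \<le> 1" for x t
  proof -
    have "min t (S x) = t" using SH(2)[OF x] t by (simp add: min_absorb1)
    then show ?thesis using SH(1) x t unfolding Lift_def pre pre' by metis
  qed
  have H5: "H (b(dim B := t1)) = H (b(dim B := t2))" if b: "b \<in> pts B" and t: "0 \<le> t1" "t1 \<le> t2" "t2 \<le> 1"
    and c: "\<And>t. t1 \<le> t \<Longrightarrow> t \<le> t2 \<Longrightarrow> ht ((p b)(dim X := t)) = ht ((p b)(dim X := t1))" for b t1 t2
    using SH(1) b t c P(2)[OF b] unfolding Lift_def by metis
  have slB: "slice B H t b = H (b(dim B := t))" if "b \<in> pts B" for b t
  proof -
    have "cat (dim B) b (vec1 t) = b(dim B := t)" using that BE by (intro cat_vec1) blast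
    then show ?thesis by (simp add: slice_def)
  qed
  have ind: "bundle_map_over M (B, X, p, F) (B', X', p', F) (slice B H t) (slice X htilde t)"
    if t: "0 \<le> t" "t \<le> 1" for t
    unfolding bundle_map_over.simps
  proof (intro conjI ballI)
    show "definable_map M B B' (slice B H t)" by (rule definable_slice[OF ds(1,3) H1 refl t])
    show "definable_map M X X' (slice X htilde t)"
      by (rule definable_slice[OF ds(2,4) htt(1) _ t]) (simp add: htt(2))
    show "p' (slice B H t b) = slice X htilde t (p b)" if b: "b \<in> pts B" for b
      using H2[OF b t] slB[OF b] sl[OF p_X[OF b] t] by simp
    show "homeomorphic_map (top_of (preim B p {x})) (top_of (preim B' p' {slice X htilde t x})) (slice B H t)"
      if x: "x \<in> pts X" for x
      unfolding sl[OF x t] by (rule homeomorphic_map_eq[OF H4[OF x t]]) (use slB tsB in auto)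
  qed
  have "definable_map M (B \<otimes> unit_I) B' H"
    by (rule definable_mapI[OF dset_prod_I[OF ds(1)] ds(3) H1 refl])
  then have "bundle_homotopy M (B, X, p, F) (B', X', p', F) H"
    using ind unfolding bundle_homotopy.simps by (metis atLeastAtMost_iff)
  moreover have "\<forall>b\<in>pts B. slice B H 0 b = f b" using slB H3 by simp
  moreover have "induced_homotopy M (B, X, p, F) (B', X', p', F) H htilde"
    using ind by (simp del: bundle_map_over.simps)
  moreover have "stationary_with (B, X, p, F) H htilde"
    unfolding stationary_with.simps
  proof (intro allI impI ballI)
    fix t1 t2 :: 'a and b assume t: "0 \<le> t1 \<and> t1 \<le> t2 \<and> t2 \<le> 1" and b: "b \<in> pts B"
    have eq: "slice X htilde t (p b) = ht ((p b)(dim X := t))" if "t \<in> {t1..t2}" for t :: 'a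
      using that t by (intro sl[OF p_X[OF b]]) auto
    show "(\<lambda>t. slice B H t b) constant_on {t1..t2} \<longleftrightarrow> (\<lambda>t. slice X htilde t (p b)) constant_on {t1..t2}"
    proof
      \<comment> \<open>This direction holds for any lift, by projecting with \<open>p'\<close>; the
        converse is the resting property built into \<open>Lift\<close>.\<close>
      assume "(\<lambda>t. slice B H t b) constant_on {t1..t2}"
      then obtain c where c: "\<And>t. t \<in> {t1..t2} \<Longrightarrow> H (b(dim B := t)) = c"
        unfolding constant_on_def slB[OF b] by blast
      have "slice X htilde t (p b) = p' c" if tt: "t \<in> {t1..t2}" for t
        using eq[OF tt] H2[OF b, of t] c[OF tt] tt t by auto
      then show "(\<lambda>t. slice X htilde t (p b)) constant_on {t1..t2}" unfolding constant_on_def by blast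
    next
      assume "(\<lambda>t. slice X htilde t (p b)) constant_on {t1..t2}"
      then obtain c where c: "\<And>t. t \<in> {t1..t2} \<Longrightarrow> ht ((p b)(dim X := t)) = c"
        unfolding constant_on_def using eq by metis
      have "slice B H s b = H (b(dim B := t1))" if s: "s \<in> {t1..t2}" for s
        unfolding slB[OF b]
      proof (rule H5[OF b, symmetric])
        show "ht ((p b)(dim X := t)) = ht ((p b)(dim X := t1))" if "t1 \<le> t" "t \<le> s" for t
          using c[of t] c[of t1] that s by auto
      qed (use s t in auto)
      then show "(\<lambda>t. slice B H t b) constant_on {t1..t2}" unfolding constant_on_def by blast
    qed
  qed
  ultimately show ?thesis by blast
qed

end
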